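(* Let $\beta^2=1-e^2$, and let the restitution coefficient $e$ and the random variable $\eta$ be chosen so that $\mathfrak A(2,e,\eta)>1$ but $\mathfrak A(\alpha,e,\eta)<1$ for some $0<\alpha<2$, where $$\mathfrak A(\alpha,e,\eta)=\frac{2}{4+\alpha}\left\langle\left(\frac{1+\tilde e}{2}\right)^{2+\alpha}+\frac{1-\left|\frac{1-\tilde e}{2}\right|^{4+\alpha}}{1-\left|\frac{1-\tilde e}{2}\right|^{2}}\right\rangle.$$ Then the unique isotropic steady state $f_\infty$ in $\mathcal P_2(\mathbb R^3)$ of the equation $$\frac{\partial f}{\partial t}=\tilde Q_e(f,f)$$ with zero mean velocity and unit pressure tensor has unbounded fourth moment, i.e. $\int_{\mathbb R^3}|v|^4\,f_\infty(v)\,dv=+\infty$.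
   Context: $\mathcal P_2(\mathbb R^3)$ is the set of Borel probability measures on $\mathbb R^3$ with finite second moment (written as densities $f(v)\,dv$ even if not absolutely continuous). Zero mean velocity: $\int v f(v)\,dv=0$; unit pressure tensor: $\int v\otimes v\,f(v)\,dv=\mathrm{Id}$; isotropic: invariant under rotations. Let $0\le e\le 1$ and let $\eta$ be a real random variable with law a probability measure $\mu$ supported in $[-e,\infty)$, with $\langle\eta\rangle=0$ and $\langle\eta^2\rangle=\beta^2$, where $\langle\cdot\rangle$ denotes expectation with respect to $\eta$ (integration against $\mu$). Put $\tilde e=e+\eta\ge0$. In the formula for $\mathfrak A$ the quotient is understood by continuity when $|1-\tilde e|=2$. For $v,w\in\mathbb R^3$, $\sigma\in S^2$, the post-collision velocity is $$v'=\tfrac12(v+w)+\tfrac{1-\tilde e}{4}(v-w)+\tfrac{1+\tilde e}{4}|v-w|\sigma .$$ The collision operator is defined weakly by $$(\varphi,\tilde Q_e(f,f))=\frac1{4\pi}\Big\langle\int_{\mathbb R^3}\int_{\mathbb R^3}\int_{S^2} f(v)f(w)\,[\varphi(v')-\varphi(v)]\,d\sigma\,dv\,dw\Big\rangle$$ for test functions $\varphi$ (e.g. bounded continuous). A steady state is a probability measure $f_\infty$ with $(\varphi,\tilde Q_e(f_\infty,f_\infty))=0$ for all such $\varphi$. The condition $\beta^2=1-e^2$ is the "conservative in the mean" case. *)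

theory Defs
  imports "HOL-Probability.Probability"
begin

text \<open>
  Surface measure \<open>d\<sigma>\<close> on the unit sphere, obtained from polar coordinates: integrating
  \<open>r\<^sup>2\<close> over \<open>[0,1]\<close> gives \<open>1/3\<close>, so the radial projection of Lebesgue measure on the unit
  ball is \<open>d\<sigma>/3\<close>.  The function \<open>sgn\<close> is \<open>x \<mapsto> x / |x|\<close> away from the origin.
\<close>

definition sphere_measure :: "(real^3) measure" where
  "sphere_measure = distr (density lborel (\<lambda>x. 3 * indicator (ball 0 1) x)) borel sgn"

lemma borel_measurable_ball_density [measurable]:
  "(\<lambda>x::real^3. 3 * indicator (ball 0 1) x :: ennreal) \<in> borel_measurable borel"
  by (intro borel_measurable_times_ennreal borel_measurable_const borel_measurable_indicator) simp

lemma emeasure_sphere_measure_UNIV: "emeasure sphere_measure UNIV = ennreal (4 * pi)"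
proof -
  have [measurable]: "(sgn :: real^3 \<Rightarrow> real^3) \<in> borel_measurable borel"
    unfolding sgn_div_norm[abs_def] by measurable
  have "emeasure sphere_measure UNIV =
      (\<integral>\<^sup>+x. 3 * indicator (ball (0::real^3) 1) x \<partial>lborel)"
    by (simp add: sphere_measure_def emeasure_distr)
       (subst emeasure_density, simp_all)
  also have "\<dots> = 3 * emeasure lborel (ball (0::real^3) 1)"
    by (rule nn_integral_cmult_indicator) simp
  also have "\<dots> = ennreal 3 * ennreal (4 / 3 * pi)"
    by (subst emeasure_ball) (simp_all add: unit_ball_vol_3)
  also have "\<dots> = ennreal (3 * (4 / 3 * pi))"
    by (rule ennreal_mult [symmetric]) simp_all
  finally show ?thesis by simp
qed

lemma AE_sphere_measure: "AE x in sphere_measure. norm x = 1"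
proof -
  have [measurable]: "(sgn :: real^3 \<Rightarrow> real^3) \<in> borel_measurable borel"
    unfolding sgn_div_norm[abs_def] by measurable
  have "AE x in lborel. (x::real^3) \<noteq> 0"
    by (rule AE_lborel_singleton)
  then have "AE x in density lborel (\<lambda>x. 3 * indicator (ball 0 1) x). norm (sgn (x::real^3)) = 1"
    by (subst AE_density) (simp_all add: norm_sgn)
  then show ?thesis
    unfolding sphere_measure_def by (subst AE_distr_iff) auto
qed

text \<open>Here \<open>et\<close> is the random restitution coefficient \<open>e + \<eta>\<close>.\<close>

definition post_velocity :: "real \<Rightarrow> real^3 \<Rightarrow> real^3 \<Rightarrow> real^3 \<Rightarrow> real^3" where
  "post_velocity et v w \<sigma> =
     (1/2) *\<^sub>R (v + w) + ((1 - et) / 4) *\<^sub>R (v - w) + ((1 + et) / 4 * norm (v - w)) *\<^sub>R \<sigma>"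

text \<open>The random variable \<open>\<eta>\<close> enters only through its law \<open>\<mu>\<close>, and \<open>f(v) dv\<close> stands for a possibly singular
  Borel measure \<open>f\<close>.\<close>

definition weak_collision ::
    "real \<Rightarrow> real measure \<Rightarrow> (real^3) measure \<Rightarrow> (real^3 \<Rightarrow> real) \<Rightarrow> real" where
  "weak_collision e \<mu> f \<phi> =
     1 / (4 * pi) *
     (\<integral>\<eta>. (\<integral>w. (\<integral>v. (\<integral>\<sigma>. \<phi> (post_velocity (e + \<eta>) v w \<sigma>) - \<phi> v
        \<partial>sphere_measure) \<partial>f) \<partial>f) \<partial>\<mu>)"

definition steady_state :: "real \<Rightarrow> real measure \<Rightarrow> (real^3) measure \<Rightarrow> bool" where
  "steady_state e \<mu> f \<longleftrightarrow>
     prob_space f \<and> sets f = sets borel \<and>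
     (\<forall>\<phi>. continuous_on UNIV \<phi> \<and> bounded (range \<phi>) \<longrightarrow> weak_collision e \<mu> f \<phi> = 0)"

definition P2 :: "(real^3) measure set" where
  "P2 = {f. prob_space f \<and> sets f = sets borel \<and> integrable f (\<lambda>v. (norm v)\<^sup>2)}"

definition isotropic :: "(real^3) measure \<Rightarrow> bool" where
  "isotropic f \<longleftrightarrow> (\<forall>R. rotation_matrix R \<longrightarrow> distr f borel ((*v) R) = f)"

definition zero_mean_velocity :: "(real^3) measure \<Rightarrow> bool" where
  "zero_mean_velocity f \<longleftrightarrow> (\<integral>v. v \<partial>f) = 0"

definition unit_pressure_tensor :: "(real^3) measure \<Rightarrow> bool" where
  "unit_pressure_tensor f \<longleftrightarrow> (\<chi> i j. \<integral>v. v $ i * v $ j \<partial>f) = mat 1"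

text \<open>
  The quotient \<open>(1 - y\<^bsup>4+\<alpha>\<^esup>) / (1 - y\<^sup>2)\<close> at \<open>y = |1 - et| / 2\<close>, extended by continuity:
  its limit as \<open>y\<close> tends to \<open>1\<close> is \<open>(4 + \<alpha>) / 2\<close>.
\<close>

definition frakA_quotient :: "real \<Rightarrow> real \<Rightarrow> real" where
  "frakA_quotient \<alpha> et =
     (if \<bar>1 - et\<bar> = 2 then (4 + \<alpha>) / 2
      else (1 - \<bar>(1 - et) / 2\<bar> powr (4 + \<alpha>)) / (1 - \<bar>(1 - et) / 2\<bar>\<^sup>2))"

text \<open>
  The expectation is taken in \<open>[0,\<infinity>]\<close>: the integrand is nonnegative but need not be integrable,
  and a Bochner integral would then return \<open>0\<close>.
\<close>

definition frakA :: "real \<Rightarrow> real \<Rightarrow> real measure \<Rightarrow> ennreal" where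
  "frakA \<alpha> e \<mu> =
     ennreal (2 / (4 + \<alpha>)) *
     (\<integral>\<^sup>+\<eta>. ennreal (((1 + (e + \<eta>)) / 2) powr (2 + \<alpha>) + frakA_quotient \<alpha> (e + \<eta>)) \<partial>\<mu>)"

end

theory Submission
  imports Defs "HOL-Real_Asymp.Real_Asymp"
begin

text \<open>
  Averaging over \<open>\<sigma>\<close> first turns the collision rule into Bobylev's identity: for an isotropic law with
  characteristic function \<open>\<Psi> (\<bar>k\<bar>\<^sup>2 / 2)\<close>, the velocity after a collision has characteristic function
  \<open>\<langle>\<Psi> (a t) \<Psi> (b t)\<rangle>\<close> at \<open>t = \<bar>k\<bar>\<^sup>2 / 2\<close> (\<open>charv_collide\<close>).  The random shares \<open>a\<close> and \<open>b\<close> are explicit in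
  \<open>\<eta>\<close> and in \<open>s = (1 - cos \<theta>) / 2\<close>, where \<open>\<theta>\<close> is the angle between \<open>\<sigma>\<close> and \<open>k\<close>; by Archimedes'
  theorem \<open>s\<close> is uniform on \<open>[0,1]\<close> (\<open>unif_sphere_inner\<close>).  Integrating out \<open>s\<close> shows that the quantity
  \<open>A(\<alpha>, e, \<eta>)\<close> of the theorem is the moment \<open>\<langle>a\<^bsup>q\<^esup> + b\<^bsup>q\<^esup>\<rangle>\<close> with \<open>q = 1 + \<alpha> / 2\<close> (\<open>frakA_eq\<close>), and
  conservation in the mean says that this moment is \<open>1\<close> for \<open>q = 1\<close> (\<open>frakA_0\<close>).  An isotropic law
  is thus a steady state exactly if \<open>\<Psi>\<close> is a fixed point of the cascade
  \<open>\<Psi> (t) = \<langle>\<Psi> (a t) \<Psi> (b t)\<rangle>\<close> (\<open>profile_steady_state\<close>), and the remaining argument concerns such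
  fixed points.

  The hypothesis \<open>A(\<alpha>, e, \<eta>) < 1\<close> makes the cascade contract functions of order \<open>t\<^bsup>q\<^esup>\<close> with \<open>1 < q < 2\<close>.
  Two fixed points with zero mean velocity and unit pressure tensor have the same expansion
  \<open>1 - t + o(t)\<close>, so their difference is \<open>o(t)\<close>, and the contraction makes it vanish
  (\<open>cascade_uniqueness\<close>).  For existence the cascade is iterated on laws of nonnegative numbers,
  starting from the point mass at \<open>1\<close>.  The Laplace transforms of the iterates converge, again by
  contraction, and Helly's theorem provides a law \<open>N\<close> of mean \<open>1\<close> whose Laplace transform is a fixed
  point (\<open>fixed_point_exists\<close>, \<open>fixed_point_mean\<close>).  Laws of nonnegative numbers are encoded as the
  laws of \<open>\<bar>m\<bar>\<close> for arbitrary real \<open>m\<close>.  If \<open>m\<close> is drawn from \<open>N\<close> and \<open>x\<close> is a standard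
  Gaussian vector, then \<open>sqrt \<bar>m\<bar> * x\<close> has characteristic function \<open>L (\<bar>k\<bar>\<^sup>2 / 2)\<close>, with \<open>L\<close> the Laplace
  transform of \<open>N\<close>; its law is the steady state.

  Its fourth moment is a multiple of the second moment of \<open>N\<close>.  A finite second moment of \<open>N\<close> would
  dominate \<open>\<langle>a\<^sup>2 + b\<^sup>2\<rangle>\<close> times itself (\<open>fixed_point_second_moment\<close>), which is impossible as
  \<open>\<langle>a\<^sup>2 + b\<^sup>2\<rangle> = A(2, e, \<eta>) > 1\<close>.
\<close>

section \<open>Characteristic functions on Euclidean spaces\<close>

definition charv :: "'a::euclidean_space measure \<Rightarrow> 'a \<Rightarrow> complex" where
  "charv M k = (\<integral>x. iexp (k \<bullet> x) \<partial>M)"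

text \<open>
  The algebra generated by the waves \<open>cos (k \<bullet> x + c)\<close>.  Because of the phase \<open>c\<close>, products of
  waves are sums of waves, so that sums suffice in the definition.
\<close>

inductive trig :: "('a::euclidean_space \<Rightarrow> real) \<Rightarrow> bool" where
  wave: "trig (\<lambda>x. r * cos (k \<bullet> x + c))"
| add: "trig g \<Longrightarrow> trig h \<Longrightarrow> trig (\<lambda>x. g x + h x)"

lemma trig_const: "trig (\<lambda>x. c)"
  using trig.wave[of c 0 0] by simp

lemma trig_wave_mult:
  assumes "trig h"
  shows "trig (\<lambda>x. (r * cos (k \<bullet> x + c)) * h x)"
  using assms
proof induction
  case (wave r' k' c')
  have "(r * cos (k \<bullet> x + c)) * (r' * cos (k' \<bullet> x + c'))
      = (r * r' / 2) * cos ((k - k') \<bullet> x + (c - c')) + (r * r' / 2) * cos ((k + k') \<bullet> x + (c + c'))"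
    for x
  proof -
    have "(k - k') \<bullet> x + (c - c') = (k \<bullet> x + c) - (k' \<bullet> x + c')"
      "(k + k') \<bullet> x + (c + c') = (k \<bullet> x + c) + (k' \<bullet> x + c')"
      by (simp_all add: inner_simps)
    then show ?thesis
      by (simp only: cos_add cos_diff) (simp add: field_simps)
  qed
  then show ?case
    by (simp only:) (intro trig.intros)
next
  case (add g h)
  then show ?case
    by (simp only: distrib_left) (rule trig.add)
qed

lemma trig_mult:
  assumes "trig g" "trig h"
  shows "trig (\<lambda>x. g x * h x)"
  using assms(1)
proof induction
  case (wave r k c)
  then show ?case using trig_wave_mult[OF assms(2)] .
next
  case (add g g')
  then show ?case
    by (simp only: distrib_right) (rule trig.add)
qed

lemma trig_polynomial:
  fixes p :: "real \<Rightarrow> real"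
  assumes "real_polynomial_function p" "trig h"
  shows "trig (\<lambda>x. p (h x))"
  using assms(1)
proof induction
  case (linear f)
  then obtain c where "f = (\<lambda>x. x * c)"
    by (auto simp: real_bounded_linear)
  then show ?case using trig_mult[OF assms(2) trig_const[of c]] by simp
qed (auto intro: trig_const trig.add trig_mult)

lemma trig_continuous: "trig h \<Longrightarrow> continuous_on S h"
  by (induction rule: trig.induct) (auto intro!: continuous_intros)

lemma trig_bounded: "trig h \<Longrightarrow> \<exists>B. \<forall>x. \<bar>h x\<bar> \<le> B"
proof (induction rule: trig.induct)
  case (wave r k c)
  show ?case
    by (rule exI[of _ "\<bar>r\<bar>"]) (simp add: abs_mult mult_left_le)
next
  case (add g h)
  then obtain B C where "\<forall>x. \<bar>g x\<bar> \<le> B" "\<forall>x. \<bar>h x\<bar> \<le> C" by blast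
  then have "\<forall>x. \<bar>g x + h x\<bar> \<le> B + C"
    by (meson abs_triangle_ineq add_mono order_trans)
  then show ?case by blast
qed

lemma trig_separates:
  assumes "x \<noteq> y"
  shows "\<exists>h. trig h \<and> h x \<noteq> h y"
proof -
  \<comment> \<open>a wave with value \<open>1\<close> at \<open>y\<close> and half a period between \<open>y\<close> and \<open>x\<close>\<close>
  define k where "k = (pi / (norm (x - y))\<^sup>2) *\<^sub>R (x - y)"
  have "k \<bullet> (x - y) = pi"
    using assms by (simp add: k_def dot_square_norm)
  then have "k \<bullet> x + - (k \<bullet> y) = pi"
    by (simp add: inner_diff_right)
  then have "1 * cos (k \<bullet> x + - (k \<bullet> y)) \<noteq> 1 * cos (k \<bullet> y + - (k \<bullet> y))"
    by (simp only:) simp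
  then show ?thesis
    using trig.wave[of 1 k "- (k \<bullet> y)"] by blast
qed

text \<open>
  Stone--Weierstrass gives an approximation on the ball only.  Composing it with a polynomial that
  is close to the truncation at height \<open>B\<close> keeps it bounded off the ball.
\<close>

lemma trig_approximation:
  fixes \<phi> :: "'a::euclidean_space \<Rightarrow> real"
  assumes cont: "continuous_on UNIV \<phi>" and B: "\<And>x. \<bar>\<phi> x\<bar> \<le> B" and eps: "0 < \<epsilon>"
  obtains h where "trig h" "\<And>x. norm x \<le> r \<Longrightarrow> \<bar>h x - \<phi> x\<bar> \<le> \<epsilon>" "\<And>x. \<bar>h x\<bar> \<le> B + \<epsilon>"
proof -
  interpret function_ring_on "Collect trig" "cball (0::'a) r"
  proof
    show "\<exists>f\<in>Collect trig. f x \<noteq> f y" if "x \<noteq> y" for x y :: 'a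
      using trig_separates[OF that] by auto
  qed (auto intro: trig_continuous trig.add trig_mult trig_const)
  obtain p where p: "trig p" "\<And>x. x \<in> cball 0 r \<Longrightarrow> \<bar>\<phi> x - p x\<bar> < \<epsilon> / 2"
    using Stone_Weierstrass_basic[of \<phi> "\<epsilon> / 2"] eps continuous_on_subset[OF cont] by auto
  obtain C where C: "\<And>x. \<bar>p x\<bar> \<le> C"
    using trig_bounded[OF p(1)] by blast
  define clip where "clip u = max (- B) (min B u)" for u :: real
  have "continuous_on {- C..C} clip"
    unfolding clip_def by (intro continuous_intros)
  then obtain q where q: "real_polynomial_function q" "\<And>u. u \<in> {- C..C} \<Longrightarrow> \<bar>clip u - q u\<bar> < \<epsilon> / 2"
    using Stone_Weierstrass_real_polynomial_function[of "{- C..C}" clip "\<epsilon> / 2"] eps by auto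
  have near: "\<bar>clip (p x) - q (p x)\<bar> < \<epsilon> / 2" for x
    using q(2)[of "p x"] C[of x] by (auto simp: abs_le_iff)
  show thesis
  proof (rule that[of "\<lambda>x. q (p x)"])
    show "trig (\<lambda>x. q (p x))"
      by (rule trig_polynomial) fact+
    show "\<bar>q (p x) - \<phi> x\<bar> \<le> \<epsilon>" if "norm x \<le> r" for x
    proof -
      have "\<bar>\<phi> x - p x\<bar> < \<epsilon> / 2" using p(2) that by simp
      then show ?thesis using near[of x] B[of x] unfolding clip_def by linarith
    qed
    show "\<bar>q (p x)\<bar> \<le> B + \<epsilon>" for x
      using near[of x] B[of x] eps unfolding clip_def by linarith
  qed
qed

lemma integrable_iexp_inner:
  fixes k :: "'a::euclidean_space"
  assumes "finite_measure M" "sets M = sets borel"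
  shows "integrable M (\<lambda>x. iexp (k \<bullet> x))"
proof -
  note [measurable_cong] = assms(2)
  interpret finite_measure M by fact
  show ?thesis
    by (intro integrable_const_bound[where B=1]) auto
qed

lemma integral_trig_eq:
  fixes M N :: "'a::euclidean_space measure"
  assumes M: "finite_measure M" "sets M = sets borel"
    and N: "finite_measure N" "sets N = sets borel"
    and eq: "\<And>k. charv M k = charv N k" and h: "trig h"
  shows "integrable M h \<and> integrable N h \<and> (\<integral>x. h x \<partial>M) = (\<integral>x. h x \<partial>N)"
  using h
proof induction
  case (wave r k c)
  have expand: "r * cos (k \<bullet> x + c) = r * Re (cis c * iexp (k \<bullet> x))" for x :: 'a
    by (simp only: cis_conv_exp[symmetric] cis_mult) (simp add: add.commute)
  note iM = integrable_iexp_inner[OF M, of k] and iN = integrable_iexp_inner[OF N, of k]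
  have *: "(\<integral>x. r * cos (k \<bullet> x + c) \<partial>L) = r * Re (cis c * charv L k)" "integrable L (\<lambda>x. r * cos (k \<bullet> x + c))"
    if "integrable L (\<lambda>x. iexp (k \<bullet> x))" for L :: "'a measure"
    unfolding expand charv_def using that
    by (simp_all add: integral_Re integrable_Re)
  show ?case
    by (simp only: *[OF iM] *[OF iN] eq simp_thms)
next
  case (add g h)
  then show ?case by auto
qed

lemma finite_measure_eqI_bounded_continuous:
  fixes M N :: "'a::euclidean_space measure"
  assumes M: "finite_measure M" "sets M = sets borel"
    and N: "finite_measure N" "sets N = sets borel"
    and eq: "\<And>\<phi>. continuous_on UNIV \<phi> \<Longrightarrow> (\<And>x. \<bar>\<phi> x\<bar> \<le> 1) \<Longrightarrow> (\<integral>x. \<phi> x \<partial>M) = (\<integral>x. \<phi> x \<partial>N :: real)"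
  shows "M = N"
proof -
  note [measurable_cong] = M(2) N(2)
  interpret M: finite_measure M by fact
  interpret N: finite_measure N by fact
  have sp: "space M = UNIV" "space N = UNIV"
    using sets_eq_imp_space_eq[OF M(2)] sets_eq_imp_space_eq[OF N(2)] by simp_all
  have meas: "measure M U = measure N U" if U: "open U" for U
  proof (cases "U = UNIV")
    case True
    then show ?thesis using eq[of "\<lambda>_. 1"] sp by simp
  next
    case False
    define \<phi> where "\<phi> n x = min 1 (real n * infdist x (- U))" for n x
    have ne: "- U \<noteq> {}" using False by auto
    have lim: "(\<lambda>n. \<phi> n x) \<longlonglongrightarrow> indicator U x" for x
    proof (cases "x \<in> U")
      case True
      then have "infdist x (- U) > 0"
        using in_closed_iff_infdist_zero[of "- U" x] ne U infdist_nonneg[of x "- U"] by (auto simp: order_le_less)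
      moreover have "eventually (\<lambda>n. real n \<ge> 1 / infdist x (- U)) sequentially"
        using filterlim_real_sequentially by (simp add: filterlim_at_top)
      ultimately have "eventually (\<lambda>n. \<phi> n x = 1) sequentially"
        by (auto elim!: eventually_mono simp: \<phi>_def field_simps)
      then show ?thesis using True by (simp add: tendsto_eventually)
    next
      case False
      then show ?thesis by (simp add: \<phi>_def)
    qed
    have cont: "continuous_on UNIV (\<phi> n)" for n
      unfolding \<phi>_def by (intro continuous_intros)
    then have [measurable]: "\<phi> n \<in> borel_measurable borel" for n
      by (rule borel_measurable_continuous_onI)
    have bd: "\<bar>\<phi> n x\<bar> \<le> 1" for n x
      by (simp add: \<phi>_def abs_le_iff infdist_nonneg min_def)
    have *: "(\<lambda>n. \<integral>x. \<phi> n x \<partial>L) \<longlonglongrightarrow> measure L U"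
      if "finite_measure L" "sets L = sets borel" for L
    proof -
      note [measurable_cong] = that(2)
      interpret L: finite_measure L by fact
      have [measurable]: "U \<in> sets borel" using U by simp
      have "(\<lambda>n. \<integral>x. \<phi> n x \<partial>L) \<longlonglongrightarrow> (\<integral>x. indicator U x \<partial>L)"
        using lim bd by (intro integral_dominated_convergence[where w="\<lambda>_. 1"]) auto
      then show ?thesis
        using sets_eq_imp_space_eq[OF that(2)] by simp
    qed
    have "(\<integral>x. \<phi> n x \<partial>M) = (\<integral>x. \<phi> n x \<partial>N)" for n
      using cont bd by (rule eq)
    then show ?thesis
      using *[OF M] *[OF N] LIMSEQ_unique by auto
  qed
  show ?thesis
  proof (rule measure_eqI_generator_eq[where E="{U. open U}" and \<Omega>=UNIV and A="\<lambda>_. UNIV"])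
    show "Int_stable {U::'a set. open U}"
      by (auto simp: Int_stable_def)
    show "sets M = sigma_sets UNIV {U. open U}" "sets N = sigma_sets UNIV {U. open U}"
      using M N by (simp_all add: borel_def)
    show "emeasure M U = emeasure N U" if "U \<in> {U. open U}" for U
      using meas that by (simp add: M.emeasure_eq_measure N.emeasure_eq_measure)
  qed auto
qed

text \<open>
  Equality of the characteristic functions says that the integrals of waves agree; a bounded
  continuous function is a pointwise limit of uniformly bounded sums of waves.
\<close>

theorem charv_uniqueness:
  fixes M N :: "'a::euclidean_space measure"
  assumes M: "finite_measure M" "sets M = sets borel"
    and N: "finite_measure N" "sets N = sets borel"
    and eq: "\<And>k. charv M k = charv N k"
  shows "M = N"
proof (rule finite_measure_eqI_bounded_continuous[OF M N])
  fix \<phi> :: "'a \<Rightarrow> real"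
  assume cont: "continuous_on UNIV \<phi>" and bd: "\<And>x. \<bar>\<phi> x\<bar> \<le> 1"
  have "\<exists>h. trig h \<and> (\<forall>x. norm x \<le> real n \<longrightarrow> \<bar>h x - \<phi> x\<bar> \<le> inverse (Suc n))
      \<and> (\<forall>x. \<bar>h x\<bar> \<le> 1 + inverse (Suc n))" for n
    using trig_approximation[OF cont bd, of "inverse (Suc n)" "real n"]
    by (metis inverse_positive_iff_positive of_nat_0_less_iff zero_less_Suc)
  then obtain h where h: "\<And>n. trig (h n)" "\<And>n x. norm x \<le> real n \<Longrightarrow> \<bar>h n x - \<phi> x\<bar> \<le> inverse (Suc n)"
    "\<And>n x. \<bar>h n x\<bar> \<le> 1 + inverse (Suc n)"
    by metis
  have lim: "(\<lambda>n. h n x) \<longlonglongrightarrow> \<phi> x" for x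
  proof -
    have "eventually (\<lambda>n. norm x \<le> real n) sequentially"
      using filterlim_real_sequentially by (simp add: filterlim_at_top)
    then have "eventually (\<lambda>n. norm (h n x - \<phi> x) \<le> inverse (Suc n)) sequentially"
      by eventually_elim (simp only: real_norm_def h(2))
    then have "(\<lambda>n. h n x - \<phi> x) \<longlonglongrightarrow> 0"
      by (rule Lim_null_comparison) (rule LIMSEQ_inverse_real_of_nat)
    then show ?thesis by (simp add: LIM_zero_iff)
  qed
  have bd2: "\<bar>h n x\<bar> \<le> 2" for n x
  proof -
    have "inverse (real (Suc n)) \<le> 1" by (simp add: field_simps)
    then show ?thesis using h(3)[of n x] by linarith
  qed
  have *: "(\<lambda>n. \<integral>x. h n x \<partial>L) \<longlonglongrightarrow> (\<integral>x. \<phi> x \<partial>L)"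
    if L: "finite_measure L" "sets L = sets borel" for L
  proof -
    note [measurable_cong] = L(2)
    interpret L: finite_measure L by fact
    have [measurable]: "h n \<in> borel_measurable borel" "\<phi> \<in> borel_measurable borel" for n
      using trig_continuous[OF h(1)] cont by (auto intro!: borel_measurable_continuous_onI)
    show ?thesis
      using lim bd2 by (intro integral_dominated_convergence[where w="\<lambda>_. 2"]) auto
  qed
  have "(\<integral>x. h n x \<partial>M) = (\<integral>x. h n x \<partial>N)" for n
    using integral_trig_eq[OF M N eq h(1)] by blast
  then show "(\<integral>x. \<phi> x \<partial>M) = (\<integral>x. \<phi> x \<partial>N)"
    using *[OF M] *[OF N] LIMSEQ_unique by auto
qed

section \<open>Fixed points of a random cascade\<close>

lemma exp_neg_quadratic_bound:
  fixes u :: real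
  assumes "0 \<le> u"
  shows "exp (- u) - 1 + u \<le> u\<^sup>2 / 2"
proof -
  have "1 \<le> (1 - u + u\<^sup>2 / 2) * (1 + u + u\<^sup>2 / 2)"
    using assms by (simp add: algebra_simps power2_eq_square)
  also have "\<dots> \<le> (1 - u + u\<^sup>2 / 2) * exp u"
  proof (rule mult_left_mono)
    show "1 + u + u\<^sup>2 / 2 \<le> exp u" using exp_lower_Taylor_quadratic[OF assms] .
    have "0 \<le> (u - 1)\<^sup>2 + 1" by simp
    then show "0 \<le> 1 - u + u\<^sup>2 / 2" by (simp add: power2_eq_square algebra_simps)
  qed
  finally show ?thesis by (simp add: exp_minus field_simps)
qed

lemma exp_neg_powr_bound:
  fixes u q :: real
  assumes u: "0 \<le> u" and q: "1 \<le> q" "q \<le> 2"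
  shows "exp (- u) - 1 + u \<le> u powr q"
proof (cases "u \<le> 1")
  case True
  have "u\<^sup>2 / 2 \<le> u powr 2"
    using u by (cases "u = 0") (simp_all add: powr_numeral)
  also have "\<dots> \<le> u powr q"
    using True u q by (cases "u = 0") (auto intro: powr_mono' simp del: powr_numeral)
  finally show ?thesis using exp_neg_quadratic_bound[OF u] by linarith
next
  case False
  then have "u powr 1 \<le> u powr q" using q by (intro powr_mono) auto
  then have "u \<le> u powr q" using u by simp
  moreover have "exp (- u) \<le> 1" using u by simp
  ultimately show ?thesis by linarith
qed

text \<open>
  The Laplace transform of the law of \<open>\<bar>x\<bar>\<close>: with the absolute value built in, all real laws are
  admitted and no support condition has to be carried along.
\<close>

definition laplace :: "real measure \<Rightarrow> real \<Rightarrow> real" where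
  "laplace N t = (\<integral>x. exp (- (t * \<bar>x\<bar>)) \<partial>N)"

lemma laplace_measurable [measurable]:
  assumes "real_distribution N"
  shows "laplace N \<in> borel_measurable borel"
proof -
  interpret real_distribution N by fact
  show ?thesis unfolding laplace_def[abs_def] by measurable
qed

lemma
  assumes "real_distribution N" and t: "0 \<le> t"
  shows laplace_nonneg: "0 \<le> laplace N t"
    and laplace_le_1: "laplace N t \<le> 1"
    and laplace_integrable: "integrable N (\<lambda>x. exp (- (t * \<bar>x\<bar>)))"
proof -
  interpret real_distribution N by fact
  show i: "integrable N (\<lambda>x. exp (- (t * \<bar>x\<bar>)))"
    using t by (intro integrable_const_bound[where B=1]) auto
  show "0 \<le> laplace N t" unfolding laplace_def by simp
  have "laplace N t \<le> (\<integral>x. 1 \<partial>N)"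
    unfolding laplace_def using i t by (intro integral_mono) auto
  then show "laplace N t \<le> 1" using prob_space by simp
qed

text \<open>
  In the application \<open>a\<close> and \<open>b\<close> are the fractions of the square of a Fourier variable passed on
  to the two precollisional velocities.  The exponent \<open>q\<close> turns the cascade into a contraction on
  functions that vanish like \<open>t\<^bsup>q\<^esup>\<close> at the origin.
\<close>

locale cascade = prob_space P for P :: "'p measure" +
  fixes a b :: "'p \<Rightarrow> real" and q :: real
  assumes measurable_a [measurable]: "a \<in> borel_measurable P"
    and measurable_b [measurable]: "b \<in> borel_measurable P"
    and a_nonneg: "0 \<le> a p" and b_nonneg: "0 \<le> b p"
    and integrable_a: "integrable P a" and integrable_b: "integrable P b"
    and mean_one: "(\<integral>p. a p + b p \<partial>P) = 1"
    and q_gt: "1 < q" and q_lt: "q < 2"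
    and integrable_powr: "integrable P (\<lambda>p. a p powr q + b p powr q)"
    and contractive: "(\<integral>p. a p powr q + b p powr q \<partial>P) < 1"
begin

definition \<kappa> :: real where
  "\<kappa> = (\<integral>p. a p powr q + b p powr q \<partial>P)"

lemma \<kappa>_nonneg: "0 \<le> \<kappa>"
  unfolding \<kappa>_def by simp

lemma \<kappa>_less_1: "\<kappa> < 1"
  unfolding \<kappa>_def by (rule contractive)

text \<open>
  The mean of \<open>a + b\<close> is \<open>1\<close>, so the linear part of a bound is preserved, whereas its part of
  order \<open>t\<^bsup>q\<^esup>\<close> shrinks.
\<close>

lemma cascade_bound:
  assumes [measurable]: "D \<in> borel_measurable borel"
    and D: "\<And>t. 0 \<le> t \<Longrightarrow> 0 \<le> D t" "\<And>t. 0 \<le> t \<Longrightarrow> D t \<le> \<epsilon> * t + K * t powr q"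
    and t: "0 \<le> t"
  shows "integrable P (\<lambda>p. D (a p * t) + D (b p * t))"
    and "(\<integral>p. D (a p * t) + D (b p * t) \<partial>P) \<le> \<epsilon> * t + (K * \<kappa>) * t powr q"
proof -
  let ?B = "\<lambda>p. (\<epsilon> * t) * (a p + b p) + (K * t powr q) * (a p powr q + b p powr q)"
  have iB: "integrable P ?B"
    using integrable_a integrable_b integrable_powr by simp
  have nn: "0 \<le> D (a p * t) + D (b p * t)" for p
    using D(1) t a_nonneg b_nonneg by simp
  have le: "D (a p * t) + D (b p * t) \<le> ?B p" for p
    using D(2)[of "a p * t"] D(2)[of "b p * t"] t a_nonneg[of p] b_nonneg[of p]
    by (simp add: powr_mult algebra_simps)
  show i: "integrable P (\<lambda>p. D (a p * t) + D (b p * t))"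
  proof (rule Bochner_Integration.integrable_bound[OF iB])
    have "norm (D (a p * t) + D (b p * t)) \<le> norm (?B p)" for p
      using nn[of p] le[of p] unfolding real_norm_def by linarith
    then show "AE p in P. norm (D (a p * t) + D (b p * t)) \<le> norm (?B p)" by blast
  qed measurable
  have "(\<integral>p. D (a p * t) + D (b p * t) \<partial>P) \<le> (\<integral>p. ?B p \<partial>P)"
    using le by (intro integral_mono i iB)
  also have "\<dots> = \<epsilon> * t + (K * \<kappa>) * t powr q"
  proof -
    have "(\<integral>p. ?B p \<partial>P) = (\<epsilon> * t) * (\<integral>p. a p + b p \<partial>P) + (K * t powr q) * \<kappa>"
      unfolding \<kappa>_def using integrable_a integrable_b integrable_powr
      by (subst Bochner_Integration.integral_add) simp_all
    then show ?thesis by (simp add: mean_one)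
  qed
  finally show "(\<integral>p. D (a p * t) + D (b p * t) \<partial>P) \<le> \<epsilon> * t + (K * \<kappa>) * t powr q" .
qed

text \<open>
  For every \<open>\<epsilon>\<close> there is a bound \<open>\<epsilon> * t + K * t\<^bsup>q\<^esup>\<close>, since the first term is enough near \<open>0\<close> and
  the second one elsewhere; iterating the cascade removes the second term.
\<close>

lemma cascade_uniqueness:
  assumes [measurable]: "D \<in> borel_measurable borel"
    and nonneg: "\<And>t. 0 \<le> t \<Longrightarrow> 0 \<le> D t"
    and linear: "\<And>t. 0 \<le> t \<Longrightarrow> D t \<le> C * t"
    and small: "\<And>\<epsilon>. 0 < \<epsilon> \<Longrightarrow> \<exists>\<delta>>0. \<forall>t. 0 \<le> t \<and> t < \<delta> \<longrightarrow> D t \<le> \<epsilon> * t"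
    and subsolution: "\<And>t. 0 \<le> t \<Longrightarrow> D t \<le> (\<integral>p. D (a p * t) + D (b p * t) \<partial>P)"
    and t: "0 \<le> t"
  shows "D t = 0"
proof -
  have C: "0 \<le> C" using nonneg[of 1] linear[of 1] by simp
  have "D t \<le> \<epsilon> * t" if \<epsilon>: "0 < \<epsilon>" for \<epsilon>
  proof -
    obtain \<delta> where \<delta>: "0 < \<delta>" "\<And>t. 0 \<le> t \<Longrightarrow> t < \<delta> \<Longrightarrow> D t \<le> \<epsilon> * t"
      using small[OF \<epsilon>] by blast
    \<comment> \<open>chosen so that \<open>C * t \<le> K * t\<^bsup>q\<^esup>\<close> for \<open>t \<ge> \<delta>\<close>\<close>
    define K where "K = C * \<delta> powr (1 - q)"
    have K: "0 \<le> K" using C by (simp add: K_def)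
    have start: "D t \<le> \<epsilon> * t + K * t powr q" if "0 \<le> t" for t
    proof (cases "t < \<delta>")
      case True
      then show ?thesis using \<delta>(2)[OF that] K by (simp add: add_increasing2)
    next
      case False
      then have "C * t = C * (t powr (1 - q) * t powr q)"
        using \<delta>(1) by (simp add: powr_add[symmetric])
      also have "\<dots> \<le> C * (\<delta> powr (1 - q) * t powr q)"
        using False \<delta>(1) C q_gt by (intro mult_left_mono mult_right_mono powr_mono2') auto
      finally have "D t \<le> K * t powr q"
        using linear[OF that] by (simp add: K_def mult.assoc)
      then show ?thesis using \<epsilon> that by (simp add: add_increasing)
    qed
    have iter: "D t \<le> \<epsilon> * t + (K * \<kappa> ^ n) * t powr q" if "0 \<le> t" for n t
      using that
    proof (induction n arbitrary: t)
      case 0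
      then show ?case using start by simp
    next
      case (Suc n)
      have "D t \<le> (\<integral>p. D (a p * t) + D (b p * t) \<partial>P)"
        using subsolution Suc.prems .
      also have "\<dots> \<le> \<epsilon> * t + (K * \<kappa> ^ n * \<kappa>) * t powr q"
        using nonneg Suc by (intro cascade_bound(2)) auto
      finally show ?case by (simp add: mult_ac)
    qed
    have "(\<lambda>n. \<epsilon> * t + (K * \<kappa> ^ n) * t powr q) \<longlonglongrightarrow> \<epsilon> * t + (K * 0) * t powr q"
      using \<kappa>_nonneg \<kappa>_less_1 by (intro tendsto_intros LIMSEQ_power_zero) auto
    then show ?thesis
      using iter[OF t] by (intro LIMSEQ_le_const[of _ "\<epsilon> * t"]) auto
  qed
  then have "D t \<le> 0 + \<epsilon>" if "0 < \<epsilon>" for \<epsilon>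
  proof (cases "t = 0")
    case True
    then show ?thesis using linear[of 0] that by simp
  next
    case False
    then show ?thesis using \<open>\<And>\<epsilon>. 0 < \<epsilon> \<Longrightarrow> D t \<le> \<epsilon> * t\<close>[of "\<epsilon> / t"] t that by simp
  qed
  then have "D t \<le> 0" by (rule field_le_epsilon)
  then show ?thesis using nonneg[OF t] by simp
qed

subsection \<open>Existence and moments of a fixed point\<close>

definition smoothing :: "real measure \<Rightarrow> real measure" where
  "smoothing N = distr (P \<Otimes>\<^sub>M (N \<Otimes>\<^sub>M N)) borel (\<lambda>(p, x, y). a p * \<bar>x\<bar> + b p * \<bar>y\<bar>)"

lemma smoothing_distribution:
  assumes "real_distribution N"
  shows "real_distribution (smoothing N)"
proof -
  interpret N: real_distribution N by fact
  interpret NN: pair_prob_space N N ..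
  interpret PNN: pair_prob_space P "N \<Otimes>\<^sub>M N" ..
  show ?thesis
    unfolding smoothing_def by (intro PNN.real_distribution_distr) measurable
qed

lemma smoothing_mean:
  assumes "real_distribution N" and mean: "(\<integral>\<^sup>+x. ennreal \<bar>x\<bar> \<partial>N) = 1"
  shows "(\<integral>\<^sup>+x. ennreal \<bar>x\<bar> \<partial>smoothing N) = 1"
proof -
  interpret N: real_distribution N by fact
  interpret NN: pair_prob_space N N ..
  interpret PNN: pair_prob_space P "N \<Otimes>\<^sub>M N" ..
  have "(\<integral>\<^sup>+x. ennreal \<bar>x\<bar> \<partial>smoothing N)
      = (\<integral>\<^sup>+z. ennreal \<bar>case z of (p, x, y) \<Rightarrow> a p * \<bar>x\<bar> + b p * \<bar>y\<bar>\<bar> \<partial>(P \<Otimes>\<^sub>M (N \<Otimes>\<^sub>M N)))"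
    unfolding smoothing_def by (subst nn_integral_distr) auto
  also have "\<dots> = (\<integral>\<^sup>+p. (\<integral>\<^sup>+x. (\<integral>\<^sup>+y. ennreal (a p * \<bar>x\<bar> + b p * \<bar>y\<bar>) \<partial>N) \<partial>N) \<partial>P)"
  proof (subst NN.nn_integral_fst[symmetric], measurable, rule nn_integral_cong)
    fix p
    show "(\<integral>\<^sup>+z. ennreal \<bar>case (p, z) of (p, x, y) \<Rightarrow> a p * \<bar>x\<bar> + b p * \<bar>y\<bar>\<bar> \<partial>(N \<Otimes>\<^sub>M N))
        = (\<integral>\<^sup>+x. (\<integral>\<^sup>+y. ennreal (a p * \<bar>x\<bar> + b p * \<bar>y\<bar>) \<partial>N) \<partial>N)"
      using a_nonneg b_nonneg by (subst N.nn_integral_fst[symmetric]) (auto simp: abs_of_nonneg)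
  qed
  also have "\<dots> = (\<integral>\<^sup>+p. ennreal (a p + b p) \<partial>P)"
    using a_nonneg b_nonneg mean
    by (simp add: ennreal_plus ennreal_mult nn_integral_add nn_integral_cmult N.emeasure_space_1[simplified])
  also have "\<dots> = ennreal (\<integral>p. a p + b p \<partial>P)"
    using a_nonneg b_nonneg integrable_a integrable_b by (intro nn_integral_eq_integral) auto
  finally show ?thesis by (simp add: mean_one)
qed

lemma laplace_smoothing:
  assumes "real_distribution N" and t: "0 \<le> t"
  shows "laplace (smoothing N) t = (\<integral>p. laplace N (a p * t) * laplace N (b p * t) \<partial>P)"
proof -
  interpret N: real_distribution N by fact
  interpret NN: pair_prob_space N N ..
  interpret PNN: pair_prob_space P "N \<Otimes>\<^sub>M N" ..
  let ?g = "\<lambda>(p, x, y). exp (- (a p * t * \<bar>x\<bar>)) * exp (- (b p * t * \<bar>y\<bar>))"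
  have [measurable]: "?g \<in> borel_measurable (P \<Otimes>\<^sub>M (N \<Otimes>\<^sub>M N))"
    by measurable
  have g: "norm (?g z) \<le> 1" for z
  proof -
    obtain p x y where z: "z = (p, x, y)" by (cases z) auto
    have "0 \<le> a p * t * \<bar>x\<bar>" "0 \<le> b p * t * \<bar>y\<bar>"
      using a_nonneg b_nonneg t by simp_all
    then show ?thesis by (simp add: z mult_exp_exp del: mult_nonneg_nonneg)
  qed
  have ip: "integrable (P \<Otimes>\<^sub>M (N \<Otimes>\<^sub>M N)) ?g"
    using g by (intro PNN.P.integrable_const_bound[where B=1]) auto
  have "laplace (smoothing N) t = (\<integral>z. ?g z \<partial>(P \<Otimes>\<^sub>M (N \<Otimes>\<^sub>M N)))"
    unfolding smoothing_def laplace_def using a_nonneg b_nonneg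
    by (subst integral_distr) (auto intro!: Bochner_Integration.integral_cong simp: mult_exp_exp algebra_simps abs_of_nonneg)
  also have "\<dots> = (\<integral>p. (\<integral>z. ?g (p, z) \<partial>(N \<Otimes>\<^sub>M N)) \<partial>P)"
    using ip by (rule PNN.integral_fst'[symmetric])
  also have "\<dots> = (\<integral>p. laplace N (a p * t) * laplace N (b p * t) \<partial>P)"
  proof (rule Bochner_Integration.integral_cong[OF refl])
    fix p
    have "integrable (N \<Otimes>\<^sub>M N) (\<lambda>z. ?g (p, z))"
      using g[of "(p, _)"] by (intro NN.P.integrable_const_bound[where B=1]) auto
    then have "(\<integral>z. ?g (p, z) \<partial>(N \<Otimes>\<^sub>M N)) = (\<integral>x. \<integral>y. ?g (p, x, y) \<partial>N \<partial>N)"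
      by (rule NN.integral_fst'[symmetric])
    then show "(\<integral>z. ?g (p, z) \<partial>(N \<Otimes>\<^sub>M N)) = laplace N (a p * t) * laplace N (b p * t)"
      by (simp add: laplace_def)
  qed
  finally show ?thesis .
qed
fun iterate :: "nat \<Rightarrow> real measure" where
  "iterate 0 = return borel 1"
| "iterate (Suc n) = smoothing (iterate n)"

lemma iterate_distribution: "real_distribution (iterate n)"
proof (induction n)
  case 0
  show ?case by (simp add: real_distribution_def real_distribution_axioms_def prob_space_return)
qed (simp add: smoothing_distribution)

lemma iterate_mean: "(\<integral>\<^sup>+x. ennreal \<bar>x\<bar> \<partial>iterate n) = 1"
  by (induction n) (simp_all add: nn_integral_return smoothing_mean iterate_distribution)

text \<open>The first step is of order \<open>t\<^bsup>q\<^esup>\<close> because \<open>a + b\<close> has mean \<open>1\<close>: the linear terms cancel.\<close>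

lemma iterate_first_step:
  assumes t: "0 \<le> t"
  shows "\<bar>laplace (iterate 1) t - laplace (iterate 0) t\<bar> \<le> (2 powr q * \<kappa> + 1) * t powr q"
proof -
  define r where "r u = exp (- u) - 1 + u" for u :: real
  have r0: "0 \<le> r u" for u
    using exp_ge_add_one_self[of "- u"] by (simp add: r_def)
  have rq: "r u \<le> u powr q" if "0 \<le> u" for u
    using exp_neg_powr_bound[OF that] q_gt q_lt by (simp add: r_def)
  have L0: "laplace (iterate 0) t = exp (- t)" if "0 \<le> t" for t
    by (simp add: laplace_def integral_return)
  have ab: "0 \<le> a p + b p" for p using a_nonneg[of p] b_nonneg[of p] by simp
  have e: "integrable P (\<lambda>p. exp (- ((a p + b p) * t)))"
    using ab t by (intro integrable_const_bound[where B=1]) auto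
  have L1: "laplace (iterate 1) t = (\<integral>p. exp (- ((a p + b p) * t)) \<partial>P)"
    using laplace_smoothing[OF iterate_distribution t, of 0] a_nonneg b_nonneg t
    by (simp add: L0 mult_exp_exp algebra_simps del: iterate.simps(1))
  have ir: "integrable P (\<lambda>p. r ((a p + b p) * t))"
    unfolding r_def using e integrable_a integrable_b by (simp add: distrib_right)
  have "(\<integral>p. r ((a p + b p) * t) \<partial>P)
      = (\<integral>p. exp (- ((a p + b p) * t)) \<partial>P) - 1 + (\<integral>p. (a p + b p) * t \<partial>P)"
    unfolding r_def using e integrable_a integrable_b
    by (subst Bochner_Integration.integral_add, simp_all add: prob_space)
  also have "(\<integral>p. (a p + b p) * t \<partial>P) = t"
    using mean_one by simp
  finally have diff: "laplace (iterate 1) t - laplace (iterate 0) t = (\<integral>p. r ((a p + b p) * t) \<partial>P) - r t"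
    using L1 L0[OF t] by (simp add: r_def)
  have "(\<integral>p. r ((a p + b p) * t) \<partial>P) \<le> (\<integral>p. (2 powr q * t powr q) * (a p powr q + b p powr q) \<partial>P)"
  proof (intro integral_mono ir integrable_mult_right integrable_powr)
    fix p
    have "a p + b p \<le> 2 * max (a p) (b p)" by simp
    then have "(a p + b p) powr q \<le> (2 * max (a p) (b p)) powr q"
      using ab q_gt by (intro powr_mono2) auto
    also have "\<dots> \<le> 2 powr q * (a p powr q + b p powr q)"
      using a_nonneg[of p] b_nonneg[of p] by (simp add: powr_mult max_def)
    finally have "(a p + b p) powr q * t powr q \<le> 2 powr q * (a p powr q + b p powr q) * t powr q"
      by (rule mult_right_mono) simp
    then show "r ((a p + b p) * t) \<le> (2 powr q * t powr q) * (a p powr q + b p powr q)"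
      using rq[of "(a p + b p) * t"] ab t by (simp add: powr_mult mult_ac)
  qed
  also have "\<dots> = 2 powr q * \<kappa> * t powr q"
    unfolding \<kappa>_def using integrable_powr by simp
  finally have "(\<integral>p. r ((a p + b p) * t) \<partial>P) \<le> 2 powr q * \<kappa> * t powr q" .
  moreover have "0 \<le> (\<integral>p. r ((a p + b p) * t) \<partial>P)"
    using r0 by simp
  moreover have "0 \<le> 2 powr q * \<kappa> * t powr q" using \<kappa>_nonneg by simp
  ultimately show ?thesis
    unfolding diff using r0[of t] rq[OF t] by (simp add: distrib_right)
qed

lemma norm_diff_mult_le:
  fixes x x' y y' :: "'a::real_normed_algebra"
  assumes "norm x \<le> 1" "norm y' \<le> 1"
  shows "norm (x * y - x' * y') \<le> norm (x - x') + norm (y - y')"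
proof -
  have "x * y - x' * y' = x * (y - y') + (x - x') * y'"
    by (simp add: algebra_simps)
  also have "norm \<dots> \<le> norm x * norm (y - y') + norm (x - x') * norm y'"
    by (intro order_trans[OF norm_triangle_ineq] add_mono norm_mult_ineq)
  also have "\<dots> \<le> 1 * norm (y - y') + norm (x - x') * 1"
    using assms by (intro add_mono mult_mono) auto
  finally show ?thesis by simp
qed

lemma iterate_step:
  assumes t: "0 \<le> t"
  shows "\<bar>laplace (iterate (Suc n)) t - laplace (iterate n) t\<bar> \<le> ((2 powr q * \<kappa> + 1) * \<kappa> ^ n) * t powr q"
  using t
proof (induction n arbitrary: t)
  case 0
  then show ?case using iterate_first_step by simp
next
  case (Suc n)
  let ?L = "\<lambda>n. laplace (iterate n)"
  define D where "D s = \<bar>?L (Suc n) s - ?L n s\<bar>" for s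
  note [measurable] = laplace_measurable[OF iterate_distribution]
  have [measurable]: "D \<in> borel_measurable borel" unfolding D_def by measurable
  note L0 = laplace_nonneg[OF iterate_distribution] and L1 = laplace_le_1[OF iterate_distribution]
  have ab: "0 \<le> a p * t" "0 \<le> b p * t" for p using a_nonneg b_nonneg Suc.prems by simp_all
  have i: "integrable P (\<lambda>p. ?L m (a p * t) * ?L m (b p * t))" for m
    using L0 L1 ab by (intro integrable_const_bound[where B=1]) (auto simp: abs_mult intro!: mult_le_one)
  have step: "?L (Suc m) t = (\<integral>p. ?L m (a p * t) * ?L m (b p * t) \<partial>P)" for m
    using laplace_smoothing[OF iterate_distribution Suc.prems] by simp
  have "\<bar>?L (Suc (Suc n)) t - ?L (Suc n) t\<bar>
      = \<bar>\<integral>p. ?L (Suc n) (a p * t) * ?L (Suc n) (b p * t) - ?L n (a p * t) * ?L n (b p * t) \<partial>P\<bar>"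
    by (simp only: Bochner_Integration.integral_diff[OF i i] step[of "Suc n"] step[of n])
  also have "\<dots> \<le> (\<integral>p. \<bar>?L (Suc n) (a p * t) * ?L (Suc n) (b p * t) - ?L n (a p * t) * ?L n (b p * t)\<bar> \<partial>P)"
    by (rule integral_abs_bound)
  also have "\<dots> \<le> (\<integral>p. D (a p * t) + D (b p * t) \<partial>P)"
  proof (rule integral_mono)
    show "integrable P (\<lambda>p. D (a p * t) + D (b p * t))"
      using Suc by (intro cascade_bound(1)[OF \<open>D \<in> borel_measurable borel\<close>, where \<epsilon>=0 and K="(2 powr q * \<kappa> + 1) * \<kappa> ^ n"]) (auto simp: D_def)
    show "integrable P (\<lambda>p. \<bar>?L (Suc n) (a p * t) * ?L (Suc n) (b p * t) - ?L n (a p * t) * ?L n (b p * t)\<bar>)"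
      by (intro integrable_abs Bochner_Integration.integrable_diff i)
    show "\<bar>?L (Suc n) (a p * t) * ?L (Suc n) (b p * t) - ?L n (a p * t) * ?L n (b p * t)\<bar>
        \<le> D (a p * t) + D (b p * t)" for p
      unfolding D_def using L0 L1 ab
      by (intro norm_diff_mult_le[where 'a=real, unfolded real_norm_def]) (simp_all del: iterate.simps)
  qed
  also have "\<dots> \<le> 0 * t + ((2 powr q * \<kappa> + 1) * \<kappa> ^ n * \<kappa>) * t powr q"
    using Suc by (intro cascade_bound(2)[OF \<open>D \<in> borel_measurable borel\<close>]) (auto simp: D_def)
  finally show ?case by (simp only: power_Suc2 mult.assoc mult_zero_left add_0)
qed

definition limit_constant :: real where
  "limit_constant = (2 powr q * \<kappa> + 1) / (1 - \<kappa>)"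

lemma iterate_limit:
  assumes t: "0 \<le> t"
  shows "convergent (\<lambda>n. laplace (iterate n) t)"
    and "\<bar>laplace (iterate n) t - exp (- t)\<bar> \<le> limit_constant * t powr q"
proof -
  let ?x = "\<lambda>n. laplace (iterate n) t"
  let ?c = "\<lambda>n. ((2 powr q * \<kappa> + 1) * \<kappa> ^ n) * t powr q"
  have "?c sums ((2 powr q * \<kappa> + 1) * (1 / (1 - \<kappa>)) * t powr q)"
    using \<kappa>_nonneg \<kappa>_less_1 by (intro sums_mult sums_mult2 geometric_sums) simp
  then have c: "summable ?c" "suminf ?c = limit_constant * t powr q"
    by (simp_all add: sums_iff limit_constant_def)
  have step: "norm (?x (Suc n) - ?x n) \<le> ?c n" for n
    using iterate_step[OF t, of n] unfolding real_norm_def .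
  have tele: "?x n = ?x 0 + (\<Sum>i<n. ?x (Suc i) - ?x i)" for n
    using sum_lessThan_telescope[of ?x n] by linarith
  have "summable (\<lambda>n. ?x (Suc n) - ?x n)"
    by (rule summable_comparison_test'[OF c(1), of 0]) (rule step)
  then have "convergent (\<lambda>n. ?x 0 + (\<Sum>i<n. ?x (Suc i) - ?x i))"
    by (intro convergent_add convergent_const) (simp add: summable_iff_convergent)
  then show "convergent ?x"
    by (subst tele) 
  have "\<bar>?x n - ?x 0\<bar> = \<bar>\<Sum>i<n. ?x (Suc i) - ?x i\<bar>"
    by (subst tele) simp
  also have "\<dots> \<le> (\<Sum>i<n. ?c i)"
    using step by (intro order_trans[OF sum_abs] sum_mono) (simp only: real_norm_def)
  also have "\<dots> \<le> suminf ?c"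
    using \<kappa>_nonneg by (intro sum_le_suminf c(1)) auto
  finally show "\<bar>?x n - exp (- t)\<bar> \<le> limit_constant * t powr q"
    using c(2) by (simp add: laplace_def integral_return)
qed

lemma tight_iterate: "tight iterate"
  unfolding tight_def
proof (intro conjI allI impI)
  show "real_distribution (iterate n)" for n by (rule iterate_distribution)
  fix \<epsilon> :: real assume \<epsilon>: "0 < \<epsilon>"
  define c where "c = 2 / \<epsilon>"
  have c: "0 < c" using \<epsilon> by (simp add: c_def)
  have "1 - \<epsilon> < measure (iterate n) {- c<..c}" for n
  proof -
    interpret N: real_distribution "iterate n" by (rule iterate_distribution)
    have i: "integrable (iterate n) (\<lambda>x. \<bar>x\<bar>)"
      using iterate_mean[of n] by (intro integrableI_bounded) auto
    have m: "(\<integral>x. \<bar>x\<bar> \<partial>iterate n) = 1"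
      using nn_integral_eq_integral[OF i] iterate_mean[of n] by simp
    have "N.prob {x. c \<le> \<bar>x\<bar>} \<le> 1 / c"
      using integral_Markov_inequality_measure[OF i, of UNIV c] m c by simp
    also have "1 / c < \<epsilon>" using \<epsilon> by (simp add: c_def)
    finally have "1 - \<epsilon> < 1 - N.prob {x. c \<le> \<bar>x\<bar>}" by simp
    also have "\<dots> = N.prob (space (iterate n) - {x. c \<le> \<bar>x\<bar>})"
      by (rule N.prob_compl[symmetric]) simp
    also have "\<dots> \<le> N.prob {- c<..c}"
      by (rule N.finite_measure_mono) auto
    finally show ?thesis .
  qed
  then show "\<exists>a b. a < b \<and> (\<forall>n. 1 - \<epsilon> < measure (iterate n) {a<..b})"
    using c by (intro exI[of _ "- c"] exI[of _ c]) auto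
qed

text \<open>
  The iterates have mean \<open>1\<close>, so Helly's theorem gives a weak limit along a subsequence.  Its
  Laplace transform is the limit along the full sequence and therefore a fixed point.
\<close>

lemma fixed_point_exists:
  "\<exists>N. real_distribution N
     \<and> (\<forall>t\<ge>0. laplace N t = (\<integral>p. laplace N (a p * t) * laplace N (b p * t) \<partial>P))
     \<and> (\<forall>t\<ge>0. \<bar>laplace N t - exp (- t)\<bar> \<le> limit_constant * t powr q)"
proof -
  obtain r N where r: "strict_mono (r :: nat \<Rightarrow> nat)" and N: "real_distribution N"
    and weak: "weak_conv_m (iterate \<circ> id \<circ> r) N"
    using tight_imp_convergent_subsubsequence[OF tight_iterate, of id] by (auto simp: strict_mono_id id_def strict_mono_def)
  have lim: "(\<lambda>n. laplace (iterate n) t) \<longlonglongrightarrow> laplace N t" if t: "0 \<le> t" for t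
  proof -
    have "(\<lambda>n. laplace (iterate (r n)) t) \<longlonglongrightarrow> laplace N t"
      unfolding laplace_def
      using weak_conv_imp_integral_bdd_continuous_conv[where \<mu>="\<lambda>n. iterate (r n)" and M=N
          and f="\<lambda>x. exp (- (t * \<bar>x\<bar>))" and B=1, OF iterate_distribution N] weak t
      by (auto simp: o_def)
    moreover obtain l where l: "(\<lambda>n. laplace (iterate n) t) \<longlonglongrightarrow> l"
      using iterate_limit(1)[OF t] by (auto simp: convergent_def)
    moreover have "(\<lambda>n. laplace (iterate (r n)) t) \<longlonglongrightarrow> l"
      using LIMSEQ_subseq_LIMSEQ[OF l r] by (simp add: o_def)
    ultimately show ?thesis using LIMSEQ_unique by blast
  qed
  note [measurable] = laplace_measurable[OF iterate_distribution] laplace_measurable[OF N]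
  have fixed: "laplace N t = (\<integral>p. laplace N (a p * t) * laplace N (b p * t) \<partial>P)" if t: "0 \<le> t" for t
  proof -
    have ab: "0 \<le> a p * t" "0 \<le> b p * t" for p using a_nonneg b_nonneg t by simp_all
    have "(\<lambda>n. \<integral>p. laplace (iterate n) (a p * t) * laplace (iterate n) (b p * t) \<partial>P)
        \<longlonglongrightarrow> (\<integral>p. laplace N (a p * t) * laplace N (b p * t) \<partial>P)"
    proof (rule integral_dominated_convergence[where w="\<lambda>_. 1"])
      show "AE p in P. (\<lambda>n. laplace (iterate n) (a p * t) * laplace (iterate n) (b p * t))
          \<longlonglongrightarrow> laplace N (a p * t) * laplace N (b p * t)"
        using ab by (intro AE_I2 tendsto_mult lim)
      show "AE p in P. norm (laplace (iterate n) (a p * t) * laplace (iterate n) (b p * t)) \<le> 1" for n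
        using ab laplace_nonneg[OF iterate_distribution] laplace_le_1[OF iterate_distribution]
        by (intro AE_I2) (simp add: abs_mult mult_le_one)
    qed auto
    moreover have "(\<lambda>n. laplace (iterate (Suc n)) t) \<longlonglongrightarrow> laplace N t"
      using lim[OF t] by (rule LIMSEQ_Suc)
    ultimately show ?thesis
      using LIMSEQ_unique by (simp add: laplace_smoothing[OF iterate_distribution t])
  qed
  have "\<bar>laplace N t - exp (- t)\<bar> \<le> limit_constant * t powr q" if t: "0 \<le> t" for t
  proof (rule LIMSEQ_le_const2)
    show "(\<lambda>n. \<bar>laplace (iterate n) t - exp (- t)\<bar>) \<longlonglongrightarrow> \<bar>laplace N t - exp (- t)\<bar>"
      by (intro tendsto_intros lim t)
  qed (use iterate_limit(2)[OF t] in blast)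
  then show ?thesis using N fixed by blast
qed
text \<open>
  By the bound, \<open>(1 - L(t)) / t\<close> tends to \<open>1\<close> as \<open>t\<close> tends to \<open>0\<close>.  It is the mean of
  \<open>(1 - exp (- t * \<bar>x\<bar>)) / t\<close>, which stays below \<open>\<bar>x\<bar>\<close> and converges to it.
\<close>

lemma fixed_point_mean:
  assumes N: "real_distribution N"
    and close: "\<And>t. 0 \<le> t \<Longrightarrow> \<bar>laplace N t - exp (- t)\<bar> \<le> C * t powr q"
  shows "(\<integral>\<^sup>+x. ennreal \<bar>x\<bar> \<partial>N) = 1"
proof -
  interpret N: real_distribution N by fact
  define t where "t n = inverse (real (Suc n))" for n
  have t: "0 < t n" for n by (simp add: t_def)
  define h where "h n x = (1 - exp (- (t n * \<bar>x\<bar>))) / t n" for n x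
  have [measurable]: "h n \<in> borel_measurable borel" for n unfolding h_def by measurable
  have h0: "0 \<le> h n x" and hle: "h n x \<le> \<bar>x\<bar>" for n x
    using t[of n] exp_ge_add_one_self[of "- (t n * \<bar>x\<bar>)"] by (simp_all add: h_def field_simps)
  have hlim: "(\<lambda>n. h n x) \<longlonglongrightarrow> \<bar>x\<bar>" for x
    unfolding h_def t_def by (cases "\<bar>x\<bar> = 0") (simp, real_asymp)
  have hint: "(\<integral>\<^sup>+x. ennreal (h n x) \<partial>N) = ennreal ((1 - laplace N (t n)) / t n)" for n
  proof -
    have i: "integrable N (\<lambda>x. exp (- (t n * \<bar>x\<bar>)))"
      using laplace_integrable[OF N] t[of n] by simp
    have "(\<integral>\<^sup>+x. ennreal (h n x) \<partial>N) = ennreal (\<integral>x. h n x \<partial>N)"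
      using h0 i unfolding h_def by (intro nn_integral_eq_integral) auto
    also have "(\<integral>x. h n x \<partial>N) = (1 - laplace N (t n)) / t n"
      unfolding h_def laplace_def using i by (simp add: N.prob_space[simplified])
    finally show ?thesis .
  qed
  have lim: "(\<lambda>n. (1 - laplace N (t n)) / t n) \<longlonglongrightarrow> 1"
  proof -
    have "(\<lambda>n. (1 - laplace N (t n)) / t n - (1 - exp (- t n)) / t n) \<longlonglongrightarrow> 0"
    proof (rule Lim_null_comparison)
      have "\<bar>(1 - laplace N (t n)) / t n - (1 - exp (- t n)) / t n\<bar> \<le> C * t n powr q / t n" for n
      proof -
        have "\<bar>(1 - laplace N (t n)) / t n - (1 - exp (- t n)) / t n\<bar> = \<bar>laplace N (t n) - exp (- t n)\<bar> / t n"
          using t[of n] by (simp add: diff_divide_distrib[symmetric] abs_minus_commute)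
        also have "\<dots> \<le> C * t n powr q / t n"
          using close[of "t n"] t[of n] by (intro divide_right_mono) auto
        finally show ?thesis .
      qed
      then show "eventually (\<lambda>n. norm ((1 - laplace N (t n)) / t n - (1 - exp (- t n)) / t n)
          \<le> C * t n powr q / t n) sequentially"
        by simp
      show "(\<lambda>n. C * t n powr q / t n) \<longlonglongrightarrow> 0"
        unfolding t_def using q_gt by (cases "C=0"; cases "C > 0") (simp_all, real_asymp+)
    qed
    moreover have "(\<lambda>n. (1 - exp (- t n)) / t n) \<longlonglongrightarrow> 1"
      unfolding t_def by real_asymp
    ultimately have "(\<lambda>n. ((1 - laplace N (t n)) / t n - (1 - exp (- t n)) / t n) + (1 - exp (- t n)) / t n)
        \<longlonglongrightarrow> 0 + 1"
      by (rule tendsto_add)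
    then show ?thesis by simp
  qed
  have elim: "(\<lambda>n. \<integral>\<^sup>+x. ennreal (h n x) \<partial>N) \<longlonglongrightarrow> 1"
    unfolding hint using tendsto_ennrealI[OF lim] by simp
  have "(\<integral>\<^sup>+x. ennreal \<bar>x\<bar> \<partial>N) = (\<integral>\<^sup>+x. liminf (\<lambda>n. ennreal (h n x)) \<partial>N)"
    using lim_imp_Liminf[OF _ tendsto_ennrealI[OF hlim]] by simp
  also have "\<dots> \<le> liminf (\<lambda>n. \<integral>\<^sup>+x. ennreal (h n x) \<partial>N)"
    by (intro nn_integral_liminf) measurable
  also have "\<dots> = 1"
    using lim_imp_Liminf[OF _ elim] by simp
  finally have "(\<integral>\<^sup>+x. ennreal \<bar>x\<bar> \<partial>N) \<le> 1" .
  moreover have "1 \<le> (\<integral>\<^sup>+x. ennreal \<bar>x\<bar> \<partial>N)"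
    using hle by (intro LIMSEQ_le_const2[OF elim] exI[of _ 0] allI impI nn_integral_mono ennreal_leI)
  ultimately show ?thesis by simp
qed

text \<open>
  From \<open>x * y \<ge> x + y - 1\<close> on \<open>[0,1]\<close>, the remainder \<open>L(t) - 1 + t\<close> of a fixed point dominates
  the mean of its values at \<open>a * t\<close> and \<open>b * t\<close>.  Divided by \<open>t\<^sup>2\<close> it is at most half the second
  moment and tends to it as \<open>t\<close> tends to \<open>0\<close>, so that a finite second moment forces
  \<open>a\<^sup>2 + b\<^sup>2\<close> to have mean at most \<open>1\<close>.
\<close>

lemma fixed_point_second_moment:
  assumes N: "real_distribution N"
    and fixed: "\<And>t. 0 \<le> t \<Longrightarrow> laplace N t = (\<integral>p. laplace N (a p * t) * laplace N (b p * t) \<partial>P)"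
    and mean: "(\<integral>\<^sup>+x. ennreal \<bar>x\<bar> \<partial>N) = 1"
    and expanding: "1 < (\<integral>\<^sup>+p. ennreal ((a p)\<^sup>2 + (b p)\<^sup>2) \<partial>P)"
  shows "(\<integral>\<^sup>+x. ennreal (x\<^sup>2) \<partial>N) = \<infinity>"
proof -
  interpret N: real_distribution N by fact
  note [measurable] = laplace_measurable[OF N]
  note L0 = laplace_nonneg[OF N] and L1 = laplace_le_1[OF N]
  define A where "A = (\<integral>\<^sup>+p. ennreal ((a p)\<^sup>2 + (b p)\<^sup>2) \<partial>P)"
  define m where "m = (\<integral>\<^sup>+x. ennreal (x\<^sup>2 / 2) \<partial>N)"
  define r where "r u = exp (- u) - 1 + u" for u :: real
  define R where "R t = laplace N t - 1 + t" for t
  define t where "t n = inverse (real (Suc n))" for n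
  have [measurable]: "r \<in> borel_measurable borel" unfolding r_def by measurable
  have t: "0 < t n" for n by (simp add: t_def)
  have r0: "0 \<le> r u" for u
    using exp_ge_add_one_self[of "- u"] by (simp add: r_def)
  have r2: "r u \<le> u\<^sup>2 / 2" if "0 \<le> u" for u
    using exp_neg_quadratic_bound[OF that] by (simp add: r_def)
  have ix: "integrable N (\<lambda>x. \<bar>x\<bar>)"
    using mean by (intro integrableI_bounded) auto
  have mx: "(\<integral>x. \<bar>x\<bar> \<partial>N) = 1"
    using nn_integral_eq_integral[OF ix] mean by simp
  have ir: "integrable N (\<lambda>x. r (s * \<bar>x\<bar>))" and R_eq: "R s = (\<integral>x. r (s * \<bar>x\<bar>) \<partial>N)" if "0 \<le> s" for s
    using laplace_integrable[OF N that] ix mx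
    by (simp_all add: r_def R_def laplace_def N.prob_space[simplified])
  have R0: "0 \<le> R s" if "0 \<le> s" for s
    unfolding R_eq[OF that] using r0 by simp
  have iR: "integrable P (\<lambda>p. R (a p * s) + R (b p * s))"
    and R_ge: "(\<integral>p. R (a p * s) + R (b p * s) \<partial>P) \<le> R s" if s: "0 \<le> s" for s
  proof -
    have ab: "0 \<le> a p * s" "0 \<le> b p * s" for p using a_nonneg b_nonneg s by simp_all
    have iLa: "integrable P (\<lambda>p. laplace N (a p * s))" and iLb: "integrable P (\<lambda>p. laplace N (b p * s))"
      using ab L0 L1 by (auto intro!: integrable_const_bound[where B=1])
    have iLL: "integrable P (\<lambda>p. laplace N (a p * s) * laplace N (b p * s))"
      using L0 L1 ab by (intro integrable_const_bound[where B=1]) (auto simp: abs_mult intro!: mult_le_one)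
    have iab: "integrable P (\<lambda>p. (a p + b p) * s)"
      using integrable_a integrable_b by simp
    show i: "integrable P (\<lambda>p. R (a p * s) + R (b p * s))"
      unfolding R_def using iLa iLb integrable_a integrable_b by simp
    have "(\<integral>p. R (a p * s) + R (b p * s) \<partial>P)
        \<le> (\<integral>p. (laplace N (a p * s) * laplace N (b p * s) + (a p + b p) * s) - 1 \<partial>P)"
    proof (intro integral_mono i Bochner_Integration.integrable_diff Bochner_Integration.integrable_add iLL iab)
      fix p
      have "0 \<le> (1 - laplace N (a p * s)) * (1 - laplace N (b p * s))"
        using L1 ab by simp
      then show "R (a p * s) + R (b p * s)
          \<le> (laplace N (a p * s) * laplace N (b p * s) + (a p + b p) * s) - 1"
        by (simp add: R_def algebra_simps)
    qed simp
    also have "\<dots> = (\<integral>p. laplace N (a p * s) * laplace N (b p * s) \<partial>P) + (\<integral>p. (a p + b p) * s \<partial>P) - 1"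
      using iLL iab by (subst Bochner_Integration.integral_diff) (simp_all add: prob_space del: integral_mult_left_zero)
    also have "\<dots> = R s"
      using mean_one fixed[OF s] by (simp add: R_def)
    finally show "(\<integral>p. R (a p * s) + R (b p * s) \<partial>P) \<le> R s" .
  qed
  define g where "g n p x = (r (a p * t n * \<bar>x\<bar>) + r (b p * t n * \<bar>x\<bar>)) / (t n)\<^sup>2" for n p x
  have g0: "0 \<le> g n p x" for n p x
    using r0 by (simp add: g_def)
  have g_int: "(\<integral>\<^sup>+p. (\<integral>\<^sup>+x. ennreal (g n p x) \<partial>N) \<partial>P) \<le> m" for n
  proof -
    have t0: "0 \<le> t n" using t[of n] by simp
    have ab: "0 \<le> a p * t n" "0 \<le> b p * t n" for p using a_nonneg b_nonneg t0 by simp_all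
    have "(\<integral>\<^sup>+x. ennreal (g n p x) \<partial>N) = ennreal ((R (a p * t n) + R (b p * t n)) / (t n)\<^sup>2)" for p
    proof -
      have "(\<integral>\<^sup>+x. ennreal (g n p x) \<partial>N) = ennreal (\<integral>x. g n p x \<partial>N)"
        using g0 ir ab unfolding g_def by (intro nn_integral_eq_integral) auto
      then show ?thesis
        unfolding g_def using ir ab by (simp add: R_eq)
    qed
    then have "(\<integral>\<^sup>+p. (\<integral>\<^sup>+x. ennreal (g n p x) \<partial>N) \<partial>P)
        = (\<integral>\<^sup>+p. ennreal ((R (a p * t n) + R (b p * t n)) / (t n)\<^sup>2) \<partial>P)"
      by simp
    also have "\<dots> = ennreal ((\<integral>p. R (a p * t n) + R (b p * t n) \<partial>P) / (t n)\<^sup>2)"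
      using iR[OF t0] R0 ab by (subst nn_integral_eq_integral) auto
    also have "\<dots> \<le> ennreal (R (t n) / (t n)\<^sup>2)"
      using R_ge[OF t0] by (intro ennreal_leI divide_right_mono) auto
    also have "\<dots> = (\<integral>\<^sup>+x. ennreal (r (t n * \<bar>x\<bar>) / (t n)\<^sup>2) \<partial>N)"
      using ir[OF t0] r0 by (subst nn_integral_eq_integral) (auto simp: R_eq[OF t0])
    also have "\<dots> \<le> m"
      unfolding m_def
    proof (intro nn_integral_mono ennreal_leI)
      fix x
      show "r (t n * \<bar>x\<bar>) / (t n)\<^sup>2 \<le> x\<^sup>2 / 2"
        using r2[of "t n * \<bar>x\<bar>"] t[of n] by (simp add: power_mult_distrib field_simps)
    qed
    finally show ?thesis .
  qed
  have g_lim: "(\<lambda>n. g n p x) \<longlonglongrightarrow> ((a p)\<^sup>2 + (b p)\<^sup>2) * (x\<^sup>2 / 2)" for p x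
  proof -
    have "(\<lambda>n. r (u * t n) / (t n)\<^sup>2) \<longlonglongrightarrow> u\<^sup>2 / 2" if "0 \<le> u" for u
    proof (cases "u = 0")
      case True
      then show ?thesis by (simp add: r_def)
    next
      case False
      then have "0 < u" using that by simp
      then have "(\<lambda>n. r (u * t n) / (t n)\<^sup>2) \<longlonglongrightarrow> u * u / 2"
        unfolding r_def t_def by real_asymp
      then show ?thesis by (simp add: power2_eq_square)
    qed
    from tendsto_add[OF this this, of "a p * \<bar>x\<bar>" "b p * \<bar>x\<bar>"] show ?thesis
      using a_nonneg[of p] b_nonneg[of p]
      by (simp add: g_def add_divide_distrib power_mult_distrib algebra_simps)
  qed
  have "A * m = (\<integral>\<^sup>+p. (\<integral>\<^sup>+x. ennreal (((a p)\<^sup>2 + (b p)\<^sup>2) * (x\<^sup>2 / 2)) \<partial>N) \<partial>P)"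
  proof -
    have "(\<integral>\<^sup>+x. ennreal (((a p)\<^sup>2 + (b p)\<^sup>2) * (x\<^sup>2 / 2)) \<partial>N) = ennreal ((a p)\<^sup>2 + (b p)\<^sup>2) * m" for p
      unfolding m_def by (subst nn_integral_cmult[symmetric], simp) (simp only: ennreal_mult'[symmetric] sum_power2_ge_zero)
    then show ?thesis
      unfolding A_def by (subst nn_integral_multc[symmetric]) simp_all
  qed
  also have "\<dots> = (\<integral>\<^sup>+p. (\<integral>\<^sup>+x. liminf (\<lambda>n. ennreal (g n p x)) \<partial>N) \<partial>P)"
    using lim_imp_Liminf[OF _ tendsto_ennrealI[OF g_lim]] by simp
  also have "\<dots> \<le> (\<integral>\<^sup>+p. liminf (\<lambda>n. \<integral>\<^sup>+x. ennreal (g n p x) \<partial>N) \<partial>P)"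
    unfolding g_def by (intro nn_integral_mono nn_integral_liminf) measurable
  also have "\<dots> \<le> liminf (\<lambda>n. \<integral>\<^sup>+p. (\<integral>\<^sup>+x. ennreal (g n p x) \<partial>N) \<partial>P)"
    unfolding g_def by (intro nn_integral_liminf) measurable
  also have "\<dots> \<le> liminf (\<lambda>n. m)"
    using g_int by (intro Liminf_mono) simp
  finally have Am: "A * m \<le> m" by (simp add: Liminf_const)
  have "m \<noteq> 0"
  proof
    assume "m = 0"
    then have "AE x in N. x = 0"
      unfolding m_def by (subst (asm) nn_integral_0_iff_AE) (auto elim!: eventually_mono)
    then have "(\<integral>\<^sup>+x. ennreal \<bar>x\<bar> \<partial>N) = (\<integral>\<^sup>+x. 0 \<partial>N)"
      by (intro nn_integral_cong_AE) (auto elim!: eventually_mono)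
    then show False using mean by simp
  qed
  have "m = \<infinity>"
  proof (rule ccontr)
    assume "m \<noteq> \<infinity>"
    then have "1 * m < A * m"
      using expanding \<open>m \<noteq> 0\<close> unfolding A_def[symmetric]
      by (intro ennreal_mult_strict_right_mono) (auto simp: top.not_eq_extremum zero_less_iff_neq_zero)
    then show False using Am by simp
  qed
  moreover have "m \<le> (\<integral>\<^sup>+x. ennreal (x\<^sup>2) \<partial>N)"
    unfolding m_def by (intro nn_integral_mono ennreal_leI) simp
  ultimately show ?thesis by (simp add: top_unique)
qed

end

section \<open>One-dimensional marginals of the uniform law on the sphere\<close>

lemma cdf_abs_uniform:
  assumes "real_distribution M" and M: "\<And>c. 0 < c \<Longrightarrow> c < 1 \<Longrightarrow> measure M {x. \<bar>x\<bar> \<le> c} = c"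
  shows "cdf (distr M borel abs) x = max 0 (min 1 x)"
proof -
  interpret real_distribution M by fact
  have cdf: "cdf (distr M borel abs) x = prob {y. \<bar>y\<bar> \<le> x}"
    by (simp add: cdf_def measure_distr vimage_def)
  have upper: "prob {y. \<bar>y\<bar> \<le> x} \<le> max 0 x"
  proof (rule field_le_epsilon)
    fix \<epsilon> :: real assume "0 < \<epsilon>"
    show "prob {y. \<bar>y\<bar> \<le> x} \<le> max 0 x + \<epsilon>"
    proof (cases "max 0 x + \<epsilon> < 1")
      case True
      have "prob {y. \<bar>y\<bar> \<le> x} \<le> prob {y. \<bar>y\<bar> \<le> max 0 x + \<epsilon>}"
        using \<open>0 < \<epsilon>\<close> by (intro finite_measure_mono) auto
      then show ?thesis using M[of "max 0 x + \<epsilon>"] True \<open>0 < \<epsilon>\<close> by simp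
    qed (use prob_le_1[of "{y. \<bar>y\<bar> \<le> x}"] in linarith)
  qed
  have lower: "min 1 x \<le> prob {y. \<bar>y\<bar> \<le> x}"
  proof (rule field_le_epsilon)
    fix \<epsilon> :: real assume "0 < \<epsilon>"
    show "min 1 x \<le> prob {y. \<bar>y\<bar> \<le> x} + \<epsilon>"
    proof (cases "min 1 x - \<epsilon> > 0")
      case True
      have "prob {y. \<bar>y\<bar> \<le> min 1 x - \<epsilon>} \<le> prob {y. \<bar>y\<bar> \<le> x}"
        using \<open>0 < \<epsilon>\<close> by (intro finite_measure_mono) auto
      then show ?thesis using M[of "min 1 x - \<epsilon>"] True \<open>0 < \<epsilon>\<close> by simp
    qed (use measure_nonneg[of M "{y. \<bar>y\<bar> \<le> x}"] in linarith)
  qed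
  show ?thesis
    unfolding cdf using upper lower prob_le_1[of "{y. \<bar>y\<bar> \<le> x}"] measure_nonneg[of M "{y. \<bar>y\<bar> \<le> x}"]
    by linarith
qed

text \<open>A symmetric law is determined by the law of the absolute value, as its characteristic function is
  the mean of \<open>cos (t * \<bar>x\<bar>)\<close>.\<close>

lemma symmetric_uniform_unique:
  assumes M: "real_distribution M" "distr M borel uminus = M"
      "\<And>c. 0 < c \<Longrightarrow> c < 1 \<Longrightarrow> measure M {x. \<bar>x\<bar> \<le> c} = c"
    and N: "real_distribution N" "distr N borel uminus = N"
      "\<And>c. 0 < c \<Longrightarrow> c < 1 \<Longrightarrow> measure N {x. \<bar>x\<bar> \<le> c} = c"
  shows "M = N"
proof (rule Levy_uniqueness[OF M(1) N(1)], rule ext)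
  fix t :: real
  have char: "char L t = (\<integral>y. complex_of_real (cos (t * y)) \<partial>distr L borel abs)"
    if L: "real_distribution L" "distr L borel uminus = L" for L
  proof -
    interpret real_distribution L by fact
    have i: "integrable L (\<lambda>x. iexp (t * x))" "integrable L (\<lambda>x. iexp (t * (- x)))"
      by (auto intro!: integrable_const_bound[where B=1])
    have "char L t = (\<integral>x. iexp (t * (- x)) \<partial>L)"
      unfolding char_def by (subst L(2)[symmetric], subst integral_distr) auto
    then have "2 * char L t = (\<integral>x. iexp (t * x) + iexp (t * (- x)) \<partial>L)"
      using i by (simp add: char_def)
    also have "\<dots> = (\<integral>x. 2 * complex_of_real (cos (t * \<bar>x\<bar>)) \<partial>L)"
    proof (rule Bochner_Integration.integral_cong[OF refl])
      fix x
      have "iexp (t * x) + iexp (t * (- x)) = cis (t * x) + cis (- (t * x))"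
        by (simp only: cis_conv_exp mult_minus_right)
      also have "\<dots> = 2 * complex_of_real (cos (t * \<bar>x\<bar>))"
        by (simp add: complex_eq_iff abs_if)
      finally show "iexp (t * x) + iexp (t * (- x)) = 2 * complex_of_real (cos (t * \<bar>x\<bar>))" .
    qed
    also have "\<dots> = 2 * (\<integral>y. complex_of_real (cos (t * y)) \<partial>distr L borel abs)"
      by (subst integral_distr) auto
    finally show ?thesis by simp
  qed
  interpret M: real_distribution M by fact
  interpret N: real_distribution N by fact
  have "distr M borel abs = distr N borel abs"
    by (rule cdf_unique[OF M.real_distribution_distr N.real_distribution_distr])
       (auto simp: cdf_abs_uniform[OF M(1,3)] cdf_abs_uniform[OF N(1,3)])
  then show "char M t = char N t"
    by (simp add: char M N)
qed

text \<open>Archimedes' computation: the part of the unit ball over the cone \<open>c * \<bar>x\<bar> < \<bar>x\<^sub>3\<bar>\<close> has horizontal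
  slices that are discs, whose squared radius changes its formula at height \<open>c\<close>.\<close>

lemma nn_integral_slice_area:
  fixes c :: real
  assumes c: "0 < c" "c < 1"
  shows "(\<integral>\<^sup>+h. ennreal (pi * max 0 (min (1 - h\<^sup>2) ((1 - c\<^sup>2) / c\<^sup>2 * h\<^sup>2))) \<partial>lborel)
    = ennreal (4 / 3 * pi * (1 - c))"
proof -
  define \<kappa> where "\<kappa> = (1 - c\<^sup>2) / c\<^sup>2"
  have c2: "0 < c\<^sup>2" "c\<^sup>2 < 1" using c by (auto simp: power_less_one_iff abs_square_less_1)
  have \<kappa>: "0 \<le> \<kappa>" using c2 by (simp add: \<kappa>_def)
  let ?f = "\<lambda>h. ennreal (pi * (\<kappa> * h\<^sup>2)) * indicator {- c..c} h
      + (ennreal (pi * (1 - h\<^sup>2)) * indicator {c..1} h + ennreal (pi * (1 - h\<^sup>2)) * indicator {- 1..- c} h)"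
  have eq: "ennreal (pi * max 0 (min (1 - h\<^sup>2) (\<kappa> * h\<^sup>2))) = ?f h" if "h \<noteq> c" "h \<noteq> - c" for h
  proof -
    have cross: "\<kappa> * h\<^sup>2 \<le> 1 - h\<^sup>2 \<longleftrightarrow> \<bar>h\<bar> \<le> c"
    proof -
      have "\<kappa> * h\<^sup>2 \<le> 1 - h\<^sup>2 \<longleftrightarrow> h\<^sup>2 \<le> c\<^sup>2"
        using c2 by (simp add: \<kappa>_def field_simps)
      also have "\<dots> \<longleftrightarrow> \<bar>h\<bar> \<le> c"
        using c by (simp add: abs_le_square_iff[symmetric])
      finally show ?thesis .
    qed
    have pos: "0 \<le> 1 - h\<^sup>2 \<longleftrightarrow> \<bar>h\<bar> \<le> 1"
      by (simp add: abs_square_le_1)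
    have nn: "0 \<le> \<kappa> * h\<^sup>2" using \<kappa> by simp
    consider "\<bar>h\<bar> < c" | "c < \<bar>h\<bar>" "\<bar>h\<bar> \<le> 1" | "1 < \<bar>h\<bar>"
      using \<open>h \<noteq> c\<close> \<open>h \<noteq> - c\<close> by linarith
    then show ?thesis
    proof cases
      case 1
      then have "h \<in> {- c..c}" "h \<notin> {c..1}" "h \<notin> {- 1..- c}" by auto
      moreover have "max 0 (min (1 - h\<^sup>2) (\<kappa> * h\<^sup>2)) = \<kappa> * h\<^sup>2"
        using cross nn 1 by (simp add: min_def max_def)
      ultimately show ?thesis by simp
    next
      case 2
      then have "h \<notin> {- c..c}" "(h \<in> {c..1} \<and> h \<notin> {- 1..- c}) \<or> (h \<notin> {c..1} \<and> h \<in> {- 1..- c})"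
        using c by auto
      moreover have "max 0 (min (1 - h\<^sup>2) (\<kappa> * h\<^sup>2)) = 1 - h\<^sup>2"
        using cross pos 2 by (simp add: min_def max_def)
      ultimately show ?thesis by (auto simp: indicator_def)
    next
      case 3
      then have "h \<notin> {- c..c}" "h \<notin> {c..1}" "h \<notin> {- 1..- c}" using c by auto
      moreover have "max 0 (min (1 - h\<^sup>2) (\<kappa> * h\<^sup>2)) = 0"
        using pos 3 by (simp add: min_def max_def)
      ultimately show ?thesis by simp
    qed
  qed
  have "(\<integral>\<^sup>+h. ennreal (pi * max 0 (min (1 - h\<^sup>2) (\<kappa> * h\<^sup>2))) \<partial>lborel) = (\<integral>\<^sup>+h. ?f h \<partial>lborel)"
    using AE_lborel_singleton[of c] AE_lborel_singleton[of "- c"]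
    by (intro nn_integral_cong_AE) (auto elim!: eventually_elim2 intro: eq)
  also have "\<dots> = ennreal (pi * \<kappa> * c ^ 3 / 3 - pi * \<kappa> * (- c) ^ 3 / 3)
      + (ennreal (pi * (1 - 1 ^ 3 / 3) - pi * (c - c ^ 3 / 3))
        + ennreal (pi * (- c - (- c) ^ 3 / 3) - pi * (- 1 - (- 1) ^ 3 / 3)))"
  proof -
    have i1: "(\<integral>\<^sup>+h. ennreal (pi * (\<kappa> * h\<^sup>2)) * indicator {- c..c} h \<partial>lborel)
        = ennreal (pi * \<kappa> * c ^ 3 / 3 - pi * \<kappa> * (- c) ^ 3 / 3)"
      using c \<kappa> by (intro nn_integral_FTC_Icc) (auto intro!: derivative_eq_intros simp: power2_eq_square)
    have i2: "(\<integral>\<^sup>+h. ennreal (pi * (1 - h\<^sup>2)) * indicator {c..1} h \<partial>lborel)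
        = ennreal (pi * (1 - 1 ^ 3 / 3) - pi * (c - c ^ 3 / 3))"
      using c by (intro nn_integral_FTC_Icc) (auto intro!: derivative_eq_intros simp: abs_square_le_1)
    have i3: "(\<integral>\<^sup>+h. ennreal (pi * (1 - h\<^sup>2)) * indicator {- 1..- c} h \<partial>lborel)
        = ennreal (pi * (- c - (- c) ^ 3 / 3) - pi * (- 1 - (- 1) ^ 3 / 3))"
      using c by (intro nn_integral_FTC_Icc) (auto intro!: derivative_eq_intros simp: abs_square_le_1)
    show ?thesis
      unfolding i1[symmetric] i2[symmetric] i3[symmetric]
      by (simp add: nn_integral_add)
  qed
  also have "\<dots> = ennreal (4 / 3 * pi * (1 - c))"
  proof -
    have "c ^ 3 \<le> c" using c power_decreasing[of 1 3 c] by simp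
    have p1: "0 \<le> pi * \<kappa> * c ^ 3 / 3 - pi * \<kappa> * (- c) ^ 3 / 3"
      using c \<kappa> by (simp add: power_minus_odd)
    have "3 * c - c ^ 3 \<le> 2"
    proof -
      have "0 \<le> (1 - c)\<^sup>2 * (2 + c)" using c by simp
      then show ?thesis by (simp add: power2_eq_square power3_eq_cube algebra_simps)
    qed
    then have "0 \<le> pi * (2 - (3 * c - c ^ 3)) / 3" by simp
    then have p2: "0 \<le> pi * (1 - 1 ^ 3 / 3) - pi * (c - c ^ 3 / 3)"
      "0 \<le> pi * (- c - (- c) ^ 3 / 3) - pi * (- 1 - (- 1) ^ 3 / 3)"
      by (simp_all add: power_minus_odd field_simps)
    have "\<kappa> * c ^ 3 = c * (1 - c\<^sup>2)"
      using c by (simp add: \<kappa>_def power3_eq_cube power2_eq_square)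
    then have "pi * \<kappa> * c ^ 3 / 3 - pi * \<kappa> * (- c) ^ 3 / 3 = pi * (2 * (c * (1 - c\<^sup>2)) / 3)"
      by (simp add: power_minus_odd mult.assoc)
    then have "(pi * \<kappa> * c ^ 3 / 3 - pi * \<kappa> * (- c) ^ 3 / 3)
        + ((pi * (1 - 1 ^ 3 / 3) - pi * (c - c ^ 3 / 3))
          + (pi * (- c - (- c) ^ 3 / 3) - pi * (- 1 - (- 1) ^ 3 / 3))) = 4 / 3 * pi * (1 - c)"
      by (simp add: power_minus_odd power3_eq_cube power2_eq_square field_simps)
    then show ?thesis
      using p1 p2 by (simp only: ennreal_plus[symmetric] add_nonneg_nonneg)
  qed
  finally show ?thesis unfolding \<kappa>_def .
qed

definition cone_part :: "real^3 \<Rightarrow> real \<Rightarrow> (real^3) set" where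
  "cone_part u c = {x \<in> ball 0 1. c * norm x < \<bar>x \<bullet> u\<bar>}"

lemma cone_part_sets [measurable]: "cone_part u c \<in> sets borel"
proof -
  have "cone_part u c = ball 0 1 \<inter> {x. c * norm x < \<bar>x \<bullet> u\<bar>}"
    by (auto simp: cone_part_def)
  then show ?thesis by simp
qed

lemma emeasure_lborel_Times:
  fixes A :: "'a::euclidean_space set" and B :: "'b::euclidean_space set"
  assumes "A \<in> sets borel" "B \<in> sets borel"
  shows "emeasure lborel (A \<times> B) = emeasure lborel A * emeasure lborel B"
  using assms by (simp add: lborel_prod[symmetric] lborel.emeasure_pair_measure_Times)

lemma lborel_vector3:
  "distr lborel borel (\<lambda>(h, x, y). vector [x, y, h]) = (lborel :: (real^3) measure)"
proof (rule lborel_eqI[symmetric])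
  have "vector [x, y, h] = x *\<^sub>R axis 1 1 + y *\<^sub>R axis 2 1 + h *\<^sub>R (axis 3 1 :: real^3)" for h x y :: real
    by (simp add: vec_eq_iff forall_3 axis_def)
  then have [measurable]: "(\<lambda>(h::real, x::real, y::real). (vector [x, y, h] :: real^3)) \<in> borel_measurable borel"
    unfolding borel_prod[symmetric] by (simp only:) measurable
  fix l u :: "real^3" assume le: "\<And>b. b \<in> Basis \<Longrightarrow> l \<bullet> b \<le> u \<bullet> b"
  have le': "l $ i \<le> u $ i" for i
    using le[of "axis i 1"] by (simp add: inner_axis axis_in_Basis_iff)
  have "(\<lambda>(h, x, y). vector [x, y, h]) -` box l u = {l$3<..<u$3} \<times> ({l$1<..<u$1} \<times> {l$2<..<u$2})"
    by (auto simp: mem_box_cart forall_3)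
  moreover have "emeasure lborel ({l$3<..<u$3} \<times> ({l$1<..<u$1} \<times> {l$2<..<u$2}))
      = ennreal ((u$3 - l$3) * ((u$1 - l$1) * (u$2 - l$2)))"
  proof -
    have "emeasure lborel ({l$1<..<u$1} \<times> {l$2<..<u$2}) = ennreal ((u$1 - l$1) * (u$2 - l$2))"
      using le'[of 1] le'[of 2] by (subst emeasure_lborel_Times) (simp_all add: ennreal_mult)
    moreover have "{l$1<..<u$1} \<times> {l$2<..<u$2} \<in> sets borel"
      by (intro borel_open open_Times open_greaterThanLessThan)
    ultimately show ?thesis
      using le'[of 1] le'[of 2] le'[of 3] by (subst emeasure_lborel_Times) (simp_all add: ennreal_mult)
  qed
  moreover have "(\<Prod>b\<in>Basis. (u - l) \<bullet> b) = (u$3 - l$3) * ((u$1 - l$1) * (u$2 - l$2))"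
  proof -
    have "(\<Prod>b\<in>Basis. (u - l) \<bullet> b) = (\<Prod>i\<in>UNIV. (u - l) $ i)"
      by (rule prod.reindex_cong[where l="\<lambda>i. axis i 1"])
         (auto simp: inj_on_def axis_eq_axis Basis_vec_def inner_axis)
    also have "\<dots> = (u - l) $ 1 * (u - l) $ 2 * (u - l) $ 3" unfolding UNIV_3 by (simp add: mult.assoc)
    finally show ?thesis by (simp only: vector_minus_component mult_ac)
  qed
  ultimately show "emeasure (distr lborel borel (\<lambda>(h, x, y). vector [x, y, h])) (box l u)
      = ennreal (\<Prod>b\<in>Basis. (u - l) \<bullet> b)"
    by (subst emeasure_distr) simp_all
qed simp
lemma slice_eq_ball:
  fixes c h :: real
  assumes c: "0 < c"
  shows "{y::real \<times> real. (norm y)\<^sup>2 + h\<^sup>2 < 1 \<and> c * sqrt ((norm y)\<^sup>2 + h\<^sup>2) < \<bar>h\<bar>}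
    = ball 0 (sqrt (max 0 (min (1 - h\<^sup>2) ((1 - c\<^sup>2) / c\<^sup>2 * h\<^sup>2))))"
proof (rule Collect_cong[THEN trans])
  fix y :: "real \<times> real"
  let ?m = "max 0 (min (1 - h\<^sup>2) ((1 - c\<^sup>2) / c\<^sup>2 * h\<^sup>2))"
  have "c * sqrt ((norm y)\<^sup>2 + h\<^sup>2) < \<bar>h\<bar> \<longleftrightarrow> (c * sqrt ((norm y)\<^sup>2 + h\<^sup>2))\<^sup>2 < \<bar>h\<bar>\<^sup>2"
  proof -
    have "(c * sqrt ((norm y)\<^sup>2 + h\<^sup>2))\<^sup>2 \<ge> \<bar>h\<bar>\<^sup>2 \<longleftrightarrow> c * sqrt ((norm y)\<^sup>2 + h\<^sup>2) \<ge> \<bar>h\<bar>"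
      using c by (intro power_mono_iff) auto
    then show ?thesis by (simp only: not_le[symmetric])
  qed
  also have "\<dots> \<longleftrightarrow> c\<^sup>2 * ((norm y)\<^sup>2 + h\<^sup>2) < h\<^sup>2"
    by (simp add: power_mult_distrib)
  also have "\<dots> \<longleftrightarrow> (norm y)\<^sup>2 < (1 - c\<^sup>2) / c\<^sup>2 * h\<^sup>2"
    using c by (simp add: field_simps)
  finally have "(norm y)\<^sup>2 + h\<^sup>2 < 1 \<and> c * sqrt ((norm y)\<^sup>2 + h\<^sup>2) < \<bar>h\<bar> \<longleftrightarrow> (norm y)\<^sup>2 < ?m"
    using zero_le_power2[of "norm y"] by linarith
  also have "\<dots> \<longleftrightarrow> norm y < sqrt ?m"
    by (metis norm_ge_zero real_less_rsqrt real_sqrt_abs abs_norm_cancel real_sqrt_less_iff)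
  finally show "(norm y)\<^sup>2 + h\<^sup>2 < 1 \<and> c * sqrt ((norm y)\<^sup>2 + h\<^sup>2) < \<bar>h\<bar> \<longleftrightarrow> norm y < sqrt ?m" .
qed auto

lemma emeasure_cone_part_axis:
  assumes c: "0 < c" "c < 1"
  shows "emeasure lborel (cone_part (axis 3 1) c) = ennreal (4 / 3 * pi * (1 - c))"
proof -
  let ?v = "\<lambda>(h::real, x::real, y::real). vector [x, y, h] :: real^3"
  have "vector [x, y, h] = x *\<^sub>R axis 1 1 + y *\<^sub>R axis 2 1 + h *\<^sub>R (axis 3 1 :: real^3)" for h x y :: real
    by (simp add: vec_eq_iff forall_3 axis_def)
  then have v [measurable]: "?v \<in> borel_measurable borel"
    unfolding borel_prod[symmetric] by (simp only:) measurable
  define A where "A = ?v -` cone_part (axis 3 1) c"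
  have A: "A \<in> sets (lborel \<Otimes>\<^sub>M lborel)"
  proof -
    have "sets (lborel \<Otimes>\<^sub>M lborel) = sets (borel :: (real \<times> real \<times> real) measure)"
      by (simp only: lborel_prod sets_lborel)
    then show ?thesis
      using measurable_sets[OF v cone_part_sets] by (simp only: A_def space_borel Int_UNIV_right)
  qed
  have "emeasure lborel (cone_part (axis 3 1) c) = emeasure lborel A"
  proof -
    have v': "?v \<in> measurable lborel borel" using v by (simp only: measurable_cong_sets[OF sets_lborel refl])
    have "emeasure lborel (cone_part (axis 3 1) c) = emeasure (distr lborel borel ?v) (cone_part (axis 3 1) c)"
      by (simp only: lborel_vector3)
    also have "\<dots> = emeasure lborel (?v -` cone_part (axis 3 1) c \<inter> space lborel)"
      by (rule emeasure_distr[OF v' cone_part_sets])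
    finally show ?thesis by (simp only: A_def space_lborel space_borel Int_UNIV_right)
  qed
  also have "\<dots> = (\<integral>\<^sup>+h. emeasure lborel (Pair h -` A) \<partial>lborel)"
    using lborel.emeasure_pair_measure_alt[OF A] by (simp add: lborel_prod)
  also have "\<dots> = (\<integral>\<^sup>+h. ennreal (pi * max 0 (min (1 - h\<^sup>2) ((1 - c\<^sup>2) / c\<^sup>2 * h\<^sup>2))) \<partial>lborel)"
  proof (rule nn_integral_cong)
    fix h
    have nv: "norm (vector [x, y, h] :: real^3) = sqrt ((norm (x, y))\<^sup>2 + h\<^sup>2)" for x y
      by (simp add: norm_vec_def L2_set_def sum_3 norm_Pair)
    have iv: "(vector [x, y, h] :: real^3) \<bullet> axis 3 1 = h" for x y :: real
      by (simp add: inner_axis)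
    have "Pair h -` A = {y. (norm y)\<^sup>2 + h\<^sup>2 < 1 \<and> c * sqrt ((norm y)\<^sup>2 + h\<^sup>2) < \<bar>h\<bar>}"
    proof (rule set_eqI)
      fix y :: "real \<times> real"
      obtain x1 x2 where y: "y = (x1, x2)" by (cases y)
      have "y \<in> Pair h -` A \<longleftrightarrow> norm (vector [x1, x2, h] :: real^3) < 1
          \<and> c * norm (vector [x1, x2, h] :: real^3) < \<bar>(vector [x1, x2, h] :: real^3) \<bullet> axis 3 1\<bar>"
        by (simp only: y A_def cone_part_def vimage_eq mem_Collect_eq prod.case mem_ball_0)
      then show "y \<in> Pair h -` A \<longleftrightarrow> y \<in> {y. (norm y)\<^sup>2 + h\<^sup>2 < 1 \<and> c * sqrt ((norm y)\<^sup>2 + h\<^sup>2) < \<bar>h\<bar>}"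
        using real_sqrt_less_iff[of "(norm (x1, x2))\<^sup>2 + h\<^sup>2" 1]
        unfolding nv[of x1 x2] iv y mem_Collect_eq real_sqrt_one by blast
    qed
    also have "\<dots> = ball 0 (sqrt (max 0 (min (1 - h\<^sup>2) ((1 - c\<^sup>2) / c\<^sup>2 * h\<^sup>2))))"
      by (rule slice_eq_ball[OF c(1)])
    also have "emeasure lborel \<dots> = ennreal (pi * max 0 (min (1 - h\<^sup>2) ((1 - c\<^sup>2) / c\<^sup>2 * h\<^sup>2)))"
      by (subst emeasure_ball) (auto simp: unit_ball_vol_2)
    finally show "emeasure lborel (Pair h -` A) = ennreal (pi * max 0 (min (1 - h\<^sup>2) ((1 - c\<^sup>2) / c\<^sup>2 * h\<^sup>2)))" .
  qed
  also have "\<dots> = ennreal (4 / 3 * pi * (1 - c))"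
    by (rule nn_integral_slice_area[OF c])
  finally show ?thesis .
qed

lemma emeasure_cone_part:
  assumes c: "0 < c" "c < 1" and u: "norm u = 1"
  shows "emeasure lborel (cone_part u c) = ennreal (4 / 3 * pi * (1 - c))"
proof -
  obtain f :: "real^3 \<Rightarrow> real^3" where f: "orthogonal_transformation f" "f (axis 3 1) = u"
  proof -
    have "norm (axis 3 1 :: real^3) = norm u" by (simp add: u)
    from orthogonal_transformation_exists[OF this] show ?thesis using that by metis
  qed
  have fin: "emeasure lborel (cone_part v c) < \<infinity>" for v
  proof -
    have "cone_part v c \<subseteq> ball 0 1" by (auto simp: cone_part_def)
    then have "emeasure lborel (cone_part v c) \<le> emeasure lborel (ball (0::real^3) 1)"
      by (rule emeasure_mono) simp
    then show ?thesis
      using emeasure_bounded_finite[OF bounded_ball[of "0::real^3" 1]] by (rule le_less_trans)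
  qed
  have lm: "cone_part v c \<in> lmeasurable" for v
    using fin[of v] by (intro fmeasurableI) auto
  have pres: "f y \<bullet> u = y \<bullet> axis 3 1" "norm (f y) = norm y" for y
  proof -
    have "f y \<bullet> f (axis 3 1) = y \<bullet> axis 3 1"
      using f(1) unfolding orthogonal_transformation_def by blast
    then show "f y \<bullet> u = y \<bullet> axis 3 1" by (simp only: f(2))
    show "norm (f y) = norm y" by (rule orthogonal_transformation_norm[OF f(1)])
  qed
  have "cone_part u c = f ` cone_part (axis 3 1) c"
  proof (intro set_eqI iffI)
    fix x assume x: "x \<in> cone_part u c"
    obtain y where y: "f y = x"
      using orthogonal_transformation_surj[OF f(1)] by (metis surjD)
    then have "y \<in> cone_part (axis 3 1) c"
      using x by (auto simp: cone_part_def pres)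
    then show "x \<in> f ` cone_part (axis 3 1) c" using y by auto
  next
    fix x assume "x \<in> f ` cone_part (axis 3 1) c"
    then show "x \<in> cone_part u c"
      by (auto simp: cone_part_def pres)
  qed
  then have "measure lebesgue (cone_part u c) = measure lebesgue (cone_part (axis 3 1) c)"
    using measure_orthogonal_image[OF f(1) lm] by simp
  then have "measure lborel (cone_part u c) = measure lborel (cone_part (axis 3 1) c)"
    by (simp add: measure_completion)
  then have "emeasure lborel (cone_part u c) = emeasure lborel (cone_part (axis 3 1) c)"
    using fin by (simp add: emeasure_eq_ennreal_measure less_top)
  then show ?thesis using emeasure_cone_part_axis[OF c] by simp
qed

definition unif_sphere :: "(real^3) measure" where
  "unif_sphere = density sphere_measure (\<lambda>_. ennreal (1 / (4 * pi)))"

definition unif_interval :: "real measure" where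
  "unif_interval = uniform_measure lborel {0..1}"

lemma sets_sphere_measure [simp, measurable_cong]: "sets sphere_measure = sets borel"
  by (simp add: sphere_measure_def)

lemma space_sphere_measure [simp]: "space sphere_measure = UNIV"
  by (simp add: sphere_measure_def)

lemma sets_unif_sphere [simp, measurable_cong]: "sets unif_sphere = sets borel"
  by (simp add: unif_sphere_def)

lemma space_unif_sphere [simp]: "space unif_sphere = UNIV"
  by (simp add: unif_sphere_def sphere_measure_def)

lemma sets_unif_interval [simp, measurable_cong]: "sets unif_interval = sets borel"
  by (simp add: unif_interval_def)

lemma space_unif_interval [simp]: "space unif_interval = UNIV"
  by (simp add: unif_interval_def)

lemma prob_space_unif_sphere: "prob_space unif_sphere"
  by (rule prob_spaceI)
     (simp add: unif_sphere_def sphere_measure_def emeasure_density_const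
       emeasure_sphere_measure_UNIV[unfolded sphere_measure_def] ennreal_mult[symmetric])

lemma prob_space_unif_interval: "prob_space unif_interval"
  unfolding unif_interval_def by (rule prob_space_uniform_measure) auto

lemma AE_unif_sphere: "AE \<sigma> in unif_sphere. norm \<sigma> = 1"
  using AE_sphere_measure unfolding unif_sphere_def by (subst AE_density) auto

lemma AE_unif_interval: "AE s in unif_interval. 0 \<le> s \<and> s \<le> 1"
  unfolding unif_interval_def by (rule AE_uniform_measureI) auto

lemma integral_sphere_measure:
  fixes h :: "real^3 \<Rightarrow> real"
  assumes "h \<in> borel_measurable borel"
  shows "(\<integral>\<sigma>. h \<sigma> \<partial>sphere_measure) = 4 * pi * (\<integral>\<sigma>. h \<sigma> \<partial>unif_sphere)"
  using assms unfolding unif_sphere_def by (subst integral_density) auto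

lemma sgn_borel_measurable [measurable]: "(sgn :: real^3 \<Rightarrow> real^3) \<in> borel_measurable borel"
  unfolding sgn_div_norm[abs_def] by measurable

lemma unif_sphere_abs_inner:
  assumes c: "0 < c" "c < 1" and u: "norm u = 1"
  shows "measure unif_sphere {\<sigma>. \<bar>\<sigma> \<bullet> u\<bar> \<le> c} = c"
proof -
  interpret prob_space unif_sphere by (rule prob_space_unif_sphere)
  have "emeasure sphere_measure {\<sigma>. c < \<bar>\<sigma> \<bullet> u\<bar>}
      = (\<integral>\<^sup>+x. 3 * indicator (ball 0 1) x * indicator (sgn -` {\<sigma>. c < \<bar>\<sigma> \<bullet> u\<bar>}) x \<partial>lborel)"
    unfolding sphere_measure_def by (subst emeasure_distr, simp, simp, subst emeasure_density) auto
  also have "\<dots> = (\<integral>\<^sup>+x. 3 * indicator (cone_part u c) x \<partial>lborel)"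
  proof (rule nn_integral_cong)
    fix x :: "real^3"
    have "c < \<bar>sgn x \<bullet> u\<bar> \<longleftrightarrow> c * norm x < \<bar>x \<bullet> u\<bar>"
      using c by (cases "x = 0") (auto simp: sgn_div_norm abs_mult field_simps)
    then show "3 * indicator (ball 0 1) x * indicator (sgn -` {\<sigma>. c < \<bar>\<sigma> \<bullet> u\<bar>}) x
        = (3 * indicator (cone_part u c) x :: ennreal)"
      by (auto simp: cone_part_def indicator_def)
  qed
  also have "\<dots> = 3 * ennreal (4 / 3 * pi * (1 - c))"
    using emeasure_cone_part[OF c u] by (simp add: nn_integral_cmult_indicator)
  also have "\<dots> = ennreal (4 * pi * (1 - c))"
    using c by (simp add: ennreal_mult'[symmetric] flip: ennreal_numeral)
  finally have "emeasure unif_sphere {\<sigma>. c < \<bar>\<sigma> \<bullet> u\<bar>} = ennreal (1 - c)"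
    using c by (simp add: unif_sphere_def emeasure_density_const ennreal_mult[symmetric])
  then have "prob {\<sigma>. c < \<bar>\<sigma> \<bullet> u\<bar>} = 1 - c"
    using c by (simp add: measure_def)
  moreover have "prob (space unif_sphere - {\<sigma>. c < \<bar>\<sigma> \<bullet> u\<bar>}) = 1 - prob {\<sigma>. c < \<bar>\<sigma> \<bullet> u\<bar>}"
    by (rule prob_compl) simp
  moreover have "space unif_sphere - {\<sigma>. c < \<bar>\<sigma> \<bullet> u\<bar>} = {\<sigma>. \<bar>\<sigma> \<bullet> u\<bar> \<le> c}"
    by auto
  ultimately show ?thesis by simp
qed

lemma unif_sphere_uminus: "distr unif_sphere borel uminus = unif_sphere"
proof (rule measure_eqI)
  fix A :: "(real^3) set" assume "A \<in> sets (distr unif_sphere borel uminus)"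
  then have [measurable]: "A \<in> sets borel" by simp
  have sgn: "emeasure sphere_measure B = 3 * emeasure lborel (ball 0 1 \<inter> sgn -` B)" if [measurable]: "B \<in> sets borel" for B
  proof -
    have [measurable]: "sgn -` B \<in> sets borel"
      using measurable_sets[OF sgn_borel_measurable that] by simp
    have "emeasure sphere_measure B = (\<integral>\<^sup>+x. 3 * indicator (ball 0 1) x * indicator (sgn -` B) x \<partial>lborel)"
      unfolding sphere_measure_def by (subst emeasure_distr, simp, simp, subst emeasure_density) auto
    also have "\<dots> = (\<integral>\<^sup>+x. 3 * indicator (ball 0 1 \<inter> sgn -` B) x \<partial>lborel)"
      by (intro nn_integral_cong) (auto simp: indicator_def)
    finally show ?thesis by (subst (asm) nn_integral_cmult_indicator) auto
  qed
  have [measurable]: "uminus -` A \<in> sets borel"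
    using measurable_sets[of "uminus :: real^3 \<Rightarrow> _" borel borel A] by simp
  have [measurable]: "sgn -` (uminus -` A) \<in> sets (borel :: (real^3) measure)"
    using measurable_sets[of "\<lambda>x::real^3. - sgn x" borel borel A] by (simp add: vimage_def)
  have "emeasure lborel (ball (0::real^3) 1 \<inter> sgn -` (uminus -` A))
      = emeasure (distr lborel borel uminus) (ball (0::real^3) 1 \<inter> sgn -` (uminus -` A))"
    using lborel_affine[of "- 1" "0 :: real^3"] by (simp add: density_1)
  also have "\<dots> = emeasure lborel (ball 0 1 \<inter> sgn -` A)"
    by (subst emeasure_distr) (auto intro!: arg_cong[where f="emeasure lborel"] simp: sgn_minus)
  finally show "emeasure (distr unif_sphere borel uminus) A = emeasure unif_sphere A"
    by (subst emeasure_distr) (simp_all add: unif_sphere_def emeasure_density_const sgn)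
qed simp

theorem unif_sphere_inner:
  "distr unif_sphere borel (\<lambda>\<sigma>. \<sigma> \<bullet> k) = distr unif_interval borel (\<lambda>s. norm k * (1 - 2 * s))"
proof -
  interpret S: prob_space unif_sphere by (rule prob_space_unif_sphere)
  interpret I: prob_space unif_interval by (rule prob_space_unif_interval)
  have unit: "distr unif_sphere borel (\<lambda>\<sigma>. \<sigma> \<bullet> u) = distr unif_interval borel (\<lambda>s. 1 - 2 * s)"
    if u: "norm u = 1" for u
  proof (rule symmetric_uniform_unique)
    show "real_distribution (distr unif_sphere borel (\<lambda>\<sigma>. \<sigma> \<bullet> u))"
      by (intro S.real_distribution_distr) simp
    show "real_distribution (distr unif_interval borel (\<lambda>s. 1 - 2 * s))"
      by (intro I.real_distribution_distr) simp
    show "measure (distr unif_sphere borel (\<lambda>\<sigma>. \<sigma> \<bullet> u)) {x. \<bar>x\<bar> \<le> c} = c" if "0 < c" "c < 1" for c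
      using unif_sphere_abs_inner[OF that u] by (subst measure_distr) auto
    show "measure (distr unif_interval borel (\<lambda>s. 1 - 2 * s)) {x. \<bar>x\<bar> \<le> c} = c" if c: "0 < c" "c < 1" for c
    proof -
      have "{s. \<bar>1 - 2 * s\<bar> \<le> c} = {(1 - c) / 2..(1 + c) / 2}"
        by (auto simp: abs_le_iff field_simps)
      moreover have "{0..1} \<inter> {(1 - c) / 2..(1 + c) / 2} = {(1 - c) / 2..(1 + c) / 2}"
        using c by auto
      ultimately show ?thesis
        using c by (subst measure_distr) (auto simp: unif_interval_def measure_uniform_measure field_simps)
    qed
    have "distr (distr unif_sphere borel (\<lambda>\<sigma>. \<sigma> \<bullet> u)) borel uminus
        = distr (distr unif_sphere borel uminus) borel (\<lambda>\<sigma>. \<sigma> \<bullet> u)"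
      by (simp add: distr_distr comp_def)
    then show "distr (distr unif_sphere borel (\<lambda>\<sigma>. \<sigma> \<bullet> u)) borel uminus = distr unif_sphere borel (\<lambda>\<sigma>. \<sigma> \<bullet> u)"
      by (simp add: unif_sphere_uminus)
    have refl: "distr unif_interval borel (\<lambda>s. 1 - s) = unif_interval"
    proof (rule measure_eqI)
      fix A assume "A \<in> sets (distr unif_interval borel (\<lambda>s. 1 - s))"
      then have [measurable]: "A \<in> sets borel" by simp
      have "emeasure (lborel :: real measure) ({0..1} \<inter> A) = emeasure (distr lborel borel (\<lambda>s. 1 + (- 1) *\<^sub>R s)) ({0..1} \<inter> A)"
        using lborel_real_affine[of "-1" 1] by (simp add: density_1)
      also have "\<dots> = emeasure lborel ({0..1} \<inter> (\<lambda>s. 1 - s) -` A)"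
        by (subst emeasure_distr) (auto intro!: arg_cong[where f="emeasure lborel"])
      finally show "emeasure (distr unif_interval borel (\<lambda>s. 1 - s)) A = emeasure unif_interval A"
        using measurable_sets[of "\<lambda>s. 1 - s" borel borel A]
        by (subst emeasure_distr) (auto simp: unif_interval_def)
    qed simp
    have "distr (distr unif_interval borel (\<lambda>s. 1 - 2 * s)) borel uminus
        = distr (distr unif_interval borel (\<lambda>s. 1 - s)) borel (\<lambda>s. 1 - 2 * s)"
      by (simp add: distr_distr comp_def algebra_simps)
    then show "distr (distr unif_interval borel (\<lambda>s. 1 - 2 * s)) borel uminus
        = distr unif_interval borel (\<lambda>s. 1 - 2 * s)"
      by (simp add: refl)
  qed
  show ?thesis
  proof (cases "k = 0")
    case True
    show ?thesis
      using S.emeasure_space_1 I.emeasure_space_1 True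
      by (intro measure_eqI) (auto simp: emeasure_distr vimage_def split: if_splits)
  next
    case False
    let ?u = "k /\<^sub>R norm k"
    have "distr unif_sphere borel (\<lambda>\<sigma>. \<sigma> \<bullet> k)
        = distr (distr unif_sphere borel (\<lambda>\<sigma>. \<sigma> \<bullet> ?u)) borel (\<lambda>x. norm k * x)"
      using False by (simp add: distr_distr comp_def mult.assoc[symmetric])
    also have "\<dots> = distr (distr unif_interval borel (\<lambda>s. 1 - 2 * s)) borel (\<lambda>x. norm k * x)"
      using False by (subst unit) simp_all
    also have "\<dots> = distr unif_interval borel (\<lambda>s. norm k * (1 - 2 * s))"
      by (simp add: distr_distr comp_def)
    finally show ?thesis .
  qed
qed

section \<open>The collision operator in Fourier variables\<close>

lemma charv_distr:
  assumes "sets f = sets borel" and [measurable]: "T \<in> borel_measurable borel"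
  shows "charv (distr f borel T) k = (\<integral>v. iexp (k \<bullet> T v) \<partial>f)"
proof -
  note [measurable_cong] = assms(1)
  show ?thesis unfolding charv_def by (subst integral_distr) auto
qed

lemma charv_measurable [measurable]:
  assumes "prob_space f" "sets f = sets borel"
  shows "charv f \<in> borel_measurable borel"
proof -
  note [measurable_cong] = assms(2)
  interpret prob_space f by fact
  show ?thesis unfolding charv_def[abs_def] by measurable
qed

lemma charv_le_1:
  assumes "prob_space f" "sets f = sets borel"
  shows "cmod (charv f k) \<le> 1"
proof -
  interpret prob_space f by fact
  have "cmod (charv f k) \<le> (\<integral>v. cmod (iexp (k \<bullet> v)) \<partial>f)"
    unfolding charv_def by (rule integral_norm_bound)
  then show ?thesis by (simp add: prob_space)
qed

lemma charv_rotation: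
  fixes f :: "(real^3) measure"
  assumes "sets f = sets borel"
  shows "charv (distr f borel ((*v) R)) k = charv f (transpose R *v k)"
proof -
  have "(*v) R \<in> borel_measurable borel"
    by (intro borel_measurable_continuous_onI matrix_vector_mult_linear_continuous_on)
  from charv_distr[OF assms this] show ?thesis
    by (simp add: charv_def dot_lmul_matrix)
qed

lemma isotropic_charv:
  fixes f :: "(real^3) measure"
  assumes f: "sets f = sets borel" "isotropic f" and n: "norm k = norm l"
  shows "charv f k = charv f l"
proof -
  obtain g :: "real^3 \<Rightarrow> real^3" where g: "orthogonal_transformation g" "det (matrix g) = 1" "g l = k"
    using rotation_exists[of l k] n by auto
  let ?R = "matrix g"
  have orth: "orthogonal_matrix ?R"
    using g(1) orthogonal_transformation_matrix by blast
  then have R: "rotation_matrix ?R"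
    using g(2) by (simp add: rotation_matrix_def)
  have "?R *v l = k"
    using g by (simp add: orthogonal_transformation_linear)
  then have "transpose ?R *v k = l"
    using orth by (metis matrix_vector_mul_assoc matrix_vector_mul_lid orthogonal_matrix_def)
  moreover have "charv (distr f borel ((*v) ?R)) k = charv f k"
    using f(2) R unfolding isotropic_def by metis
  ultimately show ?thesis
    using charv_rotation[OF f(1), of ?R k] by simp
qed

text \<open>The shares of \<open>\<bar>k\<bar>\<^sup>2\<close> received by the two Fourier variables of a collision in which \<open>\<sigma>\<close>
  makes the angle \<open>\<theta>\<close> with \<open>k\<close>, where \<open>s = (1 - cos \<theta>) / 2\<close> is uniform on \<open>[0,1]\<close>.  The absolute
  values make both shares nonnegative off that interval as well.\<close>

definition share1 :: "real \<Rightarrow> real \<times> real \<Rightarrow> real" where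
  "share1 e = (\<lambda>(\<eta>, s). ((1 + (e + \<eta>)) / 2)\<^sup>2 * \<bar>s\<bar>)"

definition share2 :: "real \<Rightarrow> real \<times> real \<Rightarrow> real" where
  "share2 e = (\<lambda>(\<eta>, s). \<bar>1 - (1 - ((1 - (e + \<eta>)) / 2)\<^sup>2) * s\<bar>)"

lemma share_measurable [measurable]:
  assumes "sets \<mu> = sets borel"
  shows "share1 e \<in> borel_measurable (\<mu> \<Otimes>\<^sub>M unif_interval)" "share2 e \<in> borel_measurable (\<mu> \<Otimes>\<^sub>M unif_interval)"
proof -
  note [measurable_cong] = assms
  show "share1 e \<in> borel_measurable (\<mu> \<Otimes>\<^sub>M unif_interval)" "share2 e \<in> borel_measurable (\<mu> \<Otimes>\<^sub>M unif_interval)"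
    unfolding share1_def share2_def by measurable
qed

definition collide :: "real \<Rightarrow> real measure \<Rightarrow> (real^3) measure \<Rightarrow> (real^3) measure" where
  "collide e \<mu> f = distr (\<mu> \<Otimes>\<^sub>M (f \<Otimes>\<^sub>M (f \<Otimes>\<^sub>M unif_sphere))) borel
     (\<lambda>(\<eta>, w, v, \<sigma>). post_velocity (e + \<eta>) v w \<sigma>)"

lemma prob_space_pair:
  assumes "prob_space M" "prob_space N"
  shows "prob_space (M \<Otimes>\<^sub>M N)"
proof -
  interpret M: prob_space M by fact
  interpret N: prob_space N by fact
  interpret pair_prob_space M N ..
  show ?thesis by (rule prob_space_axioms)
qed

lemma integral_prob_pair:
  fixes h :: "'a \<times> 'b \<Rightarrow> 'c::{banach, second_countable_topology}"
  assumes "prob_space M" "prob_space N"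
    and h: "h \<in> borel_measurable (M \<Otimes>\<^sub>M N)" and B: "\<And>z. norm (h z) \<le> B"
  shows "(\<integral>z. h z \<partial>(M \<Otimes>\<^sub>M N)) = (\<integral>x. (\<integral>y. h (x, y) \<partial>N) \<partial>M)"
proof -
  interpret M: prob_space M by fact
  interpret N: prob_space N by fact
  interpret pair_prob_space M N ..
  have "integrable (M \<Otimes>\<^sub>M N) h"
    using B by (intro P.integrable_const_bound[where B=B] h) auto
  then show ?thesis by (rule integral_fst'[symmetric])
qed

lemma integral_prob_swap:
  fixes h :: "'a \<times> 'b \<Rightarrow> 'c::{banach, second_countable_topology}"
  assumes "prob_space M" "prob_space N"
    and h: "h \<in> borel_measurable (M \<Otimes>\<^sub>M N)" and B: "\<And>z. norm (h z) \<le> B"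
  shows "(\<integral>x. (\<integral>y. h (x, y) \<partial>N) \<partial>M) = (\<integral>y. (\<integral>x. h (x, y) \<partial>M) \<partial>N)"
proof -
  interpret M: prob_space M by fact
  interpret N: prob_space N by fact
  interpret pair_prob_space M N ..
  have "integrable (M \<Otimes>\<^sub>M N) h"
    using B by (intro P.integrable_const_bound[where B=B] h) auto
  then have "integrable (M \<Otimes>\<^sub>M N) (\<lambda>(x, y). h (x, y))"
    by simp
  then show ?thesis by (rule Fubini_integral[symmetric])
qed

lemma integral_prob_pair4:
  fixes h :: "'a \<times> 'b \<times> 'd \<times> 'e \<Rightarrow> 'c::{banach, second_countable_topology}"
  assumes p: "prob_space K" "prob_space L" "prob_space M" "prob_space N"
    and h: "h \<in> borel_measurable (K \<Otimes>\<^sub>M (L \<Otimes>\<^sub>M (M \<Otimes>\<^sub>M N)))" and B: "\<And>z. norm (h z) \<le> B"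
  shows "(\<integral>z. h z \<partial>(K \<Otimes>\<^sub>M (L \<Otimes>\<^sub>M (M \<Otimes>\<^sub>M N))))
    = (\<integral>w. (\<integral>x. (\<integral>y. (\<integral>z. h (w, x, y, z) \<partial>N) \<partial>M) \<partial>L) \<partial>K)"
proof -
  note MN = prob_space_pair[OF p(3,4)] and LMN = prob_space_pair[OF p(2) prob_space_pair[OF p(3,4)]]
  have "(\<integral>z. h z \<partial>(K \<Otimes>\<^sub>M (L \<Otimes>\<^sub>M (M \<Otimes>\<^sub>M N)))) = (\<integral>w. (\<integral>z. h (w, z) \<partial>(L \<Otimes>\<^sub>M (M \<Otimes>\<^sub>M N))) \<partial>K)"
    by (rule integral_prob_pair[OF p(1) LMN h B])
  also have "\<dots> = (\<integral>w. (\<integral>x. (\<integral>y. (\<integral>z. h (w, x, y, z) \<partial>N) \<partial>M) \<partial>L) \<partial>K)"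
  proof (rule Bochner_Integration.integral_cong[OF refl])
    fix w assume [measurable]: "w \<in> space K"
    note [measurable] = h
    have h1: "(\<lambda>z. h (w, z)) \<in> borel_measurable (L \<Otimes>\<^sub>M (M \<Otimes>\<^sub>M N))" by measurable
    have "(\<integral>z. h (w, z) \<partial>(L \<Otimes>\<^sub>M (M \<Otimes>\<^sub>M N))) = (\<integral>x. (\<integral>z. h (w, x, z) \<partial>(M \<Otimes>\<^sub>M N)) \<partial>L)"
      by (rule integral_prob_pair[OF p(2) MN h1 B])
    also have "\<dots> = (\<integral>x. (\<integral>y. (\<integral>z. h (w, x, y, z) \<partial>N) \<partial>M) \<partial>L)"
    proof (rule Bochner_Integration.integral_cong[OF refl])
      fix x assume [measurable]: "x \<in> space L"
      have h2: "(\<lambda>z. h (w, x, z)) \<in> borel_measurable (M \<Otimes>\<^sub>M N)" by measurable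
      show "(\<integral>z. h (w, x, z) \<partial>(M \<Otimes>\<^sub>M N)) = (\<integral>y. (\<integral>z. h (w, x, y, z) \<partial>N) \<partial>M)"
        by (rule integral_prob_pair[OF p(3,4) h2 B])
    qed
    finally show "(\<integral>z. h (w, z) \<partial>(L \<Otimes>\<^sub>M (M \<Otimes>\<^sub>M N))) = (\<integral>x. (\<integral>y. (\<integral>z. h (w, x, y, z) \<partial>N) \<partial>M) \<partial>L)" .
  qed
  finally show ?thesis .
qed

lemma integral_unif_sphere_inner:
  fixes h :: "real \<Rightarrow> 'b::{banach, second_countable_topology}"
  assumes [measurable]: "h \<in> borel_measurable borel"
  shows "(\<integral>\<sigma>. h (\<sigma> \<bullet> k) \<partial>unif_sphere) = (\<integral>s. h (norm k * (1 - 2 * s)) \<partial>unif_interval)"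
proof -
  have "(\<integral>\<sigma>. h (\<sigma> \<bullet> k) \<partial>unif_sphere) = (\<integral>x. h x \<partial>distr unif_sphere borel (\<lambda>\<sigma>. \<sigma> \<bullet> k))"
    by (subst integral_distr) auto
  also have "\<dots> = (\<integral>s. h (norm k * (1 - 2 * s)) \<partial>unif_interval)"
    unfolding unif_sphere_inner by (subst integral_distr) auto
  finally show ?thesis .
qed

text \<open>The two vectors can be interchanged, as only the product of their norms matters.  With
  \<open>y = v - w\<close> it replaces the factor \<open>\<bar>v - w\<bar>\<close> by an expression linear in the velocities.\<close>

lemma integral_unif_sphere_exchange:
  fixes h :: "real \<Rightarrow> 'b::{banach, second_countable_topology}"
  assumes [measurable]: "h \<in> borel_measurable borel"
  shows "(\<integral>\<sigma>. h (norm y * (\<sigma> \<bullet> k)) \<partial>unif_sphere) = (\<integral>\<sigma>. h (norm k * (\<sigma> \<bullet> y)) \<partial>unif_sphere)"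
  using integral_unif_sphere_inner[of "\<lambda>x. h (norm y * x)" k] integral_unif_sphere_inner[of "\<lambda>x. h (norm k * x)" y]
  by (simp add: mult.assoc[symmetric] mult.commute)

locale particle_law =
  fixes e :: real and \<mu> :: "real measure" and f :: "(real^3) measure"
  assumes mu: "prob_space \<mu>" "sets \<mu> = sets borel"
    and f: "prob_space f" "sets f = sets borel"
begin

lemma post_velocity_measurable [measurable]:
  "(\<lambda>(\<eta>, w, v, \<sigma>). post_velocity (e + \<eta>) v w \<sigma>) \<in> borel_measurable (\<mu> \<Otimes>\<^sub>M (f \<Otimes>\<^sub>M (f \<Otimes>\<^sub>M unif_sphere)))"
proof -
  note [measurable_cong] = mu(2) f(2)
  show ?thesis unfolding post_velocity_def by measurable
qed

lemma prob_space_collisions: "prob_space (\<mu> \<Otimes>\<^sub>M (f \<Otimes>\<^sub>M (f \<Otimes>\<^sub>M unif_sphere)))"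
  by (intro prob_space_pair mu f prob_space_unif_sphere)

lemma prob_space_collide: "prob_space (collide e \<mu> f)"
  unfolding collide_def
  by (intro prob_space.prob_space_distr prob_space_collisions) measurable

lemma sets_collide: "sets (collide e \<mu> f) = sets borel"
  by (simp add: collide_def)

lemma integral_collide:
  fixes \<phi> :: "real^3 \<Rightarrow> 'c::{banach, second_countable_topology}"
  assumes [measurable]: "\<phi> \<in> borel_measurable borel" and B: "\<And>v. norm (\<phi> v) \<le> B"
  shows "(\<integral>v. \<phi> v \<partial>collide e \<mu> f)
    = (\<integral>\<eta>. (\<integral>w. (\<integral>v. (\<integral>\<sigma>. \<phi> (post_velocity (e + \<eta>) v w \<sigma>) \<partial>unif_sphere) \<partial>f) \<partial>f) \<partial>\<mu>)"
proof -
  let ?h = "\<lambda>z. \<phi> (case z of (\<eta>, w, v, \<sigma>) \<Rightarrow> post_velocity (e + \<eta>) v w \<sigma>)"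
  have "(\<integral>v. \<phi> v \<partial>collide e \<mu> f) = (\<integral>z. ?h z \<partial>(\<mu> \<Otimes>\<^sub>M (f \<Otimes>\<^sub>M (f \<Otimes>\<^sub>M unif_sphere))))"
    unfolding collide_def by (subst integral_distr) auto
  also have "\<dots> = (\<integral>\<eta>. (\<integral>w. (\<integral>v. (\<integral>\<sigma>. ?h (\<eta>, w, v, \<sigma>) \<partial>unif_sphere) \<partial>f) \<partial>f) \<partial>\<mu>)"
    using B by (intro integral_prob_pair4 mu f prob_space_unif_sphere) auto
  finally show ?thesis by simp
qed

text \<open>Fubini's theorem turns the gain term into an integral against the law after collision, so that
  steady states are the fixed points of \<^const>\<open>collide\<close>.\<close>

lemma weak_collision_eq:
  assumes cont: "continuous_on UNIV \<phi>" and bd: "bounded (range \<phi>)"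
  shows "weak_collision e \<mu> f \<phi> = (\<integral>v. \<phi> v \<partial>collide e \<mu> f) - (\<integral>v. \<phi> v \<partial>f)"
proof -
  note [measurable_cong] = mu(2) f(2)
  interpret mu: prob_space \<mu> by (rule mu)
  interpret f: prob_space f by (rule f)
  interpret S: prob_space unif_sphere by (rule prob_space_unif_sphere)
  have [measurable]: "\<phi> \<in> borel_measurable borel"
    by (rule borel_measurable_continuous_onI[OF cont])
  obtain B where B: "\<And>v. norm (\<phi> v) \<le> B"
    using bd by (auto simp: bounded_iff)
  let ?N = "\<mu> \<Otimes>\<^sub>M (f \<Otimes>\<^sub>M (f \<Otimes>\<^sub>M unif_sphere))"
  interpret N: prob_space ?N by (rule prob_space_collisions)
  let ?h = "\<lambda>z. \<phi> (case z of (\<eta>, w, v, \<sigma>) \<Rightarrow> post_velocity (e + \<eta>) v w \<sigma>)"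
  let ?g = "\<lambda>z. \<phi> (case z of (\<eta>, w, v, \<sigma>) \<Rightarrow> v)"
  have bdd: "norm (?h z - ?g z) \<le> B + B" for z
    by (intro order_trans[OF norm_triangle_ineq4] add_mono B)
  have "weak_collision e \<mu> f \<phi>
      = 1 / (4 * pi) * (\<integral>\<eta>. (\<integral>w. (\<integral>v. 4 * pi * (\<integral>\<sigma>. ?h (\<eta>, w, v, \<sigma>) - ?g (\<eta>, w, v, \<sigma>) \<partial>unif_sphere) \<partial>f) \<partial>f) \<partial>\<mu>)"
    unfolding weak_collision_def
    by (subst integral_sphere_measure) (auto simp: post_velocity_def)
  also have "\<dots> = (\<integral>\<eta>. (\<integral>w. (\<integral>v. (\<integral>\<sigma>. ?h (\<eta>, w, v, \<sigma>) - ?g (\<eta>, w, v, \<sigma>) \<partial>unif_sphere) \<partial>f) \<partial>f) \<partial>\<mu>)"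
    by simp
  also have "\<dots> = (\<integral>z. ?h z - ?g z \<partial>?N)"
    by (rule integral_prob_pair4[symmetric, OF mu(1) f(1) f(1) prob_space_unif_sphere _ bdd]) measurable
  also have "\<dots> = (\<integral>z. ?h z \<partial>?N) - (\<integral>z. ?g z \<partial>?N)"
    using B by (intro Bochner_Integration.integral_diff N.integrable_const_bound[where B=B]) auto
  also have "(\<integral>z. ?h z \<partial>?N) = (\<integral>v. \<phi> v \<partial>collide e \<mu> f)"
    unfolding collide_def by (subst integral_distr) auto
  also have "(\<integral>z. ?g z \<partial>?N) = (\<integral>\<eta>. (\<integral>w. (\<integral>v. (\<integral>\<sigma>. ?g (\<eta>, w, v, \<sigma>) \<partial>unif_sphere) \<partial>f) \<partial>f) \<partial>\<mu>)"
    using B by (intro integral_prob_pair4 mu f prob_space_unif_sphere) auto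
  also have "\<dots> = (\<integral>v. \<phi> v \<partial>f)"
    by (simp add: mu.prob_space f.prob_space S.prob_space[simplified])
  finally show ?thesis .
qed

lemma steady_state_iff: "steady_state e \<mu> f \<longleftrightarrow> collide e \<mu> f = f"
proof
  interpret T: prob_space "collide e \<mu> f" by (rule prob_space_collide)
  interpret f: prob_space f by (rule f)
  assume st: "steady_state e \<mu> f"
  show "collide e \<mu> f = f"
  proof (rule finite_measure_eqI_bounded_continuous)
    fix \<phi> :: "real^3 \<Rightarrow> real"
    assume \<phi>: "continuous_on UNIV \<phi>" "\<And>x. \<bar>\<phi> x\<bar> \<le> 1"
    then have "bounded (range \<phi>)" by (auto simp: bounded_iff)
    then show "(\<integral>v. \<phi> v \<partial>collide e \<mu> f) = (\<integral>v. \<phi> v \<partial>f)"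
      using st \<phi>(1) weak_collision_eq unfolding steady_state_def by auto
  qed (use f sets_collide T.finite_measure_axioms f.finite_measure_axioms in auto)
next
  assume eq: "collide e \<mu> f = f"
  show "steady_state e \<mu> f"
    unfolding steady_state_def using f weak_collision_eq eq by auto
qed

text \<open>
  After the exchange of \<open>k\<close> and \<open>v - w\<close> under the mean over \<open>\<sigma>\<close>, the exponent
  is a sum of a term in \<open>v\<close> and a term in \<open>w\<close>, and the means over the velocities factor.
\<close>

lemma charv_collide:
  assumes radial: "\<And>k. charv f k = \<Psi> ((norm k)\<^sup>2 / 2)" and [measurable]: "\<Psi> \<in> borel_measurable borel"
  shows "charv (collide e \<mu> f) k = (\<integral>p. \<Psi> (share1 e p * ((norm k)\<^sup>2 / 2)) * \<Psi> (share2 e p * ((norm k)\<^sup>2 / 2))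
    \<partial>(\<mu> \<Otimes>\<^sub>M unif_interval))"
proof -
  note [measurable_cong] = mu(2) f(2)
  interpret mu: prob_space \<mu> by (rule mu)
  interpret f: prob_space f by (rule f)
  interpret S: prob_space unif_sphere by (rule prob_space_unif_sphere)
  note [measurable] = charv_measurable[OF f] share_measurable[OF mu(2)]
  define t where "t = (norm k)\<^sup>2 / 2"
  have t: "0 \<le> t" by (simp add: t_def)
  have \<Psi>1: "cmod (\<Psi> u) \<le> 1" if "0 \<le> u" for u
  proof -
    have "\<Psi> u = charv f (sqrt (2 * u) *\<^sub>R axis 1 1)"
      using that by (simp add: radial power_mult_distrib)
    then show ?thesis using charv_le_1[OF f] by simp
  qed
  have inner: "(\<integral>w. (\<integral>v. (\<integral>\<sigma>. iexp (k \<bullet> post_velocity (e + \<eta>) v w \<sigma>) \<partial>unif_sphere) \<partial>f) \<partial>f)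
      = (\<integral>s. \<Psi> (share1 e (\<eta>, s) * t) * \<Psi> (share2 e (\<eta>, s) * t) \<partial>unif_interval)" for \<eta>
  proof -
    define c where "c = (1 + (e + \<eta>)) / 4"
    have c': "(1 - (e + \<eta>)) / 4 = 1 / 2 - c" by (simp add: c_def field_simps)
    \<comment> \<open>the Fourier variables that reach \<open>v\<close> and \<open>w\<close>\<close>
    define k1 where "k1 \<sigma> = (1 - c) *\<^sub>R k + (c * norm k) *\<^sub>R \<sigma>" for \<sigma>
    define k2 where "k2 \<sigma> = c *\<^sub>R k - (c * norm k) *\<^sub>R \<sigma>" for \<sigma>
    have [measurable]: "k1 \<in> borel_measurable borel" "k2 \<in> borel_measurable borel"
      unfolding k1_def k2_def by measurable
    have "(\<integral>\<sigma>. iexp (k \<bullet> post_velocity (e + \<eta>) v w \<sigma>) \<partial>unif_sphere)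
        = (\<integral>\<sigma>. iexp (k1 \<sigma> \<bullet> v) * iexp (k2 \<sigma> \<bullet> w) \<partial>unif_sphere)" for v w
    proof -
      define \<alpha> where "\<alpha> = k \<bullet> ((1/2) *\<^sub>R (v + w) + (1/2 - c) *\<^sub>R (v - w))"
      have "k \<bullet> post_velocity (e + \<eta>) v w \<sigma> = \<alpha> + c * (norm (v - w) * (\<sigma> \<bullet> k))" for \<sigma>
        unfolding post_velocity_def c'
        by (simp add: \<alpha>_def c_def inner_add_right inner_commute)
      then have "(\<integral>\<sigma>. iexp (k \<bullet> post_velocity (e + \<eta>) v w \<sigma>) \<partial>unif_sphere)
          = (\<integral>\<sigma>. iexp (\<alpha> + c * (norm (v - w) * (\<sigma> \<bullet> k))) \<partial>unif_sphere)"
        by simp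
      also have "\<dots> = (\<integral>\<sigma>. iexp (\<alpha> + c * (norm k * (\<sigma> \<bullet> (v - w)))) \<partial>unif_sphere)"
        by (rule integral_unif_sphere_exchange[where h="\<lambda>x. iexp (\<alpha> + c * x)"]) measurable
      also have "\<dots> = (\<integral>\<sigma>. iexp (k1 \<sigma> \<bullet> v) * iexp (k2 \<sigma> \<bullet> w) \<partial>unif_sphere)"
      proof (rule Bochner_Integration.integral_cong[OF refl])
        fix \<sigma>
        have "\<alpha> + c * (norm k * (\<sigma> \<bullet> (v - w))) = k1 \<sigma> \<bullet> v + k2 \<sigma> \<bullet> w"
        proof -
          have "\<alpha> = 1/2 * (k \<bullet> v + k \<bullet> w) + (1/2 - c) * (k \<bullet> v - k \<bullet> w)"
            by (simp add: \<alpha>_def inner_add_right inner_diff_right)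
          moreover have "k1 \<sigma> \<bullet> v = (1 - c) * (k \<bullet> v) + c * norm k * (\<sigma> \<bullet> v)"
            by (simp add: k1_def inner_add_left)
          moreover have "k2 \<sigma> \<bullet> w = c * (k \<bullet> w) - c * norm k * (\<sigma> \<bullet> w)"
            by (simp add: k2_def inner_diff_left)
          moreover have "\<sigma> \<bullet> (v - w) = \<sigma> \<bullet> v - \<sigma> \<bullet> w"
            by (rule inner_diff_right)
          ultimately show ?thesis
            by (simp only:) (simp add: algebra_simps)
        qed
        then show "iexp (\<alpha> + c * (norm k * (\<sigma> \<bullet> (v - w)))) = iexp (k1 \<sigma> \<bullet> v) * iexp (k2 \<sigma> \<bullet> w)"
          by (simp only: of_real_add distrib_left exp_add)
      qed
      finally show ?thesis .
    qed
    then have "(\<integral>w. (\<integral>v. (\<integral>\<sigma>. iexp (k \<bullet> post_velocity (e + \<eta>) v w \<sigma>) \<partial>unif_sphere) \<partial>f) \<partial>f)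
        = (\<integral>w. (\<integral>v. (\<integral>\<sigma>. iexp (k1 \<sigma> \<bullet> v) * iexp (k2 \<sigma> \<bullet> w) \<partial>unif_sphere) \<partial>f) \<partial>f)"
      by simp
    also have "\<dots> = (\<integral>w. (\<integral>\<sigma>. (\<integral>v. iexp (k1 \<sigma> \<bullet> v) * iexp (k2 \<sigma> \<bullet> w) \<partial>f) \<partial>unif_sphere) \<partial>f)"
      using integral_prob_swap[OF f(1) prob_space_unif_sphere,
          of "\<lambda>(v, \<sigma>). iexp (k1 \<sigma> \<bullet> v) * iexp (k2 \<sigma> \<bullet> w)" 1 for w]
      by (simp add: norm_mult split_beta')
    also have "\<dots> = (\<integral>w. (\<integral>\<sigma>. charv f (k1 \<sigma>) * iexp (k2 \<sigma> \<bullet> w) \<partial>unif_sphere) \<partial>f)"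
      by (simp add: charv_def)
    also have "\<dots> = (\<integral>\<sigma>. (\<integral>w. charv f (k1 \<sigma>) * iexp (k2 \<sigma> \<bullet> w) \<partial>f) \<partial>unif_sphere)"
      using integral_prob_swap[OF f(1) prob_space_unif_sphere,
          of "\<lambda>(w, \<sigma>). charv f (k1 \<sigma>) * iexp (k2 \<sigma> \<bullet> w)" 1] charv_le_1[OF f]
      by (simp add: norm_mult split_beta')
    also have "\<dots> = (\<integral>\<sigma>. charv f (k1 \<sigma>) * charv f (k2 \<sigma>) \<partial>unif_sphere)"
      by (simp add: charv_def)
    also have "\<dots> = (\<integral>\<sigma>. \<Psi> (((1 - c)\<^sup>2 * (norm k)\<^sup>2 + c\<^sup>2 * (norm k)\<^sup>2 + 2 * (1 - c) * c * norm k * (\<sigma> \<bullet> k)) / 2)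
        * \<Psi> ((2 * c\<^sup>2 * (norm k)\<^sup>2 - 2 * c\<^sup>2 * norm k * (\<sigma> \<bullet> k)) / 2) \<partial>unif_sphere)"
    proof (rule integral_cong_AE)
      show "AE \<sigma> in unif_sphere. charv f (k1 \<sigma>) * charv f (k2 \<sigma>)
        = \<Psi> (((1 - c)\<^sup>2 * (norm k)\<^sup>2 + c\<^sup>2 * (norm k)\<^sup>2 + 2 * (1 - c) * c * norm k * (\<sigma> \<bullet> k)) / 2)
        * \<Psi> ((2 * c\<^sup>2 * (norm k)\<^sup>2 - 2 * c\<^sup>2 * norm k * (\<sigma> \<bullet> k)) / 2)"
        using AE_unif_sphere
      proof eventually_elim
        case (elim \<sigma>)
        have \<sigma>: "\<sigma> \<bullet> \<sigma> = 1" using elim by (simp add: norm_eq_1)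
        have "(norm (k1 \<sigma>))\<^sup>2 = (1 - c)\<^sup>2 * (norm k)\<^sup>2 + c\<^sup>2 * (norm k)\<^sup>2 + 2 * (1 - c) * c * norm k * (\<sigma> \<bullet> k)"
          unfolding power2_norm_eq_inner k1_def
          by (simp add: inner_add_left inner_add_right inner_commute[of k \<sigma>] \<sigma> power_mult_distrib power2_eq_square[symmetric])
             (simp add: power2_norm_eq_inner[symmetric] power2_eq_square algebra_simps)
        moreover have "(norm (k2 \<sigma>))\<^sup>2 = 2 * c\<^sup>2 * (norm k)\<^sup>2 - 2 * c\<^sup>2 * norm k * (\<sigma> \<bullet> k)"
          unfolding power2_norm_eq_inner k2_def
          by (simp add: inner_diff_left inner_diff_right inner_commute[of k \<sigma>] \<sigma> power_mult_distrib power2_eq_square[symmetric])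
             (simp add: power2_norm_eq_inner[symmetric] power2_eq_square algebra_simps)
        ultimately show ?case by (simp only: radial)
      qed
    qed measurable
    also have "\<dots> = (\<integral>s. \<Psi> (((1 - c)\<^sup>2 * (norm k)\<^sup>2 + c\<^sup>2 * (norm k)\<^sup>2 + 2 * (1 - c) * c * norm k * (norm k * (1 - 2 * s))) / 2)
        * \<Psi> ((2 * c\<^sup>2 * (norm k)\<^sup>2 - 2 * c\<^sup>2 * norm k * (norm k * (1 - 2 * s))) / 2) \<partial>unif_interval)"
      by (rule integral_unif_sphere_inner) measurable
    also have "\<dots> = (\<integral>s. \<Psi> (share1 e (\<eta>, s) * t) * \<Psi> (share2 e (\<eta>, s) * t) \<partial>unif_interval)"
    proof (rule integral_cong_AE)
      show "AE s in unif_interval.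
          \<Psi> (((1 - c)\<^sup>2 * (norm k)\<^sup>2 + c\<^sup>2 * (norm k)\<^sup>2 + 2 * (1 - c) * c * norm k * (norm k * (1 - 2 * s))) / 2)
          * \<Psi> ((2 * c\<^sup>2 * (norm k)\<^sup>2 - 2 * c\<^sup>2 * norm k * (norm k * (1 - 2 * s))) / 2)
          = \<Psi> (share1 e (\<eta>, s) * t) * \<Psi> (share2 e (\<eta>, s) * t)"
        using AE_unif_interval
      proof eventually_elim
        case (elim s)
        have s1: "share1 e (\<eta>, s) = 4 * c\<^sup>2 * s"
          using elim by (simp add: share1_def c_def power2_eq_square)
        have "0 \<le> (1 - s) + ((1 - (e + \<eta>)) / 2)\<^sup>2 * s" using elim by simp
        also have "\<dots> = 1 - (1 - ((1 - (e + \<eta>)) / 2)\<^sup>2) * s" by (simp add: algebra_simps)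
        finally have "share2 e (\<eta>, s) = 1 - (1 - ((1 - (e + \<eta>)) / 2)\<^sup>2) * s"
          by (simp add: share2_def)
        also have "(1 - (e + \<eta>)) / 2 = 1 - 2 * c" by (simp add: c_def field_simps)
        finally have s2: "share2 e (\<eta>, s) = 1 - (1 - (1 - 2 * c)\<^sup>2) * s" .
        have "((1 - c)\<^sup>2 * (norm k)\<^sup>2 + c\<^sup>2 * (norm k)\<^sup>2 + 2 * (1 - c) * c * norm k * (norm k * (1 - 2 * s))) / 2
            = share2 e (\<eta>, s) * t"
          unfolding s2 t_def by (simp add: power2_eq_square algebra_simps add_divide_distrib diff_divide_distrib)
        moreover have "(2 * c\<^sup>2 * (norm k)\<^sup>2 - 2 * c\<^sup>2 * norm k * (norm k * (1 - 2 * s))) / 2 = share1 e (\<eta>, s) * t"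
          unfolding s1 t_def by (simp add: power2_eq_square algebra_simps)
        ultimately show ?case by (simp only: mult.commute)
      qed
    qed (auto simp: share1_def share2_def)
    finally show ?thesis .
  qed
  have "charv (collide e \<mu> f) k
      = (\<integral>\<eta>. (\<integral>w. (\<integral>v. (\<integral>\<sigma>. iexp (k \<bullet> post_velocity (e + \<eta>) v w \<sigma>) \<partial>unif_sphere) \<partial>f) \<partial>f) \<partial>\<mu>)"
    unfolding charv_def by (rule integral_collide[where B=1]) auto
  also have "\<dots> = (\<integral>\<eta>. (\<integral>s. \<Psi> (share1 e (\<eta>, s) * t) * \<Psi> (share2 e (\<eta>, s) * t) \<partial>unif_interval) \<partial>\<mu>)"
    by (simp only: inner)
  also have "\<dots> = (\<integral>p. \<Psi> (share1 e p * t) * \<Psi> (share2 e p * t) \<partial>(\<mu> \<Otimes>\<^sub>M unif_interval))"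
  proof (rule integral_prob_pair[symmetric, OF mu(1) prob_space_unif_interval])
    have "0 \<le> share1 e p * t" "0 \<le> share2 e p * t" for p
      using t by (auto simp: share1_def share2_def split: prod.split)
    then show "cmod (\<Psi> (share1 e p * t) * \<Psi> (share2 e p * t)) \<le> 1" for p
      using \<Psi>1 by (simp add: norm_mult mult_le_one)
  qed measurable
  finally show ?thesis by (simp only: t_def)
qed

end

section \<open>The quantity A as a moment of the shares\<close>

lemma nn_integral_affine_powr:
  fixes A B q :: real
  assumes A: "0 \<le> A" and B: "0 \<le> B" and ne: "A \<noteq> B" and q: "0 < q"
  shows "(\<integral>\<^sup>+s. ennreal ((A + (B - A) * s) powr q) \<partial>unif_interval)
    = ennreal ((B powr (q + 1) - A powr (q + 1)) / ((q + 1) * (B - A)))"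
proof -
  let ?g = "\<lambda>s. A + (B - A) * s"
  let ?F = "\<lambda>s. ?g s powr (q + 1) / ((q + 1) * (B - A))"
  have nn: "0 \<le> ?g s" if "s \<in> {0..1}" for s
  proof -
    have "?g s = (1 - s) * A + s * B" by (simp add: algebra_simps)
    then show ?thesis using that A B by simp
  qed
  have pos: "0 < ?g s" if "s \<in> {0<..<1}" for s
  proof -
    have "?g s = (1 - s) * A + s * B" by (simp add: algebra_simps)
    then show ?thesis using that A B ne by (cases "A = 0") (auto intro: add_pos_nonneg)
  qed
  have "((\<lambda>s. ?g s powr q) has_integral (?F 1 - ?F 0)) {0..1}"
  proof (rule fundamental_theorem_of_calculus_interior)
    show "continuous_on {0..1} ?F"
      using nn q ne by (intro continuous_intros continuous_on_powr') auto
    fix s :: real assume s: "s \<in> {0<..<1}"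
    have "(?F has_real_derivative ?g s powr q) (at s)"
    proof -
      have "((\<lambda>s. ?g s powr (q + 1)) has_real_derivative ((q + 1) * ?g s powr (q + 1 - 1)) * (B - A)) (at s)"
        by (rule DERIV_chain2[where f="\<lambda>z. z powr (q + 1)" and g="?g", OF has_real_derivative_powr[OF pos[OF s]]])
          (auto intro!: derivative_eq_intros)
      from DERIV_cdivide[OF this, of "(q + 1) * (B - A)"] show ?thesis
        using q ne by simp
    qed
    then show "(?F has_vector_derivative ?g s powr q) (at s)"
      by (simp add: has_real_derivative_iff_has_vector_derivative)
  qed simp
  then have "((\<lambda>s. if s \<in> {0..1} then ?g s powr q else 0) has_integral (?F 1 - ?F 0)) UNIV"
    by (simp only: has_integral_restrict_UNIV)
  then have "(\<integral>\<^sup>+s. ennreal (if s \<in> {0..1} then ?g s powr q else 0) \<partial>lborel) = ennreal (?F 1 - ?F 0)"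
    by (intro nn_integral_has_integral_lborel) auto
  also have "?F 1 - ?F 0 = (B powr (q + 1) - A powr (q + 1)) / ((q + 1) * (B - A))"
    by (simp add: diff_divide_distrib)
  finally have I: "(\<integral>\<^sup>+s. ennreal (if s \<in> {0..1} then ?g s powr q else 0) \<partial>lborel)
      = ennreal ((B powr (q + 1) - A powr (q + 1)) / ((q + 1) * (B - A)))" .
  have "(\<integral>\<^sup>+s. ennreal (?g s powr q) \<partial>unif_interval) = (\<integral>\<^sup>+s. ennreal (?g s powr q) * indicator {0..1} s \<partial>lborel)"
    unfolding unif_interval_def by (subst nn_integral_uniform_measure) (auto simp: divide_ennreal_def)
  also have "\<dots> = (\<integral>\<^sup>+s. ennreal (if s \<in> {0..1} then ?g s powr q else 0) \<partial>lborel)"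
    by (intro nn_integral_cong) (auto simp: indicator_def)
  finally show ?thesis using I by simp
qed

lemma power2_powr:
  fixes x r :: real
  shows "x\<^sup>2 powr r = \<bar>x\<bar> powr (2 * r)"
proof (cases "x = 0")
  case False
  then have "x\<^sup>2 powr r = (\<bar>x\<bar> powr 2) powr r" by (simp add: powr_numeral)
  also have "\<dots> = \<bar>x\<bar> powr (2 * r)" by (rule powr_powr)
  finally show ?thesis .
qed simp

text \<open>Up to the absolute values, the shares are affine in \<open>s\<close> and run over \<open>[0, ((1 + et) / 2)\<^sup>2]\<close> and from
  \<open>1\<close> to \<open>((1 - et) / 2)\<^sup>2\<close>.  The second share is constant precisely in the exceptional case of the
  quotient.\<close>

lemma share_moment_section:
  assumes \<alpha>: "0 \<le> \<alpha>" and pos: "0 \<le> e + \<eta>"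
  shows "(\<integral>\<^sup>+s. ennreal (share1 e (\<eta>, s) powr (1 + \<alpha> / 2) + share2 e (\<eta>, s) powr (1 + \<alpha> / 2)) \<partial>unif_interval)
    = ennreal (2 / (4 + \<alpha>)) * ennreal (((1 + (e + \<eta>)) / 2) powr (2 + \<alpha>) + frakA_quotient \<alpha> (e + \<eta>))"
proof -
  interpret I: prob_space unif_interval by (rule prob_space_unif_interval)
  define q where "q = 1 + \<alpha> / 2"
  define c where "c = ((1 + (e + \<eta>)) / 2)\<^sup>2"
  define d where "d = ((1 - (e + \<eta>)) / 2)\<^sup>2"
  have q: "0 < q" "q + 1 = (4 + \<alpha>) / 2" using \<alpha> by (simp_all add: q_def)
  have c: "0 < c" using pos by (simp add: c_def)
  have d: "0 \<le> d" by (simp add: d_def)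
  have cq: "c powr q = ((1 + (e + \<eta>)) / 2) powr (2 + \<alpha>)"
    using pos by (simp add: c_def power2_powr q_def distrib_left)
  have dq: "d powr (q + 1) = \<bar>(1 - (e + \<eta>)) / 2\<bar> powr (4 + \<alpha>)"
  proof -
    have "2 * (q + 1) = 4 + \<alpha>" by (simp add: q_def)
    then show ?thesis by (simp only: d_def power2_powr)
  qed
  have first: "(\<integral>\<^sup>+s. ennreal ((0 + (c - 0) * s) powr q) \<partial>unif_interval) = ennreal (2 / (4 + \<alpha>) * c powr q)"
  proof -
    have "c powr (q + 1) / ((q + 1) * c) = c powr q / (q + 1)"
      using c by (simp add: powr_add)
    also have "\<dots> = 2 / (4 + \<alpha>) * c powr q" by (simp add: q(2))
    finally show ?thesis
      using c q(1) by (subst nn_integral_affine_powr) auto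
  qed
  have second: "(\<integral>\<^sup>+s. ennreal ((1 + (d - 1) * s) powr q) \<partial>unif_interval)
      = ennreal (2 / (4 + \<alpha>) * frakA_quotient \<alpha> (e + \<eta>))"
  proof (cases "\<bar>1 - (e + \<eta>)\<bar> = 2")
    case True
    then have "d = 1"
      unfolding d_def by (metis power2_abs abs_divide abs_numeral divide_self_if power_one zero_neq_numeral)
    then show ?thesis
      using True \<alpha> I.emeasure_space_1 by (simp add: frakA_quotient_def)
  next
    case False
    then have "\<bar>(1 - (e + \<eta>)) / 2\<bar> \<noteq> 1" by auto
    then have d1: "d \<noteq> 1" by (metis d_def power2_eq_1_iff abs_1 abs_minus_cancel)
    have "(d powr (q + 1) - 1) / ((q + 1) * (d - 1)) = 2 / (4 + \<alpha>) * ((1 - d powr (q + 1)) / (1 - d))"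
    proof -
      have "(d powr (q + 1) - 1) / (d - 1) = (1 - d powr (q + 1)) / (1 - d)"
        by (metis minus_diff_eq minus_divide_divide)
      moreover have "(d powr (q + 1) - 1) / ((q + 1) * (d - 1)) = 1 / (q + 1) * ((d powr (q + 1) - 1) / (d - 1))"
        by simp
      moreover have "1 / (q + 1) = 2 / (4 + \<alpha>)" by (simp add: q(2))
      ultimately show ?thesis by (simp only:)
    qed
    also have "\<dots> = 2 / (4 + \<alpha>) * frakA_quotient \<alpha> (e + \<eta>)"
      unfolding dq by (simp only: frakA_quotient_def d_def False if_False power2_abs)
    finally show ?thesis
      using d d1 q(1) by (subst nn_integral_affine_powr) auto
  qed
  have quot: "0 \<le> frakA_quotient \<alpha> (e + \<eta>)"
  proof (cases "\<bar>(1 - (e + \<eta>)) / 2\<bar> \<le> 1")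
    case True
    then have "\<bar>(1 - (e + \<eta>)) / 2\<bar> powr (4 + \<alpha>) \<le> 1" "\<bar>(1 - (e + \<eta>)) / 2\<bar>\<^sup>2 \<le> 1"
      using \<alpha> by (auto intro!: powr_le1 power_le_one)
    then show ?thesis using \<alpha> by (simp add: frakA_quotient_def)
  next
    case False
    then have "1 \<le> \<bar>(1 - (e + \<eta>)) / 2\<bar> powr (4 + \<alpha>)" "1 \<le> \<bar>(1 - (e + \<eta>)) / 2\<bar>\<^sup>2"
      using \<alpha> by (auto intro!: ge_one_powr_ge_zero one_le_power)
    then show ?thesis using \<alpha> by (simp add: frakA_quotient_def divide_nonpos_nonpos)
  qed
  have "(\<integral>\<^sup>+s. ennreal (share1 e (\<eta>, s) powr q + share2 e (\<eta>, s) powr q) \<partial>unif_interval)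
      = (\<integral>\<^sup>+s. ennreal ((0 + (c - 0) * s) powr q) + ennreal ((1 + (d - 1) * s) powr q) \<partial>unif_interval)"
  proof (rule nn_integral_cong_AE)
    show "AE s in unif_interval. ennreal (share1 e (\<eta>, s) powr q + share2 e (\<eta>, s) powr q)
        = ennreal ((0 + (c - 0) * s) powr q) + ennreal ((1 + (d - 1) * s) powr q)"
      using AE_unif_interval
    proof eventually_elim
      case (elim s)
      have "share1 e (\<eta>, s) = 0 + (c - 0) * s"
        using elim by (simp add: share1_def c_def)
      moreover have "share2 e (\<eta>, s) = 1 + (d - 1) * s"
      proof -
        have "0 \<le> (1 - s) + d * s" using elim d by simp
        also have "\<dots> = 1 - (1 - d) * s" by (simp add: algebra_simps)
        finally have "\<bar>1 - (1 - d) * s\<bar> = 1 - (1 - d) * s" by simp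
        then show ?thesis
          by (simp only: share2_def d_def prod.case) (simp add: algebra_simps)
      qed
      ultimately show ?case by simp
    qed
  qed
  also have "\<dots> = ennreal (2 / (4 + \<alpha>) * c powr q) + ennreal (2 / (4 + \<alpha>) * frakA_quotient \<alpha> (e + \<eta>))"
    by (subst nn_integral_add) (simp_all only: first second, simp_all)
  also have "\<dots> = ennreal (2 / (4 + \<alpha>) * (c powr q + frakA_quotient \<alpha> (e + \<eta>)))"
    using \<alpha> quot by (subst ennreal_plus[symmetric]) (simp_all add: distrib_left)
  also have "\<dots> = ennreal (2 / (4 + \<alpha>)) * ennreal (c powr q + frakA_quotient \<alpha> (e + \<eta>))"
    using \<alpha> quot by (intro ennreal_mult) auto
  finally show ?thesis by (simp only: cq q_def[symmetric])
qed

lemma frakA_quotient_measurable [measurable]: "frakA_quotient \<alpha> \<in> borel_measurable borel"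
  unfolding frakA_quotient_def[abs_def] by measurable

lemma frakA_eq:
  assumes mu: "prob_space \<mu>" "sets \<mu> = sets borel" and supp: "AE \<eta> in \<mu>. - e \<le> \<eta>" and \<alpha>: "0 \<le> \<alpha>"
  shows "frakA \<alpha> e \<mu> = (\<integral>\<^sup>+p. ennreal (share1 e p powr (1 + \<alpha> / 2) + share2 e p powr (1 + \<alpha> / 2))
    \<partial>(\<mu> \<Otimes>\<^sub>M unif_interval))"
proof -
  note [measurable_cong] = mu(2)
  note [measurable] = share_measurable[OF mu(2)]
  interpret I: prob_space unif_interval by (rule prob_space_unif_interval)
  have "frakA \<alpha> e \<mu> = (\<integral>\<^sup>+\<eta>. ennreal (2 / (4 + \<alpha>))
      * ennreal (((1 + (e + \<eta>)) / 2) powr (2 + \<alpha>) + frakA_quotient \<alpha> (e + \<eta>)) \<partial>\<mu>)"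
    unfolding frakA_def by (subst nn_integral_cmult) auto
  also have "\<dots> = (\<integral>\<^sup>+\<eta>. (\<integral>\<^sup>+s. ennreal (share1 e (\<eta>, s) powr (1 + \<alpha> / 2) + share2 e (\<eta>, s) powr (1 + \<alpha> / 2))
      \<partial>unif_interval) \<partial>\<mu>)"
    using supp by (intro nn_integral_cong_AE, elim eventually_mono)
      (rule share_moment_section[OF \<alpha>, symmetric], simp)
  also have "\<dots> = (\<integral>\<^sup>+p. ennreal (share1 e p powr (1 + \<alpha> / 2) + share2 e p powr (1 + \<alpha> / 2)) \<partial>(\<mu> \<Otimes>\<^sub>M unif_interval))"
    by (rule I.nn_integral_fst) measurable
  finally show ?thesis .
qed

text \<open>Conservation in the mean is the case \<open>\<alpha> = 0\<close>: the shares then add up to \<open>1\<close> on average.\<close>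

lemma frakA_0:
  assumes mu: "prob_space \<mu>" "sets \<mu> = sets borel"
    and mean: "integrable \<mu> (\<lambda>\<eta>. \<eta>)" "(\<integral>\<eta>. \<eta> \<partial>\<mu>) = 0"
    and variance: "integrable \<mu> (\<lambda>\<eta>. \<eta>\<^sup>2)" "(\<integral>\<eta>. \<eta>\<^sup>2 \<partial>\<mu>) = 1 - e\<^sup>2"
    and supp: "AE \<eta> in \<mu>. - e \<le> \<eta>"
  shows "frakA 0 e \<mu> = 1"
proof -
  note [measurable_cong] = mu(2)
  interpret prob_space \<mu> by (rule mu)
  have quot: "frakA_quotient 0 et = 1 + ((1 - et) / 2)\<^sup>2" for et
  proof -
    define y where "y = \<bar>(1 - et) / 2\<bar>"
    have y0: "0 \<le> y" by (simp add: y_def)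
    have sq: "((1 - et) / 2)\<^sup>2 = y\<^sup>2" by (simp only: y_def power2_abs)
    have y1: "\<bar>1 - et\<bar> = 2 \<longleftrightarrow> y = 1" by (auto simp: y_def)
    have "y powr 4 = y ^ 4"
      using y0 by (cases "y = 0") (simp_all add: powr_numeral)
    moreover have "(1 - y ^ 4) / (1 - y\<^sup>2) = 1 + y\<^sup>2" if "y \<noteq> 1"
    proof -
      have "1 - y\<^sup>2 \<noteq> 0" using that y0 by (auto simp: power2_eq_1_iff)
      moreover have "1 - y ^ 4 = (1 + y\<^sup>2) * (1 - y\<^sup>2)"
        by (simp add: algebra_simps power2_eq_square power4_eq_xxxx)
      ultimately show ?thesis by simp
    qed
    ultimately show ?thesis
      unfolding frakA_quotient_def y1 sq y_def[symmetric] by simp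
  qed
  have "frakA 0 e \<mu> = ennreal (1 / 2) * (\<integral>\<^sup>+\<eta>. ennreal (3 / 2 + (e\<^sup>2 + 2 * e * \<eta> + \<eta>\<^sup>2) / 2) \<partial>\<mu>)"
  proof -
    have "AE \<eta> in \<mu>. ennreal (((1 + (e + \<eta>)) / 2) powr (2 + 0) + frakA_quotient 0 (e + \<eta>))
        = ennreal (3 / 2 + (e\<^sup>2 + 2 * e * \<eta> + \<eta>\<^sup>2) / 2)"
      using supp
    proof eventually_elim
      case (elim \<eta>)
      then have "((1 + (e + \<eta>)) / 2) powr (2 + 0) = ((1 + (e + \<eta>)) / 2)\<^sup>2"
        by (simp add: powr_numeral)
      moreover have "((1 + (e + \<eta>)) / 2)\<^sup>2 + (1 + ((1 - (e + \<eta>)) / 2)\<^sup>2) = 3 / 2 + (e\<^sup>2 + 2 * e * \<eta> + \<eta>\<^sup>2) / 2"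
        by (simp add: power2_eq_square field_simps)
      ultimately show ?case by (simp only: quot)
    qed
    then show ?thesis
      unfolding frakA_def by (simp add: nn_integral_cong_AE)
  qed
  also have "(\<integral>\<^sup>+\<eta>. ennreal (3 / 2 + (e\<^sup>2 + 2 * e * \<eta> + \<eta>\<^sup>2) / 2) \<partial>\<mu>)
      = ennreal (\<integral>\<eta>. 3 / 2 + (e\<^sup>2 + 2 * e * \<eta> + \<eta>\<^sup>2) / 2 \<partial>\<mu>)"
  proof (rule nn_integral_eq_integral)
    show "integrable \<mu> (\<lambda>\<eta>. 3 / 2 + (e\<^sup>2 + 2 * e * \<eta> + \<eta>\<^sup>2) / 2)"
      using mean variance by simp
    have "0 \<le> 3 / 2 + (e + \<eta>)\<^sup>2 / 2" for \<eta> by simp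
    then show "AE \<eta> in \<mu>. 0 \<le> 3 / 2 + (e\<^sup>2 + 2 * e * \<eta> + \<eta>\<^sup>2) / 2"
      by (simp add: power2_eq_square algebra_simps)
  qed
  also have "(\<integral>\<eta>. 3 / 2 + (e\<^sup>2 + 2 * e * \<eta> + \<eta>\<^sup>2) / 2 \<partial>\<mu>) = 2"
    using mean variance by (simp add: prob_space field_simps)
  also have "ennreal (1 / 2) * ennreal 2 = ennreal (1 / 2 * 2)"
    by (rule ennreal_mult[symmetric]) simp_all
  finally show ?thesis by simp
qed

section \<open>Scale mixtures of Gaussians\<close>

definition std_gauss :: "(real^'n) measure" where
  "std_gauss = distr (PiM UNIV (\<lambda>_. std_normal_distribution)) borel (\<lambda>x. \<chi> i. x i)"

lemma sets_std_gauss [simp, measurable_cong]: "sets std_gauss = sets borel"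
  by (simp add: std_gauss_def)

lemma vec_lambda_measurable [measurable]:
  "(\<lambda>x. (\<chi> i. x i) :: real^'n) \<in> borel_measurable (PiM UNIV (\<lambda>_. std_normal_distribution))"
proof -
  have "((\<chi> i. x i) :: real^'n) = (\<Sum>i\<in>UNIV. x i *\<^sub>R axis i 1)" for x
    using basis_expansion[of "\<chi> i. x i"] by (simp add: scalar_mult_eq_scaleR)
  then show ?thesis by (simp only:) measurable
qed

lemma prob_space_std_gauss: "prob_space std_gauss"
proof -
  interpret N: real_distribution std_normal_distribution by (rule real_dist_normal_dist)
  show ?thesis
    unfolding std_gauss_def
    by (intro prob_space.prob_space_distr[OF prob_space_PiM] N.prob_space_axioms vec_lambda_measurable)
qed

lemma charv_std_gauss: "charv (std_gauss :: (real^'n) measure) k = complex_of_real (exp (- ((norm k)\<^sup>2 / 2)))"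
proof -
  interpret N: real_distribution std_normal_distribution by (rule real_dist_normal_dist)
  interpret product_prob_space "\<lambda>_::'n. std_normal_distribution" ..
  have "charv (std_gauss :: (real^'n) measure) k
      = (\<integral>x. iexp (k \<bullet> (\<chi> i. x i)) \<partial>PiM UNIV (\<lambda>_. std_normal_distribution))"
    unfolding charv_def std_gauss_def by (subst integral_distr) auto
  also have "\<dots> = (\<integral>x. (\<Prod>i\<in>UNIV. iexp (k $ i * x i)) \<partial>PiM UNIV (\<lambda>_. std_normal_distribution))"
    by (simp add: inner_vec_def exp_sum sum_distrib_left)
  also have "\<dots> = (\<Prod>i\<in>UNIV. char std_normal_distribution (k $ i))"
    unfolding char_def by (rule product_integral_prod) (simp_all add: N.integrable_iexp)
  also have "\<dots> = complex_of_real (\<Prod>i\<in>UNIV. exp (- ((k $ i)\<^sup>2) / 2))"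
    by (simp only: char_std_normal_distribution of_real_prod)
  also have "(\<Prod>i\<in>UNIV. exp (- ((k $ i)\<^sup>2) / 2)) = exp (\<Sum>i\<in>UNIV. - ((k $ i)\<^sup>2) / 2)"
    by (rule exp_sum[symmetric]) simp
  also have "(\<Sum>i\<in>UNIV. - ((k $ i)\<^sup>2) / 2) = - ((norm k)\<^sup>2 / 2)"
    unfolding power2_norm_eq_inner inner_vec_def
    by (simp add: sum_negf sum_divide_distrib power2_eq_square)
  finally show ?thesis .
qed

lemma char_marginal:
  fixes f :: "'a::euclidean_space measure"
  assumes "sets f = sets borel"
  shows "char (distr f borel (\<lambda>v. v \<bullet> u)) s = charv f (s *\<^sub>R u)"
proof -
  note [measurable_cong] = assms
  show ?thesis unfolding char_def charv_def by (subst integral_distr) (auto simp: inner_commute)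
qed

lemma std_gauss_coordinate: "distr (std_gauss :: (real^'n) measure) borel (\<lambda>x. x $ i) = std_normal_distribution"
proof -
  interpret prob_space "std_gauss :: (real^'n) measure" by (rule prob_space_std_gauss)
  have eq: "(\<lambda>x::real^'n. x $ i) = (\<lambda>x. x \<bullet> axis i 1)"
    by (simp add: inner_axis)
  show ?thesis
    unfolding eq
    by (rule Levy_uniqueness[OF real_distribution_distr real_dist_normal_dist])
       (auto simp: char_marginal charv_std_gauss char_std_normal_distribution)
qed

lemma std_gauss_second_moment: "(\<integral>\<^sup>+x. ennreal ((norm x)\<^sup>2) \<partial>(std_gauss :: (real^'n) measure)) = ennreal (real CARD('n))"
proof -
  have coord: "(\<integral>\<^sup>+x. ennreal ((x $ i)\<^sup>2) \<partial>(std_gauss :: (real^'n) measure)) = 1" for i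
  proof -
    have "(\<integral>\<^sup>+x. ennreal ((x $ i)\<^sup>2) \<partial>(std_gauss :: (real^'n) measure))
        = (\<integral>\<^sup>+y. ennreal (y\<^sup>2) \<partial>distr (std_gauss :: (real^'n) measure) borel (\<lambda>x. x $ i))"
      by (subst nn_integral_distr) auto
    also have "\<dots> = ennreal (\<integral>y. y\<^sup>2 \<partial>std_normal_distribution)"
      unfolding std_gauss_coordinate
      using std_normal_distribution_even_moments(2)[of 1] by (intro nn_integral_eq_integral) auto
    also have "(\<integral>y. y\<^sup>2 \<partial>std_normal_distribution) = 1"
      using std_normal_distribution_even_moments(1)[of 1] by simp
    finally show ?thesis by simp
  qed
  have "(\<integral>\<^sup>+x. ennreal ((norm x)\<^sup>2) \<partial>(std_gauss :: (real^'n) measure))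
      = (\<integral>\<^sup>+x. (\<Sum>i\<in>UNIV. ennreal ((x $ i)\<^sup>2)) \<partial>(std_gauss :: (real^'n) measure))"
    unfolding power2_norm_eq_inner inner_vec_def by (simp add: power2_eq_square)
  also have "\<dots> = (\<Sum>i::'n\<in>UNIV. 1)"
    by (subst nn_integral_sum) (auto simp: coord)
  finally show ?thesis by (simp add: ennreal_of_nat_eq_real_of_nat)
qed

text \<open>Mixing over the variance turns a fixed point of the cascade into a radial law: the Laplace
  transform of \<open>N\<close>, taken at \<open>\<bar>k\<bar>\<^sup>2 / 2\<close>, becomes a characteristic function.\<close>

definition gauss_mixture :: "real measure \<Rightarrow> (real^'n) measure" where
  "gauss_mixture N = distr (N \<Otimes>\<^sub>M std_gauss) borel (\<lambda>(m, x). sqrt \<bar>m\<bar> *\<^sub>R x)"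

context
  fixes N :: "real measure"
  assumes N: "real_distribution N"
begin

interpretation N: real_distribution N by (rule N)
interpretation G: prob_space "std_gauss :: (real^'n) measure" by (rule prob_space_std_gauss)

lemma mixture_measurable: "(\<lambda>(m, x). sqrt \<bar>m\<bar> *\<^sub>R x) \<in> borel_measurable (N \<Otimes>\<^sub>M (std_gauss :: (real^'n) measure))"
  by measurable

lemma sets_gauss_mixture: "sets (gauss_mixture N) = sets borel"
  by (simp add: gauss_mixture_def)

lemma prob_space_gauss_mixture: "prob_space (gauss_mixture N :: (real^'n) measure)"
  unfolding gauss_mixture_def
  by (intro prob_space.prob_space_distr prob_space_pair N.prob_space_axioms G.prob_space_axioms mixture_measurable)

lemma charv_gauss_mixture:
  "charv (gauss_mixture N :: (real^'n) measure) k = complex_of_real (laplace N ((norm k)\<^sup>2 / 2))"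
proof -
  have "charv (gauss_mixture N :: (real^'n) measure) k
      = (\<integral>z. iexp (k \<bullet> (case z of (m, x) \<Rightarrow> sqrt \<bar>m\<bar> *\<^sub>R x)) \<partial>(N \<Otimes>\<^sub>M std_gauss))"
    unfolding gauss_mixture_def charv_def
    by (subst integral_distr[OF mixture_measurable]) auto
  also have "\<dots> = (\<integral>m. (\<integral>x. iexp (k \<bullet> (case (m, x) of (m, x) \<Rightarrow> sqrt \<bar>m\<bar> *\<^sub>R x)) \<partial>std_gauss) \<partial>N)"
    by (rule integral_prob_pair[OF N.prob_space_axioms G.prob_space_axioms, where B=1])
       (use mixture_measurable in \<open>auto simp: split_beta'\<close>)
  also have "\<dots> = (\<integral>m. charv std_gauss (sqrt \<bar>m\<bar> *\<^sub>R k) \<partial>N)"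
    by (simp add: charv_def)
  also have "\<dots> = (\<integral>m. complex_of_real (exp (- ((norm k)\<^sup>2 / 2 * \<bar>m\<bar>))) \<partial>N)"
    by (simp add: charv_std_gauss power_mult_distrib mult.commute)
  also have "\<dots> = complex_of_real (laplace N ((norm k)\<^sup>2 / 2))"
    unfolding laplace_def by (rule integral_complex_of_real)
  finally show ?thesis .
qed

lemma nn_integral_gauss_mixture_power:
  "(\<integral>\<^sup>+v. ennreal (norm v ^ (2 * n)) \<partial>(gauss_mixture N :: (real^'n) measure))
    = (\<integral>\<^sup>+m. ennreal (\<bar>m\<bar> ^ n) \<partial>N) * (\<integral>\<^sup>+x. ennreal (norm x ^ (2 * n)) \<partial>(std_gauss :: (real^'n) measure))"
proof -
  have "(\<integral>\<^sup>+v. ennreal (norm v ^ (2 * n)) \<partial>(gauss_mixture N :: (real^'n) measure))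
      = (\<integral>\<^sup>+z. ennreal (norm (case z of (m, x) \<Rightarrow> sqrt \<bar>m\<bar> *\<^sub>R x) ^ (2 * n)) \<partial>(N \<Otimes>\<^sub>M (std_gauss :: (real^'n) measure)))"
    unfolding gauss_mixture_def by (subst nn_integral_distr[OF mixture_measurable]) auto
  also have "\<dots> = (\<integral>\<^sup>+z. ennreal (\<bar>fst z\<bar> ^ n) * ennreal (norm (snd z) ^ (2 * n)) \<partial>(N \<Otimes>\<^sub>M (std_gauss :: (real^'n) measure)))"
    by (intro nn_integral_cong) (auto simp: split_beta' power_mult_distrib power_mult ennreal_mult)
  also have "\<dots> = (\<integral>\<^sup>+m. (\<integral>\<^sup>+x. ennreal (\<bar>m\<bar> ^ n) * ennreal (norm x ^ (2 * n)) \<partial>(std_gauss :: (real^'n) measure)) \<partial>N)"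
    by (subst G.nn_integral_fst[symmetric]) auto
  also have "\<dots> = (\<integral>\<^sup>+m. ennreal (\<bar>m\<bar> ^ n) * (\<integral>\<^sup>+x. ennreal (norm x ^ (2 * n)) \<partial>(std_gauss :: (real^'n) measure)) \<partial>N)"
    by (intro nn_integral_cong nn_integral_cmult) auto
  also have "\<dots> = (\<integral>\<^sup>+m. ennreal (\<bar>m\<bar> ^ n) \<partial>N) * (\<integral>\<^sup>+x. ennreal (norm x ^ (2 * n)) \<partial>(std_gauss :: (real^'n) measure))"
    by (rule nn_integral_multc) auto
  finally show ?thesis .
qed

end

section \<open>Radial laws\<close>

lemma law_inner_cong:
  fixes f :: "'a::euclidean_space measure"
  assumes f: "prob_space f" "sets f = sets borel"
    and radial: "\<And>k l. norm k = norm l \<Longrightarrow> charv f k = charv f l" and n: "norm u = norm w"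
  shows "distr f borel (\<lambda>v. v \<bullet> u) = distr f borel (\<lambda>v. v \<bullet> w)"
proof -
  note [measurable_cong] = f(2)
  interpret prob_space f by (rule f)
  show ?thesis
  proof (rule Levy_uniqueness)
    show "real_distribution (distr f borel (\<lambda>v. v \<bullet> u))" "real_distribution (distr f borel (\<lambda>v. v \<bullet> w))"
      by (intro real_distribution_distr, measurable)+
    show "char (distr f borel (\<lambda>v. v \<bullet> u)) = char (distr f borel (\<lambda>v. v \<bullet> w))"
      using n by (intro ext) (simp only: char_marginal[OF f(2)], intro radial, simp)
  qed
qed

lemma radial_zero_mean:
  assumes f: "prob_space f" "sets f = sets borel"
    and radial: "\<And>k l. norm k = norm l \<Longrightarrow> charv f k = charv f l"
  shows "zero_mean_velocity f"
proof -
  note [measurable_cong] = f(2)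
  interpret prob_space f by (rule f)
  have "charv (distr f borel uminus) k = charv f k" for k
    using radial[of "- k" k] charv_distr[OF f(2), of uminus k] by (simp add: charv_def)
  then have "distr f borel uminus = f"
    by (intro charv_uniqueness finite_measure_axioms prob_space.finite_measure[OF prob_space_distr] f) simp_all
  then have "(\<integral>v. v \<partial>f) = (\<integral>v. v \<partial>distr f borel uminus)"
    by simp
  also have "\<dots> = (\<integral>v. - v \<partial>f)"
    by (rule integral_distr) simp_all
  finally have "(\<integral>v. v \<partial>f) = - (\<integral>v. v \<partial>f)"
    by simp
  then have "2 *\<^sub>R (\<integral>v. v \<partial>f) = 0"
    by (simp add: scaleR_2 eq_neg_iff_add_eq_0)
  then show ?thesis
    by (simp add: zero_mean_velocity_def)
qed

text \<open>Comparing the second moments in the directions \<open>e\<^sub>i + e\<^sub>j\<close> and \<open>e\<^sub>i - e\<^sub>j\<close> shows that the mixed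
  moments vanish.\<close>

lemma radial_unit_pressure:
  fixes f :: "(real^3) measure"
  assumes f: "prob_space f" "sets f = sets borel"
    and radial: "\<And>k l. norm k = norm l \<Longrightarrow> charv f k = charv f l"
    and int: "integrable f (\<lambda>v. (norm v)\<^sup>2)" and m: "(\<integral>v. (norm v)\<^sup>2 \<partial>f) = 3"
  shows "unit_pressure_tensor f"
proof -
  note [measurable_cong] = f(2)
  interpret prob_space f by (rule f)
  define I where "I i j = (\<integral>v. v $ i * v $ j \<partial>f)" for i j
  have ij: "integrable f (\<lambda>v. v $ i * v $ j)" for i j
  proof (rule Bochner_Integration.integrable_bound[OF int])
    show "AE v in f. norm (v $ i * v $ j) \<le> norm ((norm v)\<^sup>2)"
      by (intro AE_I2) (auto simp: abs_mult power2_eq_square intro!: mult_mono component_le_norm_cart)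
  qed measurable
  have Q: "(\<integral>v. (v \<bullet> u)\<^sup>2 \<partial>f) = (\<integral>v. (v \<bullet> w)\<^sup>2 \<partial>f)" if "norm u = norm w" for u w
  proof -
    have *: "(\<integral>v. (v \<bullet> x)\<^sup>2 \<partial>f) = (\<integral>y. y\<^sup>2 \<partial>distr f borel (\<lambda>v. v \<bullet> x))" for x
      by (subst integral_distr) auto
    have "distr f borel (\<lambda>v. v \<bullet> u) = distr f borel (\<lambda>v. v \<bullet> w)"
      by (rule law_inner_cong[OF f _ that]) (rule radial)
    then show ?thesis by (simp only: *)
  qed
  have diag: "I i i = I j j" for i j
    using Q[of "axis i 1" "axis j 1"] by (simp add: I_def inner_axis power2_eq_square)
  have "3 = (\<integral>v. (\<Sum>i\<in>UNIV. v $ i * v $ i) \<partial>f)"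
    using m by (simp add: power2_norm_eq_inner inner_vec_def)
  also have "\<dots> = (\<Sum>i\<in>UNIV. I i i)"
    unfolding I_def by (intro Bochner_Integration.integral_sum ij)
  finally have "3 = (\<Sum>j\<in>(UNIV :: 3 set). I j j)" .
  then have one: "I i i = 1" for i
  proof -
    have "(\<Sum>j\<in>(UNIV :: 3 set). I j j) = (\<Sum>j\<in>(UNIV :: 3 set). I i i)"
      by (intro sum.cong diag refl)
    also have "\<dots> = 3 * I i i" by simp
    finally show ?thesis using \<open>3 = (\<Sum>j\<in>(UNIV :: 3 set). I j j)\<close> by linarith
  qed
  have off: "I i j = 0" if "i \<noteq> j" for i j
  proof -
    have "orthogonal (axis i 1 :: real^3) (axis j 1)"
      using that by (simp add: orthogonal_def inner_axis_axis)
    then have "(norm (axis i 1 + axis j 1 :: real^3))\<^sup>2 = (norm (axis i 1 - axis j 1 :: real^3))\<^sup>2"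
      unfolding orthogonal_def by (simp add: power2_norm_eq_inner inner_simps inner_commute)
    then have "norm (axis i 1 + axis j 1 :: real^3) = norm (axis i 1 - axis j 1 :: real^3)"
      by simp
    from Q[OF this] have "(\<integral>v. (v $ i + v $ j)\<^sup>2 \<partial>f) = (\<integral>v. (v $ i - v $ j)\<^sup>2 \<partial>f)"
      by (simp add: inner_axis inner_add_right inner_diff_right)
    moreover have "(\<integral>v. (v $ i + v $ j)\<^sup>2 \<partial>f) = (\<integral>v. v $ i * v $ i + (v $ j * v $ j + 2 * (v $ i * v $ j)) \<partial>f)"
      by (intro Bochner_Integration.integral_cong) (simp_all add: power2_eq_square algebra_simps)
    moreover have "\<dots> = I i i + (I j j + 2 * I i j)"
      unfolding I_def using ij by simp
    moreover have "(\<integral>v. (v $ i - v $ j)\<^sup>2 \<partial>f) = (\<integral>v. v $ i * v $ i + (v $ j * v $ j - 2 * (v $ i * v $ j)) \<partial>f)"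
      by (intro Bochner_Integration.integral_cong) (simp_all add: power2_eq_square algebra_simps)
    moreover have "\<dots> = I i i + (I j j - 2 * I i j)"
      unfolding I_def using ij by simp
    ultimately show ?thesis by simp
  qed
  show ?thesis
    unfolding unit_pressure_tensor_def using one off by (simp add: vec_eq_iff mat_def I_def)
qed

text \<open>The bound in the expansion of a one-dimensional characteristic function increases with \<open>\<bar>s\<bar>\<close>, so
  that its convergence to \<open>0\<close> along the sequence \<open>1 / n\<close> gives it for all small \<open>s\<close>.\<close>

lemma charv_second_order:
  fixes f :: "(real^3) measure"
  assumes P2: "f \<in> P2" and zero: "zero_mean_velocity f" and unit: "unit_pressure_tensor f"
  defines "err \<equiv> (\<lambda>s. cmod (charv f (s *\<^sub>R axis 1 1) - (1 - s\<^sup>2 / 2)))"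
  shows "err s \<le> s\<^sup>2" and "0 < \<epsilon> \<Longrightarrow> \<exists>\<delta>>0. \<forall>s. \<bar>s\<bar> \<le> \<delta> \<longrightarrow> err s \<le> \<epsilon> * s\<^sup>2"
proof -
  have f: "prob_space f" "sets f = sets borel" and int: "integrable f (\<lambda>v. (norm v)\<^sup>2)"
    using P2 by (auto simp: P2_def)
  note [measurable_cong] = f(2)
  interpret prob_space f by (rule f)
  define X where "X v = v $ 1" for v :: "real^3"
  have X [measurable]: "X \<in> borel_measurable f" unfolding X_def by measurable
  have X2: "integrable f (\<lambda>v. (X v)\<^sup>2)"
  proof (rule Bochner_Integration.integrable_bound[OF int])
    show "AE v in f. norm ((X v)\<^sup>2) \<le> norm ((norm v)\<^sup>2)"
    proof (rule AE_I2)
      fix v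
      show "norm ((X v)\<^sup>2) \<le> norm ((norm v)\<^sup>2)"
        using power_mono[OF component_le_norm_cart[of v 1] abs_ge_zero, of 2] by (simp add: X_def)
    qed
  qed measurable
  have X1: "integrable f X"
    using X X2 by (rule square_integrable_imp_integrable)
  have iv: "integrable f (\<lambda>v. v)"
  proof -
    have "integrable f norm"
      by (rule square_integrable_imp_integrable[OF _ int]) measurable
    then show ?thesis
      by (rule integrable_norm_cancel) measurable
  qed
  have mean: "expectation X = 0"
  proof -
    have "expectation X = (\<integral>v. v \<bullet> axis 1 1 \<partial>f)" by (simp add: X_def[abs_def] inner_axis)
    also have "\<dots> = (\<integral>v. v \<partial>f) \<bullet> axis 1 1" using iv by simp
    finally show ?thesis using zero by (simp add: zero_mean_velocity_def)
  qed
  have sq: "expectation (\<lambda>v. (X v)\<^sup>2) = 1"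
    using unit unfolding unit_pressure_tensor_def
    by (simp add: vec_eq_iff mat_def X_def power2_eq_square)
  have var: "variance X = 1" using mean sq by simp
  define h where "h s = expectation (\<lambda>v. min (6 * (X v)\<^sup>2) (\<bar>s\<bar> * \<bar>X v\<bar> ^ 3))" for s
  have ih: "integrable f (\<lambda>v. min (6 * (X v)\<^sup>2) (\<bar>s\<bar> * \<bar>X v\<bar> ^ 3))" for s
    by (rule Bochner_Integration.integrable_bound[OF integrable_mult_right[OF X2, of 6]])
       (auto simp: min_def)
  have err: "err s \<le> s\<^sup>2 / 6 * h s" for s
  proof -
    have "charv f (s *\<^sub>R axis 1 1) = char (distr f borel X) s"
      by (simp add: char_marginal[OF f(2), symmetric] X_def[abs_def] inner_axis)
    then show ?thesis
      using char_approx3'[OF X X1 X2 mean var refl, of s] by (simp add: err_def h_def)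
  qed
  have "h s \<le> expectation (\<lambda>v. 6 * (X v)\<^sup>2)" for s
    unfolding h_def using ih X2 by (intro integral_mono) auto
  then have h6: "h s \<le> 6" for s using sq by simp
  have "s\<^sup>2 / 6 * h s \<le> s\<^sup>2 / 6 * 6"
    by (intro mult_left_mono h6) simp
  then show "err s \<le> s\<^sup>2" using err[of s] by simp
  have h_mono: "h s \<le> h t" if "\<bar>s\<bar> \<le> \<bar>t\<bar>" for s t
    unfolding h_def using that by (intro integral_mono ih min.mono mult_right_mono) auto
  have lim: "(\<lambda>n. h (inverse (real (Suc n)))) \<longlonglongrightarrow> expectation (\<lambda>v. 0)"
    unfolding h_def
  proof (rule integral_dominated_convergence[where w="\<lambda>v. 6 * (X v)\<^sup>2"])
    show "AE v in f. (\<lambda>n. min (6 * (X v)\<^sup>2) (\<bar>inverse (real (Suc n))\<bar> * \<bar>X v\<bar> ^ 3)) \<longlonglongrightarrow> 0"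
    proof (rule AE_I2)
      fix v
      have "(\<lambda>n. min (6 * (X v)\<^sup>2) (\<bar>inverse (real (Suc n))\<bar> * \<bar>X v\<bar> ^ 3))
          \<longlonglongrightarrow> min (6 * (X v)\<^sup>2) (\<bar>0\<bar> * \<bar>X v\<bar> ^ 3)"
        by (intro tendsto_intros LIMSEQ_inverse_real_of_nat)
      moreover have "min (6 * (X v)\<^sup>2) (\<bar>0\<bar> * \<bar>X v\<bar> ^ 3) = 0" by simp
      ultimately show "(\<lambda>n. min (6 * (X v)\<^sup>2) (\<bar>inverse (real (Suc n))\<bar> * \<bar>X v\<bar> ^ 3)) \<longlonglongrightarrow> 0"
        by (simp only:)
    qed
  qed (use X2 in \<open>auto simp: min_def\<close>)
  show "\<exists>\<delta>>0. \<forall>s. \<bar>s\<bar> \<le> \<delta> \<longrightarrow> err s \<le> \<epsilon> * s\<^sup>2" if "0 < \<epsilon>"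
  proof -
    have "eventually (\<lambda>n. h (inverse (real (Suc n))) < \<epsilon>) sequentially"
      using lim that by (intro order_tendstoD(2)) auto
    then obtain n where n: "h (inverse (real (Suc n))) < \<epsilon>"
      by (auto simp: eventually_sequentially)
    have "err s \<le> \<epsilon> * s\<^sup>2" if "\<bar>s\<bar> \<le> inverse (real (Suc n))" for s
    proof -
      have "h s \<le> \<epsilon>"
        using h_mono[of s "inverse (real (Suc n))"] n that by simp
      then have "s\<^sup>2 / 6 * h s \<le> s\<^sup>2 / 6 * \<epsilon>"
        by (intro mult_left_mono) auto
      also have "\<dots> \<le> \<epsilon> * s\<^sup>2" using \<open>0 < \<epsilon>\<close> by (simp add: field_simps)
      finally show ?thesis using err[of s] by simp
    qed
    then show ?thesis by (intro exI[of _ "inverse (real (Suc n))"]) auto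
  qed
qed
section \<open>The steady state\<close>

text \<open>Both functions expand as \<open>1 - t + o(t)\<close>, so that their distance meets the hypotheses of
  \<open>cascade_uniqueness\<close>.\<close>

lemma (in cascade) fixed_point_unique:
  fixes \<Phi> \<Psi> :: "real \<Rightarrow> complex"
  assumes [measurable]: "\<Phi> \<in> borel_measurable borel" "\<Psi> \<in> borel_measurable borel"
    and le_1: "\<And>t. 0 \<le> t \<Longrightarrow> cmod (\<Phi> t) \<le> 1" "\<And>t. 0 \<le> t \<Longrightarrow> cmod (\<Psi> t) \<le> 1"
    and fixed: "\<And>t. 0 \<le> t \<Longrightarrow> \<Phi> t = (\<integral>p. \<Phi> (a p * t) * \<Phi> (b p * t) \<partial>P)"
      "\<And>t. 0 \<le> t \<Longrightarrow> \<Psi> t = (\<integral>p. \<Psi> (a p * t) * \<Psi> (b p * t) \<partial>P)"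
    and linear: "\<And>t. 0 \<le> t \<Longrightarrow> cmod (\<Phi> t - (1 - t)) \<le> 2 * t" "\<And>t. 0 \<le> t \<Longrightarrow> cmod (\<Psi> t - (1 - t)) \<le> 2 * t"
    and small: "\<And>\<epsilon>. 0 < \<epsilon> \<Longrightarrow> \<exists>\<delta>>0. \<forall>t. 0 \<le> t \<and> t < \<delta> \<longrightarrow> cmod (\<Phi> t - (1 - t)) \<le> \<epsilon> * t"
      "\<And>\<epsilon>. 0 < \<epsilon> \<Longrightarrow> \<exists>\<delta>>0. \<forall>t. 0 \<le> t \<and> t < \<delta> \<longrightarrow> cmod (\<Psi> t - (1 - t)) \<le> \<epsilon> * t"
    and t: "0 \<le> t"
  shows "\<Phi> t = \<Psi> t"
proof -
  define D where "D t = cmod (\<Phi> t - \<Psi> t)" for t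
  have tri: "D t \<le> cmod (\<Phi> t - (1 - t)) + cmod (\<Psi> t - (1 - t))" for t
    unfolding D_def using norm_triangle_ineq4[of "\<Phi> t - (1 - t)" "\<Psi> t - (1 - t)"] by simp
  have D: "D \<in> borel_measurable borel" unfolding D_def by measurable
  note [measurable] = D
  have "D t = 0"
  proof (rule cascade_uniqueness[OF D _ _ _ _ t])
    show "0 \<le> D t" for t by (simp add: D_def)
    show "D t \<le> 4 * t" if "0 \<le> t" for t
      using tri[of t] linear(1)[OF that] linear(2)[OF that] by linarith
    show "\<exists>\<delta>>0. \<forall>t. 0 \<le> t \<and> t < \<delta> \<longrightarrow> D t \<le> \<epsilon> * t" if "0 < \<epsilon>" for \<epsilon>
    proof -
      have "0 < \<epsilon> / 2" using that by simp
      obtain \<delta> where \<delta>: "0 < \<delta>" "\<And>t. 0 \<le> t \<Longrightarrow> t < \<delta> \<Longrightarrow> cmod (\<Phi> t - (1 - t)) \<le> \<epsilon> / 2 * t"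
        using small(1)[OF \<open>0 < \<epsilon> / 2\<close>] by blast
      obtain \<delta>' where \<delta>': "0 < \<delta>'" "\<And>t. 0 \<le> t \<Longrightarrow> t < \<delta>' \<Longrightarrow> cmod (\<Psi> t - (1 - t)) \<le> \<epsilon> / 2 * t"
        using small(2)[OF \<open>0 < \<epsilon> / 2\<close>] by blast
      have "D t \<le> \<epsilon> * t" if "0 \<le> t" "t < min \<delta> \<delta>'" for t
        using tri[of t] \<delta>(2)[of t] \<delta>'(2)[of t] that by simp
      then show ?thesis using \<delta>(1) \<delta>'(1) by (intro exI[of _ "min \<delta> \<delta>'"]) auto
    qed
    show "D t \<le> (\<integral>p. D (a p * t) + D (b p * t) \<partial>P)" if t: "0 \<le> t" for t
    proof -
      have ab: "0 \<le> a p * t" "0 \<le> b p * t" for p using a_nonneg b_nonneg t by simp_all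
      have i: "integrable P (\<lambda>p. \<Phi> (a p * t) * \<Phi> (b p * t))" "integrable P (\<lambda>p. \<Psi> (a p * t) * \<Psi> (b p * t))"
        using le_1 ab by (auto intro!: integrable_const_bound[where B=1] AE_I2 mult_le_one simp: norm_mult)
      have "D t = cmod (\<integral>p. \<Phi> (a p * t) * \<Phi> (b p * t) - \<Psi> (a p * t) * \<Psi> (b p * t) \<partial>P)"
        unfolding D_def fixed[OF t] using i by simp
      also have "\<dots> \<le> (\<integral>p. cmod (\<Phi> (a p * t) * \<Phi> (b p * t) - \<Psi> (a p * t) * \<Psi> (b p * t)) \<partial>P)"
        by (rule integral_norm_bound)
      also have "\<dots> \<le> (\<integral>p. D (a p * t) + D (b p * t) \<partial>P)"
      proof (rule integral_mono)
        show "integrable P (\<lambda>p. cmod (\<Phi> (a p * t) * \<Phi> (b p * t) - \<Psi> (a p * t) * \<Psi> (b p * t)))"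
          using i by (intro integrable_norm Bochner_Integration.integrable_diff)
        have "D s \<le> 2" if "0 \<le> s" for s
          unfolding D_def using le_1[OF that] norm_triangle_ineq4[of "\<Phi> s" "\<Psi> s"] by linarith
        then have "D (a p * t) + D (b p * t) \<le> 2 + 2" for p
          by (meson add_mono ab)
        moreover have "0 \<le> D s" for s by (simp add: D_def)
        ultimately have "norm (D (a p * t) + D (b p * t)) \<le> 2 + 2" for p
          by simp
        then show "integrable P (\<lambda>p. D (a p * t) + D (b p * t))"
          by (intro integrable_const_bound[where B="2 + 2"]) auto
        show "cmod (\<Phi> (a p * t) * \<Phi> (b p * t) - \<Psi> (a p * t) * \<Psi> (b p * t)) \<le> D (a p * t) + D (b p * t)" for p
          unfolding D_def using le_1 ab by (intro norm_diff_mult_le) auto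
      qed
      finally show ?thesis .
    qed
  qed
  then show ?thesis by (simp add: D_def)
qed

text \<open>The radial profile of a characteristic function, in the variable \<open>t = \<bar>k\<bar>\<^sup>2 / 2\<close>.\<close>

definition profile :: "(real^3) measure \<Rightarrow> real \<Rightarrow> complex" where
  "profile f t = charv f (sqrt (2 * t) *\<^sub>R axis 1 1)"

lemma profile_measurable [measurable]:
  assumes "prob_space f" "sets f = sets borel"
  shows "profile f \<in> borel_measurable borel"
proof -
  note [measurable] = charv_measurable[OF assms]
  show ?thesis unfolding profile_def[abs_def] by measurable
qed

lemma charv_eq_profile:
  assumes "\<And>k l. norm k = norm l \<Longrightarrow> charv f k = charv f l"
  shows "charv f k = profile f ((norm k)\<^sup>2 / 2)"
  unfolding profile_def by (rule assms) simp

lemma profile_second_order: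
  assumes f: "f \<in> P2" "zero_mean_velocity f" "unit_pressure_tensor f"
  shows "0 \<le> t \<Longrightarrow> cmod (profile f t - (1 - t)) \<le> 2 * t"
    and "0 < \<epsilon> \<Longrightarrow> \<exists>\<delta>>0. \<forall>t. 0 \<le> t \<and> t < \<delta> \<longrightarrow> cmod (profile f t - (1 - t)) \<le> \<epsilon> * t"
proof -
  show "cmod (profile f t - (1 - t)) \<le> 2 * t" if "0 \<le> t"
    using charv_second_order(1)[OF f, of "sqrt (2 * t)"] that by (simp add: profile_def)
  assume "0 < \<epsilon>"
  then obtain \<delta> where \<delta>: "0 < \<delta>"
    "\<And>s. \<bar>s\<bar> \<le> \<delta> \<Longrightarrow> cmod (charv f (s *\<^sub>R axis 1 1) - (1 - s\<^sup>2 / 2)) \<le> \<epsilon> / 2 * s\<^sup>2"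
    using charv_second_order(2)[OF f, of "\<epsilon> / 2"] by auto
  have "cmod (profile f t - (1 - t)) \<le> \<epsilon> * t" if t: "0 \<le> t" "t < \<delta>\<^sup>2 / 2" for t
  proof -
    have "sqrt (2 * t) \<le> sqrt (\<delta>\<^sup>2)" using t by (intro real_sqrt_le_mono) simp
    then have "\<bar>sqrt (2 * t)\<bar> \<le> \<delta>" using \<delta>(1) t by simp
    from \<delta>(2)[OF this] show ?thesis using t by (simp add: profile_def)
  qed
  then show "\<exists>\<delta>>0. \<forall>t. 0 \<le> t \<and> t < \<delta> \<longrightarrow> cmod (profile f t - (1 - t)) \<le> \<epsilon> * t"
    using \<delta>(1) by (intro exI[of _ "\<delta>\<^sup>2 / 2"]) auto
qed

lemma profile_steady_state:
  assumes mu: "prob_space \<mu>" "sets \<mu> = sets borel" and f: "prob_space f" "sets f = sets borel"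
    and radial: "\<And>k l. norm k = norm l \<Longrightarrow> charv f k = charv f l"
  shows "steady_state e \<mu> f \<longleftrightarrow>
    (\<forall>t\<ge>0. profile f t = (\<integral>p. profile f (share1 e p * t) * profile f (share2 e p * t) \<partial>(\<mu> \<Otimes>\<^sub>M unif_interval)))"
    (is "_ \<longleftrightarrow> (\<forall>t\<ge>0. profile f t = ?R t)")
proof -
  interpret particle_law e \<mu> f by (rule particle_law.intro[OF mu f])
  have coll: "charv (collide e \<mu> f) k = ?R ((norm k)\<^sup>2 / 2)" for k
    by (rule charv_collide[OF charv_eq_profile[OF radial] profile_measurable[OF f]])
  have "collide e \<mu> f = f \<longleftrightarrow> (\<forall>k. charv (collide e \<mu> f) k = charv f k)"
    using charv_uniqueness[of "collide e \<mu> f" f] f prob_space_collide sets_collide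
    by (metis prob_space.finite_measure)
  also have "\<dots> \<longleftrightarrow> (\<forall>t\<ge>0. profile f t = ?R t)"
  proof (intro iffI allI impI)
    fix t :: real assume eq: "\<forall>k. charv (collide e \<mu> f) k = charv f k" and t: "0 \<le> t"
    have "(norm (sqrt (2 * t) *\<^sub>R axis 1 1 :: real^3))\<^sup>2 / 2 = t" using t by simp
    then show "profile f t = ?R t"
      using coll[of "sqrt (2 * t) *\<^sub>R axis 1 1"] eq by (simp add: profile_def)
  next
    fix k :: "real^3" assume "\<forall>t\<ge>0. profile f t = ?R t"
    then have "profile f ((norm k)\<^sup>2 / 2) = ?R ((norm k)\<^sup>2 / 2)" by simp
    moreover have "charv f k = profile f ((norm k)\<^sup>2 / 2)"
      by (rule charv_eq_profile[OF radial])
    ultimately show "charv (collide e \<mu> f) k = charv f k"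
      by (simp only: coll)
  qed
  finally show ?thesis unfolding steady_state_iff .
qed
theorem corollary5p14:
  fixes e \<beta> :: real and \<mu> :: "real measure"
  assumes e: "0 \<le> e" "e \<le> 1"
    and law: "prob_space \<mu>" "sets \<mu> = sets borel"
    and supp: "AE \<eta> in \<mu>. - e \<le> \<eta>"
    and mean: "integrable \<mu> (\<lambda>\<eta>. \<eta>)" "(\<integral>\<eta>. \<eta> \<partial>\<mu>) = 0"
    and variance: "integrable \<mu> (\<lambda>\<eta>. \<eta>\<^sup>2)" "(\<integral>\<eta>. \<eta>\<^sup>2 \<partial>\<mu>) = \<beta>\<^sup>2"
    and conservative: "\<beta>\<^sup>2 = 1 - e\<^sup>2"
    and A_gt: "frakA 2 e \<mu> > 1"
    and A_lt: "\<exists>\<alpha>. 0 < \<alpha> \<and> \<alpha> < 2 \<and> frakA \<alpha> e \<mu> < 1"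
  shows "\<exists>f. f \<in> P2 \<and> steady_state e \<mu> f \<and> isotropic f \<and>
             zero_mean_velocity f \<and> unit_pressure_tensor f \<and>
             (\<forall>g. g \<in> P2 \<and> steady_state e \<mu> g \<and> isotropic g \<and>
                  zero_mean_velocity g \<and> unit_pressure_tensor g \<longrightarrow> g = f) \<and>
             (\<integral>\<^sup>+v. ennreal ((norm v) ^ 4) \<partial>f) = \<infinity>"
proof -
  obtain \<alpha> where \<alpha>: "0 < \<alpha>" "\<alpha> < 2" "frakA \<alpha> e \<mu> < 1" using A_lt by blast
  define q where "q = 1 + \<alpha> / 2"
  let ?P = "\<mu> \<Otimes>\<^sub>M unif_interval"
  let ?a = "share1 e" and ?b = "share2 e"
  note [measurable] = share_measurable[OF law(2)]
  have a0: "0 \<le> ?a p" and b0: "0 \<le> ?b p" for p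
    by (auto simp: share1_def share2_def split: prod.split)
  have moment_q: "(\<integral>\<^sup>+p. ennreal (?a p powr q + ?b p powr q) \<partial>?P) < 1"
    using \<alpha>(3) frakA_eq[OF law supp, of \<alpha>] \<alpha>(1) by (simp add: q_def)
  have moment_1: "(\<integral>\<^sup>+p. ennreal (?a p + ?b p) \<partial>?P) = 1"
    using frakA_0[OF law mean variance(1) _ supp] variance(2) conservative frakA_eq[OF law supp, of 0] a0 b0
    by simp
  have moment_2: "1 < (\<integral>\<^sup>+p. ennreal ((?a p)\<^sup>2 + (?b p)\<^sup>2) \<partial>?P)"
    using A_gt frakA_eq[OF law supp, of 2] a0 b0 by (simp add: powr_numeral)
  have int_ab: "integrable ?P (\<lambda>p. ?a p + ?b p)"
    using moment_1 a0 b0 by (intro integrableI_bounded) (auto simp: abs_of_nonneg)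
  have int_q: "integrable ?P (\<lambda>p. ?a p powr q + ?b p powr q)"
    using moment_q by (intro integrableI_bounded) (auto simp: abs_of_nonneg intro: less_trans)
  interpret C: cascade ?P ?a ?b q
  proof (intro cascade.intro cascade_axioms.intro)
    show "prob_space ?P" by (intro prob_space_pair law prob_space_unif_interval)
    show "?a \<in> borel_measurable ?P" "?b \<in> borel_measurable ?P" by measurable
    show "0 \<le> ?a p" "0 \<le> ?b p" for p by (rule a0, rule b0)
    show "integrable ?P ?a" "integrable ?P ?b"
      using a0 b0 by (auto intro!: Bochner_Integration.integrable_bound[OF int_ab])
    show "(\<integral>p. ?a p + ?b p \<partial>?P) = 1"
      using nn_integral_eq_integral[OF int_ab] moment_1 a0 b0 by simp
    show "1 < q" "q < 2" using \<alpha> by (simp_all add: q_def)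
    show "integrable ?P (\<lambda>p. ?a p powr q + ?b p powr q)" by (rule int_q)
    show "(\<integral>p. ?a p powr q + ?b p powr q \<partial>?P) < 1"
      using nn_integral_eq_integral[OF int_q] moment_q by (simp add: ennreal_less_one_iff)
  qed
  obtain N where N: "real_distribution N"
    and fixed: "\<And>t. 0 \<le> t \<Longrightarrow> laplace N t = (\<integral>p. laplace N (?a p * t) * laplace N (?b p * t) \<partial>?P)"
    and close: "\<And>t. 0 \<le> t \<Longrightarrow> \<bar>laplace N t - exp (- t)\<bar> \<le> C.limit_constant * t powr q"
    using C.fixed_point_exists by blast
  have N1: "(\<integral>\<^sup>+x. ennreal \<bar>x\<bar> \<partial>N) = 1"
    by (rule C.fixed_point_mean[OF N close])
  have N2: "(\<integral>\<^sup>+x. ennreal (x\<^sup>2) \<partial>N) = \<infinity>"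
    by (rule C.fixed_point_second_moment[OF N fixed N1 moment_2])
  define f where "f = (gauss_mixture N :: (real^3) measure)"
  have f: "prob_space f" "sets f = sets borel"
    unfolding f_def by (rule prob_space_gauss_mixture[OF N], rule sets_gauss_mixture[OF N])
  have charv_f: "charv f k = complex_of_real (laplace N ((norm k)\<^sup>2 / 2))" for k
    unfolding f_def by (rule charv_gauss_mixture[OF N])
  have radial_f: "charv f k = charv f l" if "norm k = norm l" for k l
    by (simp add: charv_f that)
  have profile_f: "profile f t = complex_of_real (laplace N t)" if "0 \<le> t" for t
    using that by (simp add: profile_def charv_f)
  have second: "(\<integral>\<^sup>+v. ennreal ((norm v)\<^sup>2) \<partial>f) = 3"
    unfolding f_def using nn_integral_gauss_mixture_power[OF N, of 1, where 'n=3] N1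
    by (simp add: std_gauss_second_moment)
  have int2: "integrable f (\<lambda>v. (norm v)\<^sup>2)"
    using second f(2) by (intro integrableI_bounded) (auto cong: measurable_cong_sets)
  have P2_f: "f \<in> P2"
    using f int2 by (simp add: P2_def)
  have "ennreal (\<integral>v. (norm v)\<^sup>2 \<partial>f) = ennreal 3"
    using nn_integral_eq_integral[OF int2] second by simp
  then have "(\<integral>v. (norm v)\<^sup>2 \<partial>f) = 3"
    by (subst (asm) ennreal_inj) simp_all
  then have unit_f: "unit_pressure_tensor f"
    using radial_unit_pressure[OF f radial_f int2] by blast
  have zero_f: "zero_mean_velocity f"
    using radial_zero_mean[OF f radial_f] by blast
  have iso_f: "isotropic f"
    unfolding isotropic_def
  proof (intro allI impI)
    fix R :: "real^3^3" assume R: "rotation_matrix R"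
    have [measurable]: "(*v) R \<in> borel_measurable borel"
      by (intro borel_measurable_continuous_onI matrix_vector_mult_linear_continuous_on)
    have "norm (transpose R *v k) = norm k" for k
    proof -
      have "orthogonal_matrix (transpose R)"
        using R by (simp add: rotation_matrix_def)
      then have "orthogonal_transformation ((*v) (transpose R))"
        by (simp add: orthogonal_transformation_matrix)
      then show ?thesis by (rule orthogonal_transformation_norm)
    qed
    then have "charv (distr f borel ((*v) R)) k = charv f k" for k
      unfolding charv_rotation[OF f(2)] by (rule radial_f)
    moreover have "prob_space (distr f borel ((*v) R))"
      using f by (intro prob_space.prob_space_distr) (auto cong: measurable_cong_sets)
    ultimately show "distr f borel ((*v) R) = f"
      using f by (intro charv_uniqueness prob_space.finite_measure) simp_all
  qed
  have fixed_f: "profile f t = (\<integral>p. profile f (?a p * t) * profile f (?b p * t) \<partial>?P)" if t: "0 \<le> t" for t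
  proof -
    have "(\<integral>p. profile f (?a p * t) * profile f (?b p * t) \<partial>?P)
        = (\<integral>p. complex_of_real (laplace N (?a p * t) * laplace N (?b p * t)) \<partial>?P)"
      using a0 b0 t by (simp add: profile_f)
    also have "\<dots> = complex_of_real (laplace N t)"
      unfolding fixed[OF t] by (rule integral_complex_of_real)
    finally show ?thesis using profile_f[OF t] by simp
  qed
  then have steady_f: "steady_state e \<mu> f"
    using profile_steady_state[OF law f radial_f] by blast
  have unique: "g = f" if g: "g \<in> P2" "steady_state e \<mu> g" "isotropic g" "zero_mean_velocity g" "unit_pressure_tensor g" for g
  proof -
    have g': "prob_space g" "sets g = sets borel" using g(1) by (auto simp: P2_def)
    have radial_g: "charv g k = charv g l" if "norm k = norm l" for k l
      by (rule isotropic_charv[OF g'(2) g(3) that])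
    have fixed_g: "profile g t = (\<integral>p. profile g (?a p * t) * profile g (?b p * t) \<partial>?P)" if "0 \<le> t" for t
      using profile_steady_state[OF law g' radial_g] g(2) that by blast
    have "profile g t = profile f t" if t: "0 \<le> t" for t
    proof (rule C.fixed_point_unique[OF _ _ _ _ fixed_g fixed_f _ _ _ _ t])
      show "profile g \<in> borel_measurable borel" "profile f \<in> borel_measurable borel"
        by (rule profile_measurable[OF g'], rule profile_measurable[OF f])
      show "cmod (profile g t) \<le> 1" "cmod (profile f t) \<le> 1" for t
        unfolding profile_def by (rule charv_le_1[OF g'], rule charv_le_1[OF f])
    qed (use profile_second_order[OF g(1,4,5)] profile_second_order[OF P2_f zero_f unit_f] in blast)+
    then have "charv g k = charv f k" for k
      using charv_eq_profile[of g k, OF radial_g] charv_eq_profile[of f k, OF radial_f] by simp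
    then show "g = f"
      using f g' by (intro charv_uniqueness prob_space.finite_measure)
  qed
  have fourth: "(\<integral>\<^sup>+v. ennreal ((norm v) ^ 4) \<partial>f) = \<infinity>"
  proof -
    have "(\<integral>\<^sup>+x. ennreal (norm x ^ 4) \<partial>(std_gauss :: (real^3) measure)) \<noteq> 0"
    proof
      assume "(\<integral>\<^sup>+x. ennreal (norm x ^ 4) \<partial>(std_gauss :: (real^3) measure)) = 0"
      then have "AE x in (std_gauss :: (real^3) measure). x = 0"
        by (subst (asm) nn_integral_0_iff_AE) (auto elim!: eventually_mono)
      then have "(\<integral>\<^sup>+x. ennreal ((norm x)\<^sup>2) \<partial>(std_gauss :: (real^3) measure)) = (\<integral>\<^sup>+x. 0 \<partial>(std_gauss :: (real^3) measure))"
        by (intro nn_integral_cong_AE) (auto elim!: eventually_mono)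
      then show False by (simp add: std_gauss_second_moment)
    qed
    then show ?thesis
      unfolding f_def using nn_integral_gauss_mixture_power[OF N, of 2, where 'n=3] N2
      by (simp add: ennreal_top_mult)
  qed
  show ?thesis
    using P2_f steady_f iso_f zero_f unit_f unique fourth by blast
qed

end
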